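(* Let $f$ be a smooth function with rational asymmetric logarithmic singularity at $x_1$ (defined in the context). For $\alpha\in[0,1)$ irrational, $q\in\mathbb{Q}$ and $N\in\mathbb{N}$, let $g(N)=\min_{n\le N}\|n\alpha+q-x_1\|$ and $A_N=(x_1-g(N),x_1+g(N))$ (taken modulo $1$). Then for almost every $\alpha\in[0,1)$ and every $0<r<1$ there exists $C(r)=C(r,f,q)>0$ such that both sets $$\Big\{N: S_N(f,\alpha,q)\ge C(r)\sup_{x\in[0,1)\setminus A_N}|f(x)|\sum_{i=1}^{K(N)}a_i+N\Big|\int_{A_N}f(x)\,dx\Big|\Big\},$$ $$\Big\{N: S_N(f,\alpha,q)\le -C(r)\sup_{x\in[0,1)\setminus A_N}|f(x)|\sum_{i=1}^{K(N)}a_i-N\Big|\int_{A_N}f(x)\,dx\Big|\Big\}$$ have upper density at least $r$.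
   Context: $\{x\}$ is the fractional part and $\|x\|$ the distance to the nearest integer. A $1$-periodic $f$ with $\int_0^1 f=0$ is a smooth function with rational logarithmic singularity at $x_1\in\mathbb{Q}$ if $f(x)=c_1\log\|x-x_1\|+c_2\log\{x-x_1\}+t(x)$ for $x\not\equiv x_1\pmod1$ and $f(x)=t(x)$ otherwise, with constants $c_1,c_2$ and $t$ $1$-periodic of bounded variation on $[0,1)$; it is asymmetric if $c_2\ne0$. For $\alpha=[a_0;a_1,\dots]$ with convergent denominators $q_0=1,q_1=a_1,q_{k+1}=a_{k+1}q_k+q_{k-1}$, $K(N)$ is the integer with $q_{K-1}\le N<q_K$. $S_N(f,\alpha,q):=\sum_{n=1}^N f(n\alpha+q)-N\int_0^1 f$. The upper density of $A\subseteq\mathbb{N}$ is $\limsup_{M\to\infty}|\{N\le M:N\in A\}|/M$. *)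

theory Defs
  imports "HOL-Analysis.Analysis" "HOL-Library.Liminf_Limsup"
begin

definition dist_int :: "real \<Rightarrow> real" where
  "dist_int x = min (frac x) (1 - frac x)"

definition bounded_variation_on :: "(real \<Rightarrow> real) \<Rightarrow> real set \<Rightarrow> bool" where
  "bounded_variation_on t S \<longleftrightarrow>
     (\<exists>B. \<forall>xs. sorted xs \<and> set xs \<subseteq> S \<longrightarrow>
        (\<Sum>i<length xs - 1. \<bar>t (xs ! Suc i) - t (xs ! i)\<bar>) \<le> B)"

definition one_periodic :: "(real \<Rightarrow> real) \<Rightarrow> bool" where
  "one_periodic f \<longleftrightarrow> (\<forall>x. f (x + 1) = f x)"

text \<open>Smooth function with rational logarithmic singularity at x1 (context definition),
  including the standing assumptions: 1-periodic with zero mean on [0,1].\<close>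
definition smooth_log_sing :: "(real \<Rightarrow> real) \<Rightarrow> real \<Rightarrow> real \<Rightarrow> real \<Rightarrow> bool" where
  "smooth_log_sing f x1 c1 c2 \<longleftrightarrow>
     x1 \<in> \<rat> \<and> one_periodic f \<and> (f has_integral 0) {0..1} \<and>
     (\<exists>t. one_periodic t \<and> bounded_variation_on t {0..<1} \<and>
        (\<forall>x. (x - x1 \<notin> \<int> \<longrightarrow> f x = c1 * ln (dist_int (x - x1)) + c2 * ln (frac (x - x1)) + t x)
           \<and> (x - x1 \<in> \<int> \<longrightarrow> f x = t x)))"

definition asym_log_sing :: "(real \<Rightarrow> real) \<Rightarrow> real \<Rightarrow> bool" where
  "asym_log_sing f x1 \<longleftrightarrow> (\<exists>c1 c2. c2 \<noteq> 0 \<and> smooth_log_sing f x1 c1 c2)"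

fun cf_rem :: "real \<Rightarrow> nat \<Rightarrow> real" where
  "cf_rem x 0 = x"
| "cf_rem x (Suc n) = 1 / frac (cf_rem x n)"

definition cf_digit :: "real \<Rightarrow> nat \<Rightarrow> nat" where
  "cf_digit x n = nat \<lfloor>cf_rem x n\<rfloor>"

fun cf_denom :: "real \<Rightarrow> nat \<Rightarrow> nat" where
  "cf_denom x 0 = 1"
| "cf_denom x (Suc 0) = cf_digit x 1"
| "cf_denom x (Suc (Suc k)) = cf_digit x (Suc (Suc k)) * cf_denom x (Suc k) + cf_denom x k"

definition cf_K :: "real \<Rightarrow> nat \<Rightarrow> nat" where
  "cf_K x N = (THE K. 1 \<le> K \<and> cf_denom x (K - 1) \<le> N \<and> N < cf_denom x K)"

definition S_N :: "(real \<Rightarrow> real) \<Rightarrow> real \<Rightarrow> real \<Rightarrow> nat \<Rightarrow> real" where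
  "S_N f \<alpha> q N = (\<Sum>n=1..N. f (real n * \<alpha> + q)) - real N * integral {0..1} f"

definition gmin :: "real \<Rightarrow> real \<Rightarrow> real \<Rightarrow> nat \<Rightarrow> real" where
  "gmin \<alpha> q x1 N = Min ((\<lambda>n. dist_int (real n * \<alpha> + q - x1)) ` {1..N})"

text \<open>[0,1) minus A_N, where A_N = (x1 - g, x1 + g) taken modulo 1.\<close>
definition outside_A :: "real \<Rightarrow> real \<Rightarrow> real set" where
  "outside_A x1 g = {x \<in> {0..<1}. \<not> dist_int (x - x1) < g}"

definition upper_density :: "nat set \<Rightarrow> ereal" where
  "upper_density A = limsup (\<lambda>M. ereal (real (card {N \<in> A. 1 \<le> N \<and> N \<le> M}) / real M))"

end

theory Submission
  imports Defs
begin

text \<open>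
For almost every \<open>\<alpha>\<close> there are infinitely many convergents \<open>p\<^sub>k / q\<^sub>k\<close> of prescribed parity whose denominator is
divisible by the denominator \<open>d\<close> of \<open>q - x1\<close> and for which the next digit \<open>a\<^sub>k\<^sub>+\<^sub>1\<close> exceeds any given multiple of
\<open>a\<^sub>1 + \<dots> + a\<^sub>k\<close>. Given any initial digits, two further digits of size at most \<open>d\<close> produce the
divisibility; the digit sum is \<open>O(k ln k)\<close> with conditional probability at least one half, and the next digit then exceeds
\<open>C k ln k\<close> with conditional probability about \<open>1 / (C k ln k)\<close>, whose sum diverges. So the event has probability bounded
below uniformly on all cylinders, hence has full measure.

For such \<open>k\<close> and \<open>N\<close> up to a small multiple of \<open>a\<^sub>k\<^sub>+\<^sub>1 q\<^sub>k\<close>, each block of \<open>q\<^sub>k\<close> consecutive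
orbit points is the lattice of multiples of \<open>1 / q\<^sub>k\<close> (translated so that it contains the singularity) pushed slightly to
one side. By Stirling's formula the block sum of the one-sided logarithm \<open>ln {y}\<close> deviates from its mean by about \<open>-(ln q\<^sub>k) / 2\<close>
or \<open>+(ln q\<^sub>k) / 2\<close> according to the side. The two one-sided singularities of \<open>f\<close> have different coefficients, so
these deviations do not cancel and they have a fixed sign determined by the parity of \<open>k\<close>. The incomplete block is controlled by the
Denjoy--Koksma inequality applied to truncated logarithms.
\<close>

section \<open>Continued fractions\<close>

text \<open>Both sides of the inequality live on the scale \<open>a * ln q\<close>, where
  \<open>a\<close> is the dominating digit and \<open>q\<close> the denominator before it, so only
  constants are at stake. For \<open>N\<close> comparable to \<open>\<epsilon> * a * q\<close> a
  positive share of \<open>a\<close> complete blocks adds up with one sign. The incomplete block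
  costs the sum of the earlier digits times \<open>ln q\<close>; this is why a single digit must
  dominate that sum. On the other side the digit sum up to \<open>K(N)\<close> is at most
  \<open>2 * a\<close>, while the supremum and \<open>N\<close> times the integral are
  \<open>O(ln q)\<close>, because the orbit keeps a distance of order \<open>1 / (a * q^2)\<close>
  from the singularity and \<open>ln a = O(ln q)\<close>. The last fact holds for almost every
  \<alpha> by Borel--Cantelli. The estimate is uniform for \<open>N\<close> between
  \<open>(1 - r) * M\<close> and \<open>M\<close>, which yields density \<open>r\<close> at the
  price of a constant proportional to \<open>1 - r\<close>. Divisibility by \<open>d\<close> is
  essential to the method: a lattice that misses the singularity by half a step would produce no
  logarithmic deviation.\<close>

definition Irr :: "real set" where
  "Irr = {x. 0 < x \<and> x < 1 \<and> x \<notin> \<rat>}"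

text \<open>For \<open>x\<close> in \<open>Irr\<close> this is the n-th iterate of the Gauss map
  \<open>t \<mapsto> frac (1 / t)\<close> at \<open>x\<close>.\<close>

definition gauss :: "real \<Rightarrow> nat \<Rightarrow> real" where
  "gauss x n = frac (cf_rem x n)"

lemma frac_in_Rats_iff: "frac (x::real) \<in> \<rat> \<longleftrightarrow> x \<in> \<rat>"
proof
  assume "frac x \<in> \<rat>"
  moreover have "x = frac x + of_int \<lfloor>x\<rfloor>" by (simp add: frac_def)
  ultimately show "x \<in> \<rat>" by (metis Rats_add Rats_of_int)
next
  assume "x \<in> \<rat>"
  then show "frac x \<in> \<rat>" unfolding frac_def by (intro Rats_diff Rats_of_int)
qed

lemma cf_rem_irrational: "x \<in> Irr \<Longrightarrow> cf_rem x n \<notin> \<rat>"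
proof (induction n)
  case 0
  then show ?case by (simp add: Irr_def)
next
  case (Suc n)
  then have "frac (cf_rem x n) \<notin> \<rat>" by (simp add: frac_in_Rats_iff)
  then show ?case
    by (metis Rats_inverse cf_rem.simps(2) inverse_eq_divide inverse_inverse_eq)
qed

lemma gauss_in_Irr:
  assumes "x \<in> Irr"
  shows "gauss x n \<in> Irr"
proof -
  have nr: "gauss x n \<notin> \<rat>"
    using cf_rem_irrational[OF assms] by (simp add: gauss_def frac_in_Rats_iff)
  then have "gauss x n \<noteq> 0" by (metis Rats_0)
  then show ?thesis
    using nr frac_lt_1[of "cf_rem x n"] frac_ge_0[of "cf_rem x n"]
    by (auto simp: Irr_def gauss_def less_le)
qed

lemma gauss_pos: "x \<in> Irr \<Longrightarrow> 0 < gauss x n" and gauss_less_1: "x \<in> Irr \<Longrightarrow> gauss x n < 1"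
  using gauss_in_Irr by (auto simp: Irr_def)

lemma gauss_0: "x \<in> Irr \<Longrightarrow> gauss x 0 = x"
  by (simp add: gauss_def Irr_def frac_eq)

lemma cf_rem_Suc: "cf_rem x (Suc n) = 1 / gauss x n"
  by (simp add: gauss_def)

lemma cf_rem_Suc_gt_1: "x \<in> Irr \<Longrightarrow> 1 < cf_rem x (Suc n)"
  using gauss_pos[of x n] gauss_less_1[of x n] by (simp add: gauss_def)

lemma cf_digit_Suc_pos: "x \<in> Irr \<Longrightarrow> 1 \<le> cf_digit x (Suc n)"
  using cf_rem_Suc_gt_1[of x n] unfolding cf_digit_def by linarith

lemma cf_digit_pos: "x \<in> Irr \<Longrightarrow> 1 \<le> n \<Longrightarrow> 1 \<le> cf_digit x n"
  using cf_digit_Suc_pos[of x "n - 1"] by simp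

lemma inverse_gauss:
  assumes "x \<in> Irr"
  shows "1 / gauss x n = real (cf_digit x (Suc n)) + gauss x (Suc n)"
proof -
  have "real (cf_digit x (Suc n)) = of_int \<lfloor>cf_rem x (Suc n)\<rfloor>"
    using cf_rem_Suc_gt_1[OF assms, of n] unfolding cf_digit_def by linarith
  then show ?thesis
    by (simp add: gauss_def frac_def)
qed

text \<open>Irrationality rules out \<open>1 / gauss x n = real m\<close>, so the floor condition
  becomes a strict bound, and digit events become open intervals up to rationals.\<close>

lemma cf_digit_ge_iff:
  assumes "x \<in> Irr" "1 \<le> m"
  shows "m \<le> cf_digit x (Suc n) \<longleftrightarrow> gauss x n < 1 / real m"
proof -
  have "m \<le> cf_digit x (Suc n) \<longleftrightarrow> real m \<le> cf_rem x (Suc n)"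
    using cf_rem_Suc_gt_1[OF assms(1), of n] unfolding cf_digit_def by linarith
  also have "\<dots> \<longleftrightarrow> real m < cf_rem x (Suc n)"
    using cf_rem_irrational[OF assms(1), of "Suc n"] by (metis Rats_of_nat less_le)
  also have "\<dots> \<longleftrightarrow> gauss x n < 1 / real m"
    unfolding cf_rem_Suc using gauss_pos[OF assms(1), of n] assms(2) by (simp add: field_simps)
  finally show ?thesis .
qed

text \<open>The state is (current, previous); the start values \<open>(1, 0)\<close> and \<open>(0, 1)\<close> give denominators and numerators,
with \<open>a\<^sub>0 = 0\<close>.\<close>

primrec cpair :: "(nat \<Rightarrow> nat) \<Rightarrow> nat \<times> nat \<Rightarrow> nat \<Rightarrow> nat \<times> nat" where
  "cpair c v 0 = v"
| "cpair c v (Suc n) = (c (Suc n) * fst (cpair c v n) + snd (cpair c v n), fst (cpair c v n))"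

abbreviation den :: "(nat \<Rightarrow> nat) \<Rightarrow> nat \<Rightarrow> nat" where "den c n \<equiv> fst (cpair c (1, 0) n)"
abbreviation den' :: "(nat \<Rightarrow> nat) \<Rightarrow> nat \<Rightarrow> nat" where "den' c n \<equiv> snd (cpair c (1, 0) n)"
abbreviation num :: "(nat \<Rightarrow> nat) \<Rightarrow> nat \<Rightarrow> nat" where "num c n \<equiv> fst (cpair c (0, 1) n)"
abbreviation num' :: "(nat \<Rightarrow> nat) \<Rightarrow> nat \<Rightarrow> nat" where "num' c n \<equiv> snd (cpair c (0, 1) n)"

lemma cf_denom_eq_den: "cf_denom x n = den (cf_digit x) n"
  by (induction x n rule: cf_denom.induct) auto

lemma cpair_cong:
  "(\<And>i. 1 \<le> i \<Longrightarrow> i \<le> n \<Longrightarrow> c i = c' i) \<Longrightarrow> cpair c v n = cpair c' v n"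
  by (induction n) auto

text \<open>Appending a digit multiplies the matrix of the two state pairs by one of determinant
  -1.\<close>

lemma den_det: "int (num' c n) * int (den c n) - int (num c n) * int (den' c n) = (- 1) ^ n"
  by (induction n) (auto simp: algebra_simps)

lemma den_det_real: "real (num' c n) * real (den c n) - real (num c n) * real (den' c n) = (- 1) ^ n"
  using arg_cong[OF den_det[of c n], of real_of_int] by simp

lemma coprime_num_den: "coprime (int (num c n)) (int (den c n))"
proof (rule coprimeI)
  fix d assume "d dvd int (num c n)" "d dvd int (den c n)"
  then have "d dvd int (num' c n) * int (den c n) - int (num c n) * int (den' c n)"
    by (intro dvd_diff) auto
  then have "d dvd (- 1) ^ n" by (simp only: den_det)
  then show "is_unit d" by (metis dvd_trans is_unit_power_iff dvd_minus_iff dvd_refl)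
qed

lemma coprime_den_den': "coprime (den c n) (den' c n)"
proof (rule coprimeI)
  fix d assume "d dvd den c n" "d dvd den' c n"
  then have "int d dvd int (num' c n) * int (den c n) - int (num c n) * int (den' c n)"
    by (intro dvd_diff) auto
  then have "int d dvd (- 1) ^ n" by (simp only: den_det)
  then have "is_unit (int d)" by (metis dvd_trans is_unit_power_iff dvd_minus_iff dvd_refl)
  then show "is_unit d" by simp
qed

lemma den_bounds:
  assumes "\<And>i. 1 \<le> i \<Longrightarrow> i \<le> n \<Longrightarrow> 1 \<le> c i"
  shows "1 \<le> den c n \<and> den' c n \<le> den c n"
  using assms
proof (induction n)
  case (Suc n)
  then have IH: "1 \<le> den c n" "1 \<le> c (Suc n)" by auto
  have "1 * den c n \<le> c (Suc n) * den c n" using IH(2) by (intro mult_right_mono) simp_all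
  then have "den c n \<le> c (Suc n) * den c n + den' c n" by linarith
  moreover have "1 \<le> c (Suc n) * den c n + den' c n" using IH(1) calculation by linarith
  ultimately show ?case by simp
qed simp

lemma den_ge:
  assumes "\<And>i. 1 \<le> i \<Longrightarrow> 1 \<le> c i"
  shows "n \<le> den c n"
proof -
  have b: "1 \<le> den c k" for k using den_bounds[of k c] assms by auto
  show ?thesis
  proof (induction n)
    case (Suc n)
    have "1 * den c n \<le> c (Suc n) * den c n" using assms[of "Suc n"] by (intro mult_right_mono) simp_all
    then have m: "n \<le> c (Suc n) * den c n" using Suc by linarith
    \<comment> \<open>The previous denominator starts at 0 and is positive only from index 1 on; the
      step from 0 to 1 is settled by positivity alone.\<close>
    have 1: "n = 0 \<or> 1 \<le> den' c n" using b by (cases n) simp_all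
    have 2: "den c (Suc n) = c (Suc n) * den c n + den' c n" by simp
    show ?case
    proof (cases "n = 0")
      case True
      then show ?thesis using b[of "Suc n"] by simp
    next
      case False
      then show ?thesis unfolding 2 using 1 m by linarith
    qed
  qed simp
qed

text \<open>The finite continued fraction \<open>1 / (c 1 + 1 / (c 2 + ... + 1 / (c n + t)))\<close>
  with a real tail \<open>t\<close>, that is, an inverse branch of the n-th iterate of the Gauss
  map.\<close>

definition cf_moebius :: "(nat \<Rightarrow> nat) \<Rightarrow> nat \<Rightarrow> real \<Rightarrow> real" where
  "cf_moebius c n t = (real (num c n) + t * real (num' c n)) / (real (den c n) + t * real (den' c n))"

lemma cf_moebius_denom_pos:
  assumes "\<And>i. 1 \<le> i \<Longrightarrow> i \<le> n \<Longrightarrow> 1 \<le> c i" "0 \<le> t"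
  shows "0 < real (den c n) + t * real (den' c n)"
proof -
  have "1 \<le> den c n" using den_bounds[of n c] assms(1) by blast
  then show ?thesis using assms(2) by (simp add: add_pos_nonneg)
qed

lemma cf_moebius_diff:
  assumes "\<And>i. 1 \<le> i \<Longrightarrow> i \<le> n \<Longrightarrow> 1 \<le> c i" "0 \<le> s" "0 \<le> t"
  shows "cf_moebius c n t - cf_moebius c n s = (- 1) ^ n * (t - s)
    / ((real (den c n) + t * real (den' c n)) * (real (den c n) + s * real (den' c n)))"
proof -
  define Q where "Q = real (den c n)"
  define Q' where "Q' = real (den' c n)"
  define P where "P = real (num c n)"
  define P' where "P' = real (num' c n)"
  have pos: "0 < Q + t * Q'" "0 < Q + s * Q'"
    using cf_moebius_denom_pos[of n c t] cf_moebius_denom_pos[of n c s] assms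
    by (auto simp: Q_def Q'_def)
  have "(P + t * P') * (Q + s * Q') - (P + s * P') * (Q + t * Q') = (P' * Q - P * Q') * (t - s)"
    by (simp add: algebra_simps)
  also have "P' * Q - P * Q' = (- 1) ^ n"
    using den_det_real[of c n] by (simp add: Q_def Q'_def P_def P'_def)
  finally have "(P + t * P') / (Q + t * Q') - (P + s * P') / (Q + s * Q')
      = (- 1) ^ n * (t - s) / ((Q + t * Q') * (Q + s * Q'))"
    using pos by (simp add: diff_frac_eq)
  then show ?thesis
    by (simp add: cf_moebius_def P_def P'_def Q_def Q'_def)
qed

lemma cf_moebius_Suc:
  assumes "\<And>i. 1 \<le> i \<Longrightarrow> i \<le> Suc n \<Longrightarrow> 1 \<le> c i" "0 \<le> t"
  shows "cf_moebius c (Suc n) t = cf_moebius c n (1 / (real (c (Suc n)) + t))"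
proof -
  define z where "z = real (c (Suc n)) + t"
  have z: "z > 0" using assms(1)[of "Suc n"] assms(2) by (simp add: z_def)
  have *: "u + 1 / z * v = (u * z + v) / z" for u v :: real
    using z by (simp add: add_divide_distrib)
  have "cf_moebius c n (1 / z) = (real (num c n) * z + real (num' c n)) / (real (den c n) * z + real (den' c n))"
    unfolding cf_moebius_def * using z by simp
  then show ?thesis
    by (simp add: cf_moebius_def z_def algebra_simps)
qed

lemma eq_cf_moebius_gauss:
  assumes "x \<in> Irr"
  shows "x = cf_moebius (cf_digit x) n (gauss x n)"
proof (induction n)
  case 0
  show ?case using gauss_0[OF assms] by (simp add: cf_moebius_def)
next
  case (Suc n)
  have "gauss x n = 1 / (real (cf_digit x (Suc n)) + gauss x (Suc n))"
    using inverse_gauss[OF assms, of n] gauss_pos[OF assms, of n]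
    by (metis div_by_1 divide_divide_eq_right mult_1)
  then show ?case
    using Suc cf_moebius_Suc[of n "cf_digit x" "gauss x (Suc n)"] cf_digit_pos[OF assms]
      gauss_pos[OF assms, of "Suc n"] by simp
qed

text \<open>Uniqueness of the expansion. The last digit is absorbed into the tail
  \<open>1 / (c n + t)\<close>; once that tail is known to be a Gauss iterate, comparing integer
  parts of reciprocals recovers the digit and \<open>t\<close>.\<close>

lemma cf_moebius_eqD:
  assumes "x \<in> Irr" "\<And>i. 1 \<le> i \<Longrightarrow> i \<le> n \<Longrightarrow> 1 \<le> c i"
    and "x = cf_moebius c n t" "0 < t" "t < 1"
  shows "gauss x n = t \<and> (\<forall>i. 1 \<le> i \<and> i \<le> n \<longrightarrow> cf_digit x i = c i)"
  using assms(2-)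
proof (induction n arbitrary: t)
  case 0
  then show ?case using gauss_0[OF assms(1)] by (simp add: cf_moebius_def)
next
  case (Suc n)
  define s where "s = 1 / (real (c (Suc n)) + t)"
  have c1: "1 \<le> c (Suc n)" using Suc.prems(1) by auto
  then have "1 < real (c (Suc n)) + t" using Suc.prems(3) by linarith
  then have s: "0 < s" "s < 1" by (auto simp: s_def)
  have "x = cf_moebius c n s"
    using cf_moebius_Suc[of n c t] Suc.prems by (simp add: s_def)
  then have IH: "gauss x n = s" "\<forall>i. 1 \<le> i \<and> i \<le> n \<longrightarrow> cf_digit x i = c i"
    using Suc.IH[of s] Suc.prems(1) s by auto
  have eq: "real (c (Suc n)) + t = real (cf_digit x (Suc n)) + gauss x (Suc n)"
    using inverse_gauss[OF assms(1), of n] by (simp add: IH(1) s_def)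
  have "cf_digit x (Suc n) = c (Suc n)"
    using eq Suc.prems(3,4) gauss_pos[OF assms(1), of "Suc n"] gauss_less_1[OF assms(1), of "Suc n"]
    by linarith
  then show ?case using eq IH(2) by (auto simp: le_Suc_eq)
qed

text \<open>Tail \<open>gauss x n\<close> gives \<open>x\<close> and tail 0 gives the convergent, so
  the error is a difference of two values of \<open>cf_moebius\<close>. The exact form is kept
  because the sign and bounds from both sides are needed later.\<close>

lemma cf_approx:
  assumes "x \<in> Irr"
  defines "c \<equiv> cf_digit x"
  shows "x - real (num c n) / real (den c n)
    = (- 1) ^ n / (real (den c n) * (real (den c (Suc n)) + gauss x (Suc n) * real (den c n)))"
proof -
  have c1: "\<And>i. 1 \<le> i \<Longrightarrow> 1 \<le> c i" using cf_digit_pos[OF assms(1)] by (simp add: c_def)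
  have g: "0 < gauss x n" using gauss_pos[OF assms(1)] by auto
  define z where "z = real (cf_digit x (Suc n)) + gauss x (Suc n)"
  have z: "1 / gauss x n = z" unfolding z_def by (rule inverse_gauss[OF assms(1)])
  have zp: "z > 0" using z g by (metis zero_less_divide_1_iff)
  have gz: "gauss x n = 1 / z" using z g by auto
  have q: "real (den c n) > 0" using den_bounds[of n c] c1 by fastforce
  have "x - real (num c n) / real (den c n) = cf_moebius c n (gauss x n) - cf_moebius c n 0"
    using eq_cf_moebius_gauss[OF assms(1), of n] by (simp add: cf_moebius_def c_def)
  also have "\<dots> = (- 1) ^ n * gauss x n
    / ((real (den c n) + gauss x n * real (den' c n)) * real (den c n))"
    using cf_moebius_diff[of n c 0 "gauss x n"] c1 g by simp
  also have "\<dots> = (- 1) ^ n / (real (den c n) * (z * real (den c n) + real (den' c n)))"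
    using zp q by (simp add: gz field_simps)
  also have "z * real (den c n) + real (den' c n) = real (den c (Suc n)) + gauss x (Suc n) * real (den c n)"
    by (simp add: z_def c_def algebra_simps)
  finally show ?thesis .
qed

section \<open>Measure of cylinder sets\<close>

lemma cf_moebius_in_unit:
  assumes "\<And>i. 1 \<le> i \<Longrightarrow> i \<le> n \<Longrightarrow> 1 \<le> c i" "0 < t" "t < 1"
  shows "0 < cf_moebius c n t \<and> cf_moebius c n t < 1"
  using assms
proof (induction n arbitrary: t)
  case 0
  then show ?case by (simp add: cf_moebius_def)
next
  case (Suc n)
  define s where "s = 1 / (real (c (Suc n)) + t)"
  have "1 \<le> c (Suc n)" using Suc.prems(1) by auto
  then have "1 < real (c (Suc n)) + t" using Suc.prems(2) by linarith
  then have "0 < s" "s < 1" by (auto simp: s_def)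
  then show ?case
    using Suc.IH[of s] cf_moebius_Suc[of n c t] Suc.prems by (simp add: s_def)
qed

definition digits :: "nat \<Rightarrow> real \<Rightarrow> nat list" where
  "digits n x = map (cf_digit x) [1..<Suc n]"

text \<open>Named by a point instead of a digit word: for \<open>x\<close> in \<open>Irr\<close> it
  is never empty and its digits are positive.\<close>

definition cylinder :: "nat \<Rightarrow> real \<Rightarrow> real set" where
  "cylinder n x = {y \<in> Irr. digits n y = digits n x}"

lemma digits_eq_iff: "digits n x = digits n y \<longleftrightarrow> (\<forall>i. 1 \<le> i \<and> i \<le> n \<longrightarrow> cf_digit x i = cf_digit y i)"
  unfolding digits_def by (auto simp: less_Suc_eq_le)

lemma digits_Suc: "digits (Suc n) x = digits n x @ [cf_digit x (Suc n)]"
  by (simp add: digits_def)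

lemma digits_take: "n \<le> k \<Longrightarrow> digits n x = take n (digits k x)"
  by (simp add: digits_def take_map take_upt del: upt_Suc)

lemma cpair_digits: "digits n x = digits n y \<Longrightarrow> cpair (cf_digit x) v n = cpair (cf_digit y) v n"
  by (rule cpair_cong) (simp add: digits_eq_iff)

lemma Irr_borel: "Irr \<in> sets borel"
proof -
  have e: "Irr = {0<..<1} - (\<rat> :: real set)" by (auto simp: Irr_def)
  have "(\<rat> :: real set) \<in> sets lborel"
    by (rule null_setsD2, rule countable_imp_null_set_lborel, rule countable_rat)
  then show ?thesis unfolding e by (intro sets.Diff) simp_all
qed

lemma Irr_fmeasurable:
  assumes "Z \<in> sets borel" "Z \<subseteq> Irr"
  shows "Z \<in> fmeasurable lborel"
proof (rule fmeasurableI2)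
  show "{0<..<1::real} \<in> fmeasurable lborel" by (simp add: fmeasurable_def)
qed (use assms in \<open>auto simp: Irr_def\<close>)

text \<open>The set is the image of the tails \<open>0 < t < 1 / m\<close> under a monotone inverse
  branch, hence an interval up to rationals. The branch increases or decreases with the parity of
  \<open>n\<close>; the factor \<open>(- 1) ^ n\<close> in \<open>g\<close> treats both at once. The
  case \<open>m = 1\<close> is the whole cylinder.\<close>

lemma measure_cylinder_ge:
  fixes x :: real and m n :: nat
  assumes x: "x \<in> Irr" and m: "1 \<le> m"
  defines "c \<equiv> cf_digit x"
  defines "Z \<equiv> {y \<in> cylinder n x. m \<le> cf_digit y (Suc n)}"
  shows "Z \<in> sets borel" (is ?A)
    and "measure lborel Z = 1 / (real (den c n) * (real m * real (den c n) + real (den' c n)))" (is ?B)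
proof -
  have c1: "\<And>i. 1 \<le> i \<Longrightarrow> 1 \<le> c i" using cf_digit_pos[OF x] by (simp add: c_def)
  define g where "g = (\<lambda>t. (- 1) ^ n * cf_moebius c n t)"
  define M where "M = real m"
  have M: "M \<ge> 1" using m by (simp add: M_def)
  define Q where "Q = real (den c n)"
  define Q' where "Q' = real (den' c n)"
  have Q: "Q > 0" "Q' \<ge> 0" using den_bounds[of n c] c1 by (force simp: Q_def Q'_def)+
  have gdiff: "g t - g s = (t - s) / ((Q + t * Q') * (Q + s * Q'))" if "0 \<le> s" "0 \<le> t" for s t
  proof -
    have "g t - g s = (- 1) ^ n * (cf_moebius c n t - cf_moebius c n s)"
      by (simp add: g_def algebra_simps)
    also have "\<dots> = ((- 1) ^ n * (- 1) ^ n) * (t - s) / ((Q + t * Q') * (Q + s * Q'))"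
      using cf_moebius_diff[of n c s t] c1 that by (simp add: Q_def Q'_def)
    also have "(- 1) ^ n * (- 1) ^ n = (1::real)" by (simp flip: power_mult_distrib)
    finally show ?thesis by simp
  qed
  have gmono: "g s < g t" if "0 \<le> s" "s < t" for s t
  proof -
    have "0 < (t - s) / ((Q + t * Q') * (Q + s * Q'))"
      using that Q by (intro divide_pos_pos mult_pos_pos add_pos_nonneg) auto
    then show ?thesis using gdiff[of s t] that by simp
  qed
  define J where "J = {y. g 0 < (- 1) ^ n * y \<and> (- 1) ^ n * y < g (1 / M)}"
  have Jeq: "J = (if even n then {g 0<..<g (1 / M)} else {- g (1 / M)<..<- g 0})"
    by (auto simp: J_def)
  have g0M: "g 0 \<le> g (1 / M)" using gmono[of 0 "1 / M"] M by simp
  have Jm: "J \<in> sets borel" by (simp add: Jeq)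
  have mJ: "measure lborel J = g (1 / M) - g 0"
    using g0M by (simp add: Jeq)
  have "Z = J - \<rat>"
  proof (intro equalityI subsetI)
    fix y assume "y \<in> Z"
    then have y: "y \<in> Irr" "digits n y = digits n x" "gauss y n < 1 / M"
      using m by (auto simp: Z_def cylinder_def cf_digit_ge_iff M_def)
    have "y = cf_moebius c n (gauss y n)"
      using eq_cf_moebius_gauss[OF y(1), of n] cpair_digits[OF y(2)]
      by (simp add: cf_moebius_def c_def)
    then have "g (gauss y n) = (- 1) ^ n * y" by (simp add: g_def)
    then have "y \<in> J"
      using gmono[of 0 "gauss y n"] gmono[of "gauss y n" "1 / M"] y(3) gauss_pos[OF y(1), of n]
      by (simp add: J_def)
    then show "y \<in> J - \<rat>" using y(1) by (simp add: Irr_def)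
  next
    fix y assume y: "y \<in> J - \<rat>"
    have "continuous_on {0..1/M} g"
      unfolding g_def cf_moebius_def
      using cf_moebius_denom_pos[of n c] c1 by (intro continuous_intros) force
    \<comment> \<open>Every point of the interval comes from some tail. The open ends exclude
      \<open>t = 0\<close> and \<open>t = 1 / M\<close>, after which uniqueness of the expansion
      identifies \<open>t\<close> as the Gauss iterate of \<open>y\<close>.\<close>
    then obtain t where t: "0 \<le> t" "t \<le> 1 / M" "g t = (- 1) ^ n * y"
      using IVT'[of g 0 "(- 1) ^ n * y" "1 / M"] y M by (auto simp: J_def)
    have "t \<noteq> 0" "t \<noteq> 1 / M" using y t(3) by (auto simp: J_def)
    then have t': "0 < t" "t < 1 / M" using t by auto
    have "1 / M \<le> 1" using M by simp
    then have t1: "t < 1" using t' by linarith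
    have yt: "y = cf_moebius c n t" using t(3) by (simp add: g_def)
    then have yI: "y \<in> Irr" using y cf_moebius_in_unit[of n c t] c1 t' t1 by (auto simp: Irr_def)
    have "gauss y n = t \<and> (\<forall>i. 1 \<le> i \<and> i \<le> n \<longrightarrow> cf_digit y i = c i)"
      using cf_moebius_eqD[OF yI, of n c t] c1 yt t' t1 by auto
    then show "y \<in> Z"
      using yI t' m by (auto simp: Z_def cylinder_def cf_digit_ge_iff digits_eq_iff c_def M_def)
  qed
  moreover have Qn: "(\<rat> :: real set) \<in> null_sets lborel"
    by (intro countable_imp_null_set_lborel countable_rat)
  ultimately show ?A using Jm by auto
  have "measure lborel Z = measure lborel J"
    using \<open>Z = J - \<rat>\<close> Jm Qn by (simp add: measure_Diff_null_set)
  also have "\<dots> = (1 / M) / ((Q + 1 / M * Q') * Q)" using mJ gdiff[of 0 "1 / M"] M by simp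
  also have "(Q + 1 / M * Q') = (M * Q + Q') / M" using M by (simp add: field_simps)
  also have "(1 / M) / ((M * Q + Q') / M * Q) = 1 / (Q * (M * Q + Q'))" using M by simp
  finally show ?B by (simp add: Q_def Q'_def M_def)
qed

lemma cylinder_eq_ge: "cylinder n x = {y \<in> cylinder n x. 1 \<le> cf_digit y (Suc n)}"
  using cf_digit_pos[of _ "Suc n"] by (auto simp: cylinder_def)

lemma cylinder_borel: "x \<in> Irr \<Longrightarrow> cylinder n x \<in> sets borel"
  using measure_cylinder_ge(1)[of x 1 n] by (subst cylinder_eq_ge) simp

lemma measure_cylinder:
  assumes "x \<in> Irr"
  defines "c \<equiv> cf_digit x"
  shows "measure lborel (cylinder n x) = 1 / (real (den c n) * (real (den c n) + real (den' c n)))"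
  using measure_cylinder_ge(2)[OF assms(1), of 1 n] by (subst cylinder_eq_ge) (simp add: c_def)

text \<open>The quotient of the two measures is \<open>(Q + Q') / (m * Q + Q')\<close>, and
  \<open>0 \<le> Q' \<le> Q\<close> confines it between \<open>1 / m\<close> and
  \<open>2 / m\<close> whatever the earlier digits are. This bounded distortion replaces
  independence of the digits.\<close>

lemma cylinder_ge_bounds:
  assumes "x \<in> Irr" "1 \<le> m"
  shows "measure lborel {y \<in> cylinder n x. m \<le> cf_digit y (Suc n)} \<le> 2 / real m * measure lborel (cylinder n x)"
    and "1 / real m * measure lborel (cylinder n x) \<le> measure lborel {y \<in> cylinder n x. m \<le> cf_digit y (Suc n)}"
proof -
  define Q where "Q = real (den (cf_digit x) n)"
  define Q' where "Q' = real (den' (cf_digit x) n)"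
  define M where "M = real m"
  have M: "M \<ge> 1" using assms(2) by (simp add: M_def)
  have Q: "Q \<ge> 1" "Q' \<ge> 0" "Q' \<le> Q"
    using den_bounds[of n "cf_digit x"] cf_digit_pos[OF assms(1)] by (force simp: Q_def Q'_def)+
  have e1: "measure lborel {y \<in> cylinder n x. m \<le> cf_digit y (Suc n)} = 1 / (Q * (M * Q + Q'))"
    using measure_cylinder_ge(2)[OF assms] by (simp add: Q_def Q'_def M_def)
  have e2: "measure lborel (cylinder n x) = 1 / (Q * (Q + Q'))"
    using measure_cylinder[OF assms(1)] by (simp add: Q_def Q'_def)
  have "M * (Q + Q') \<le> 2 * (M * Q + Q')"
  proof -
    have "M * Q' \<le> M * Q" using Q M by (intro mult_left_mono) auto
    then show ?thesis using Q by (simp add: algebra_simps)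
  qed
  moreover have p: "0 < M * (Q + Q')" "0 < M * Q + Q'" "0 < Q"
    using M Q by (auto intro!: add_pos_nonneg mult_pos_pos)
  ultimately have "1 / (M * Q + Q') \<le> 2 / (M * (Q + Q'))"
    by (simp add: field_simps)
  then have "1 / (M * Q + Q') / Q \<le> 2 / (M * (Q + Q')) / Q"
    using p by (intro divide_right_mono) auto
  then show "measure lborel {y \<in> cylinder n x. m \<le> cf_digit y (Suc n)} \<le> 2 / real m * measure lborel (cylinder n x)"
    unfolding e1 e2 M_def[symmetric] by (simp add: field_simps)
  have "1 * Q' \<le> M * Q'" using M Q by (intro mult_right_mono) auto
  then have "M * Q + Q' \<le> M * (Q + Q')" by (simp add: algebra_simps)
  then have "1 / (M * (Q + Q')) \<le> 1 / (M * Q + Q')" using p by (simp add: frac_le)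
  then have "1 / (M * (Q + Q')) / Q \<le> 1 / (M * Q + Q') / Q"
    using p by (intro divide_right_mono) auto
  then show "1 / real m * measure lborel (cylinder n x) \<le> measure lborel {y \<in> cylinder n x. m \<le> cf_digit y (Suc n)}"
    unfolding e1 e2 M_def[symmetric] by (simp add: field_simps)
qed

text \<open>Subtracting the measures for thresholds \<open>u\<close> and \<open>Suc u\<close> gives
  the share \<open>Q * (Q + Q') / ((u * Q + Q') * ((u + 1) * Q + Q'))\<close>. The first factor of
  the denominator is at most \<open>d * (Q + Q')\<close>, the second at most
  \<open>(d + 1) * (2 * Q)\<close>.\<close>

lemma cylinder_eq_bound:
  assumes "x \<in> Irr" "1 \<le> u" "u \<le> d"
  shows "1 / (2 * real d * (real d + 1)) * measure lborel (cylinder n x)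
    \<le> measure lborel {y \<in> cylinder n x. cf_digit y (Suc n) = u}"
proof -
  define Q where "Q = real (den (cf_digit x) n)"
  define Q' where "Q' = real (den' (cf_digit x) n)"
  define M where "M = real u"
  have M: "M \<ge> 1" "M \<le> real d" using assms(2,3) by (auto simp: M_def)
  have Q: "Q \<ge> 1" "Q' \<ge> 0" "Q' \<le> Q"
    using den_bounds[of n "cf_digit x"] cf_digit_pos[OF assms(1)] by (force simp: Q_def Q'_def)+
  define Z1 where "Z1 = {y \<in> cylinder n x. u \<le> cf_digit y (Suc n)}"
  define Z2 where "Z2 = {y \<in> cylinder n x. Suc u \<le> cf_digit y (Suc n)}"
  have Z1: "Z1 \<in> fmeasurable lborel" and Z2: "Z2 \<in> fmeasurable lborel"
    using measure_cylinder_ge(1)[OF assms(1,2), of n] measure_cylinder_ge(1)[OF assms(1), of "Suc u" n]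
    by (auto simp: Z1_def Z2_def cylinder_def intro!: Irr_fmeasurable)
  have "{y \<in> cylinder n x. cf_digit y (Suc n) = u} = Z1 - Z2" by (auto simp: Z1_def Z2_def)
  moreover have "Z2 \<subseteq> Z1" by (auto simp: Z1_def Z2_def)
  ultimately have e: "measure lborel {y \<in> cylinder n x. cf_digit y (Suc n) = u} = measure lborel Z1 - measure lborel Z2"
    using measurable_measure_Diff[OF Z1 fmeasurableD[OF Z2]] by simp
  have e1: "measure lborel Z1 = 1 / (Q * (M * Q + Q'))"
    using measure_cylinder_ge(2)[OF assms(1,2)] by (simp add: Q_def Q'_def M_def Z1_def)
  have e3: "measure lborel Z2 = 1 / (Q * ((M + 1) * Q + Q'))"
    using measure_cylinder_ge(2)[OF assms(1), of "Suc u" n] by (simp add: Q_def Q'_def M_def Z2_def add.commute)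
  have e2: "measure lborel (cylinder n x) = 1 / (Q * (Q + Q'))"
    using measure_cylinder[OF assms(1)] by (simp add: Q_def Q'_def)
  have p: "0 < M * Q + Q'" "0 < (M + 1) * Q + Q'" "0 < Q" "0 < Q + Q'"
    using M Q by (auto intro!: add_pos_nonneg mult_pos_pos)
  have "1 / (Q * (M * Q + Q')) - 1 / (Q * ((M + 1) * Q + Q')) = 1 / ((M * Q + Q') * ((M + 1) * Q + Q'))"
    using p by (simp add: divide_simps) (simp add: algebra_simps)
  moreover have "1 / (2 * real d * (real d + 1)) * (1 / (Q * (Q + Q'))) \<le> 1 / ((M * Q + Q') * ((M + 1) * Q + Q'))"
  proof -
    have "M * Q + Q' \<le> M * Q + M * Q'" using M Q mult_right_mono[of 1 M Q'] by simp
    also have "\<dots> = M * (Q + Q')" by (simp add: algebra_simps)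
    also have "\<dots> \<le> real d * (Q + Q')" using M Q by (intro mult_right_mono) auto
    finally have a: "M * Q + Q' \<le> real d * (Q + Q')" .
    have "(M + 1) * Q + Q' \<le> (M + 1) * Q + (M + 1) * Q" 
      using M Q mult_right_mono[of 1 "M + 1" Q] by (intro add_left_mono) linarith
    also have "\<dots> = (M + 1) * (2 * Q)" by (simp add: algebra_simps)
    also have "\<dots> \<le> (real d + 1) * (2 * Q)" using M Q by (intro mult_right_mono) auto
    finally have b: "(M + 1) * Q + Q' \<le> (real d + 1) * (2 * Q)" .
    have "(M * Q + Q') * ((M + 1) * Q + Q') \<le> (real d * (Q + Q')) * ((real d + 1) * (2 * Q))"
      using a b p by (intro mult_mono) auto
    also have "\<dots> = 2 * real d * (real d + 1) * (Q * (Q + Q'))" by (simp add: algebra_simps)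
    finally have "1 / (2 * real d * (real d + 1) * (Q * (Q + Q'))) \<le> 1 / ((M * Q + Q') * ((M + 1) * Q + Q'))"
      using p M by (intro divide_left_mono mult_pos_pos) auto
    then show ?thesis by simp
  qed
  ultimately show ?thesis unfolding e e1 e2 e3 by simp
qed

section \<open>Sets determined by finitely many digits\<close>

text \<open>Membership depends only on the first \<open>n\<close> digits.\<close>

definition digit_determined :: "nat \<Rightarrow> real set \<Rightarrow> bool" where
  "digit_determined n X \<longleftrightarrow> X \<subseteq> Irr \<and> (\<forall>x\<in>X. \<forall>y\<in>Irr. digits n x = digits n y \<longrightarrow> y \<in> X)"

lemma digit_determined_subset: "digit_determined n X \<Longrightarrow> X \<subseteq> Irr" by (simp add: digit_determined_def)

lemma digit_determined_mono: "digit_determined n X \<Longrightarrow> n \<le> k \<Longrightarrow> digit_determined k X"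
  unfolding digit_determined_def by (metis digits_take)

lemma digit_determined_Int: "digit_determined n X \<Longrightarrow> digit_determined n Y \<Longrightarrow> digit_determined n (X \<inter> Y)"
  unfolding digit_determined_def by blast

lemma digit_determined_Irr: "digit_determined n Irr" by (simp add: digit_determined_def)

lemma digit_determined_cylinder: "digit_determined n (cylinder n x)"
  by (auto simp: digit_determined_def cylinder_def)

lemma digit_determined_digit: "1 \<le> i \<Longrightarrow> i \<le> n \<Longrightarrow> digit_determined n {x \<in> Irr. P (cf_digit x i)}"
  by (auto simp: digit_determined_def digits_eq_iff)

lemma digit_determined_UN_cylinder: "digit_determined n X \<Longrightarrow> X = \<Union> (cylinder n ` X)"
proof -
  assume a: "digit_determined n X"
  have "x \<in> cylinder n x" if "x \<in> X" for x using a that by (auto simp: digit_determined_def cylinder_def)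
  moreover have "cylinder n x \<subseteq> X" if "x \<in> X" for x using a that by (auto simp: digit_determined_def cylinder_def)
  ultimately show ?thesis by blast
qed

lemma countable_cylinder_image: "countable (cylinder n ` X)"
proof -
  have "cylinder n ` X = (\<lambda>w. {y \<in> Irr. digits n y = w}) ` (digits n ` X)"
    by (auto simp: cylinder_def image_image)
  then show ?thesis by auto
qed

lemma disjoint_cylinder: "disjoint_family_on (\<lambda>C. C \<inter> Y) (cylinder n ` X)"
  by (auto simp: disjoint_family_on_def cylinder_def)

lemma digit_determined_borel:
  assumes "digit_determined n X"
  shows "X \<in> sets borel"
proof -
  have "\<Union> (cylinder n ` X) \<in> sets borel"
    using assms by (intro sets.countable_Union countable_cylinder_image) (auto simp: digit_determined_def intro!: cylinder_borel)
  then show ?thesis using digit_determined_UN_cylinder[OF assms] by simp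
qed

lemma digit_determined_fmeasurable: "digit_determined n X \<Longrightarrow> X \<in> fmeasurable lborel"
  using Irr_fmeasurable[OF digit_determined_borel digit_determined_subset] .

lemma emeasure_digit_determined_Int:
  assumes "digit_determined n X" "Y \<in> sets borel"
  shows "emeasure lborel (X \<inter> Y) = (\<integral>\<^sup>+C. emeasure lborel (C \<inter> Y) \<partial>count_space (cylinder n ` X))"
proof -
  have "X \<inter> Y = (\<Union>C\<in>cylinder n ` X. C \<inter> Y)" using digit_determined_UN_cylinder[OF assms(1)] by auto
  then show ?thesis
    using assms
    by (simp only:) (rule emeasure_UN_countable, auto simp: digit_determined_def countable_cylinder_image disjoint_cylinder intro!: cylinder_borel)
qed

lemma emeasure_digit_determined:
  assumes "digit_determined n X"
  shows "emeasure lborel X = (\<integral>\<^sup>+C. emeasure lborel C \<partial>count_space (cylinder n ` X))"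
  using emeasure_digit_determined_Int[OF assms, of UNIV] by simp

text \<open>A determined set is a countable disjoint union of cylinders, so inequalities on
  cylinders add up. The sum is an integral over counting measure, which stays in the extended reals;
  it returns to \<open>measure\<close> because everything lies in the unit interval.\<close>

lemma
  assumes X: "digit_determined n X" and Y: "Y \<in> sets borel" and c: "0 \<le> c"
  shows measure_digit_determined_upper: "(\<And>x. x \<in> X \<Longrightarrow> measure lborel (cylinder n x \<inter> Y) \<le> c * measure lborel (cylinder n x))
      \<Longrightarrow> measure lborel (X \<inter> Y) \<le> c * measure lborel X"
    and measure_digit_determined_lower: "(\<And>x. x \<in> X \<Longrightarrow> c * measure lborel (cylinder n x) \<le> measure lborel (cylinder n x \<inter> Y))
      \<Longrightarrow> c * measure lborel X \<le> measure lborel (X \<inter> Y)"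
proof -
  have XI: "x \<in> X \<Longrightarrow> x \<in> Irr" for x using X by (auto simp: digit_determined_def)
  have fm: "C \<in> fmeasurable lborel \<and> C \<inter> Y \<in> fmeasurable lborel" if "C \<in> cylinder n ` X" for C
  proof -
    have "C \<in> sets borel" "C \<subseteq> Irr" using that XI cylinder_borel by (auto simp: cylinder_def)
    then show ?thesis using Y Irr_fmeasurable[of C] Irr_fmeasurable[of "C \<inter> Y"] by auto
  qed
  have eC: "emeasure lborel C = ennreal (measure lborel C)"
      "emeasure lborel (C \<inter> Y) = ennreal (measure lborel (C \<inter> Y))" if "C \<in> cylinder n ` X" for C
    using fm[OF that] by (auto simp: emeasure_eq_measure2)
  have eX: "emeasure lborel X = ennreal (measure lborel X)"
      "emeasure lborel (X \<inter> Y) = ennreal (measure lborel (X \<inter> Y))"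
    using digit_determined_fmeasurable[OF X] fmeasurable_Int_fmeasurable[OF digit_determined_fmeasurable[OF X], of Y] Y
    by (auto simp: emeasure_eq_measure2)
  { assume h: "\<And>x. x \<in> X \<Longrightarrow> measure lborel (cylinder n x \<inter> Y) \<le> c * measure lborel (cylinder n x)"
    have "emeasure lborel (X \<inter> Y) \<le> (\<integral>\<^sup>+C. ennreal c * emeasure lborel C \<partial>count_space (cylinder n ` X))"
      unfolding emeasure_digit_determined_Int[OF X Y]
      by (intro nn_integral_mono) (use h in \<open>auto simp: eC ennreal_mult'[OF c, symmetric] intro!: ennreal_leI\<close>)
    also have "\<dots> = ennreal c * emeasure lborel X"
      by (subst nn_integral_cmult) (auto simp: emeasure_digit_determined[OF X])
    finally show "measure lborel (X \<inter> Y) \<le> c * measure lborel X"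
      using c by (simp add: eX ennreal_mult'[symmetric]) }
  { assume h: "\<And>x. x \<in> X \<Longrightarrow> c * measure lborel (cylinder n x) \<le> measure lborel (cylinder n x \<inter> Y)"
    have "ennreal c * emeasure lborel X = (\<integral>\<^sup>+C. ennreal c * emeasure lborel C \<partial>count_space (cylinder n ` X))"
      by (subst nn_integral_cmult) (auto simp: emeasure_digit_determined[OF X])
    also have "\<dots> \<le> emeasure lborel (X \<inter> Y)"
      unfolding emeasure_digit_determined_Int[OF X Y]
      by (intro nn_integral_mono) (use h in \<open>auto simp: eC ennreal_mult'[OF c, symmetric] intro!: ennreal_leI\<close>)
    finally show "c * measure lborel X \<le> measure lborel (X \<inter> Y)"
      using c by (simp add: eX ennreal_mult'[symmetric]) }
qed

section \<open>Partial sums of digits and a zero--one law\<close>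

lemma digit_determined_ge_upper:
  assumes X: "digit_determined k X" and m: "1 \<le> m"
  shows "measure lborel (X \<inter> {y \<in> Irr. m \<le> cf_digit y (Suc k)}) \<le> 2 / real m * measure lborel X"
proof (rule measure_digit_determined_upper[OF X])
  show "{y \<in> Irr. m \<le> cf_digit y (Suc k)} \<in> sets borel"
    by (rule digit_determined_borel, rule digit_determined_digit[of "Suc k" "Suc k"]) auto
  fix x assume "x \<in> X"
  then have x: "x \<in> Irr" using X by (auto simp: digit_determined_def)
  have "cylinder k x \<inter> {y \<in> Irr. m \<le> cf_digit y (Suc k)} = {y \<in> cylinder k x. m \<le> cf_digit y (Suc k)}"
    by (auto simp: cylinder_def)
  then show "measure lborel (cylinder k x \<inter> {y \<in> Irr. m \<le> cf_digit y (Suc k)}) \<le> 2 / real m * measure lborel (cylinder k x)"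
    using cylinder_ge_bounds(1)[OF x m] by simp
qed auto

lemma digit_determined_ge_lower:
  assumes X: "digit_determined k X" and m: "1 \<le> m"
  shows "1 / real m * measure lborel X \<le> measure lborel (X \<inter> {y \<in> Irr. m \<le> cf_digit y (Suc k)})"
proof (rule measure_digit_determined_lower[OF X])
  show "{y \<in> Irr. m \<le> cf_digit y (Suc k)} \<in> sets borel"
    by (rule digit_determined_borel, rule digit_determined_digit[of "Suc k" "Suc k"]) auto
  fix x assume "x \<in> X"
  then have x: "x \<in> Irr" using X by (auto simp: digit_determined_def)
  have "cylinder k x \<inter> {y \<in> Irr. m \<le> cf_digit y (Suc k)} = {y \<in> cylinder k x. m \<le> cf_digit y (Suc k)}"
    by (auto simp: cylinder_def)
  then show "1 / real m * measure lborel (cylinder k x) \<le> measure lborel (cylinder k x \<inter> {y \<in> Irr. m \<le> cf_digit y (Suc k)})"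
    using cylinder_ge_bounds(2)[OF x m] by simp
qed auto

text \<open>The favourable digit \<open>u\<close> may change from cylinder to cylinder; only its
  size matters, since \<open>cylinder_eq_bound\<close> is uniform in
  \<open>u \<le> d\<close>.\<close>

lemma digit_determined_choice:
  assumes X: "digit_determined k X" and Y: "digit_determined (Suc k) Y"
    and ex: "\<And>x. x \<in> X \<Longrightarrow> \<exists>u. 1 \<le> u \<and> u \<le> d \<and> {y \<in> cylinder k x. cf_digit y (Suc k) = u} \<subseteq> Y"
  shows "1 / (2 * real d * (real d + 1)) * measure lborel X \<le> measure lborel (X \<inter> Y)"
proof (rule measure_digit_determined_lower[OF X digit_determined_borel[OF Y]])
  fix x assume xX: "x \<in> X"
  then have x: "x \<in> Irr" using X by (auto simp: digit_determined_def)
  obtain u where u: "1 \<le> u" "u \<le> d" "{y \<in> cylinder k x. cf_digit y (Suc k) = u} \<subseteq> Y"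
    using ex[OF xX] by blast
  have lv: "digit_determined (Suc k) (cylinder k x)" by (rule digit_determined_mono[OF digit_determined_cylinder]) simp
  have "{y \<in> cylinder k x. cf_digit y (Suc k) = u} = cylinder k x \<inter> {y \<in> Irr. cf_digit y (Suc k) = u}"
    by (auto simp: cylinder_def)
  moreover have "digit_determined (Suc k) (cylinder k x \<inter> {y \<in> Irr. cf_digit y (Suc k) = u})"
    by (intro digit_determined_Int lv digit_determined_digit[of "Suc k" "Suc k"]) auto
  ultimately have b: "{y \<in> cylinder k x. cf_digit y (Suc k) = u} \<in> sets borel"
    using digit_determined_borel by metis
  have "measure lborel {y \<in> cylinder k x. cf_digit y (Suc k) = u} \<le> measure lborel (cylinder k x \<inter> Y)"
    using u(3) b by (intro measure_mono_fmeasurable digit_determined_fmeasurable[OF digit_determined_Int[OF lv Y]]) auto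
  then show "1 / (2 * real d * (real d + 1)) * measure lborel (cylinder k x) \<le> measure lborel (cylinder k x \<inter> Y)"
    using cylinder_eq_bound[OF x u(1,2), of k] by linarith
qed auto

lemma sum_inverse_le_ln: "1 \<le> n \<Longrightarrow> (\<Sum>m = 1..n. 1 / real m) \<le> 1 + ln (real n)"
proof (induction n rule: dec_induct)
  case base
  then show ?case by simp
next
  case (step n)
  have "ln (real n / real (Suc n)) \<le> real n / real (Suc n) - 1"
    using step by (intro ln_le_minus_one) auto
  also have "\<dots> = - (1 / real (Suc n))" by (simp add: field_simps)
  finally have "1 / real (Suc n) \<le> ln (real (Suc n)) - ln (real n)"
    using step by (simp add: ln_div)
  then show ?case using step.IH by simp
qed

definition digit_sum :: "real \<Rightarrow> nat \<Rightarrow> nat" where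
  "digit_sum x k = (\<Sum>i = 1..k. cf_digit x i)"

lemma digit_determined_digit_sum: "digit_determined k {x \<in> Irr. P (digit_sum x k)}"
proof -
  have "digit_sum x k = digit_sum y k" if "digits k x = digits k y" for x y
    using that by (auto simp: digit_sum_def digits_eq_iff intro!: sum.cong)
  then show ?thesis unfolding digit_determined_def by (metis (mono_tags, lifting) mem_Collect_eq subsetI)
qed

text \<open>A digit truncated at \<open>M\<close> counts the levels it reaches, which turns its mean
  into a sum of tail measures.\<close>

lemma count_le: "(\<Sum>m = 1..M. indicator {m. m \<le> a} m :: real) = real (min a M)"
proof -
  have "(\<Sum>m = 1..M. indicator {m. m \<le> a} m :: real) = real (card ({1..M} \<inter> {m. m \<le> a}))"
    by (simp add: indicator_def sum.If_cases)
  also have "{1..M} \<inter> {m. m \<le> a} = {1..min a M}" by auto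
  finally show ?thesis by simp
qed

text \<open>Either a digit exceeds \<open>M\<close>, or the sum of the digits truncated at \<open>M\<close> is large; the latter is bounded by Markov's
inequality.\<close>

lemma digit_sum_tail:
  assumes X: "digit_determined n X" and nk: "n \<le> k" and M: "1 \<le> M"
    and S: "\<And>x. x \<in> X \<Longrightarrow> real (digit_sum x n) \<le> \<sigma>" and s: "\<sigma> < s"
  shows "measure lborel (X \<inter> {x \<in> Irr. s < real (digit_sum x k)})
    \<le> (2 * real k / real M + 2 * real k * (1 + ln (real M)) / (s - \<sigma>)) * measure lborel X"
proof -
  define E where "E = (\<lambda>i m. X \<inter> {y \<in> Irr. m \<le> cf_digit y (Suc i)})"
  define T where "T = X \<inter> {x \<in> Irr. s - \<sigma> < (\<Sum>i\<in>{n..<k}. real (min (cf_digit x (Suc i)) M))}"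
  have E_digit_determined: "digit_determined (Suc i) (E i m)" if "n \<le> i" for i m
    unfolding E_def using that by (intro digit_determined_Int digit_determined_mono[OF X] digit_determined_digit[of "Suc i" "Suc i"]) auto
  have E_fm: "E i m \<in> fmeasurable lborel" if "n \<le> i" for i m
    using digit_determined_fmeasurable[OF E_digit_determined[OF that]] .
  have E_le: "measure lborel (E i m) \<le> 2 / real m * measure lborel X" if "n \<le> i" "1 \<le> m" for i m
    unfolding E_def using digit_determined_ge_upper[OF digit_determined_mono[OF X that(1)] that(2)] .
  have X_fm: "X \<in> fmeasurable lborel" using digit_determined_fmeasurable[OF X] .
  have XI: "X \<subseteq> Irr" using X by (simp add: digit_determined_def)
  have T_digit_determined: "digit_determined k T"
  proof -
    have "(\<Sum>i\<in>{n..<k}. real (min (cf_digit x (Suc i)) M)) = (\<Sum>i\<in>{n..<k}. real (min (cf_digit y (Suc i)) M))"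
      if "digits k x = digits k y" for x y
      using that by (auto simp: digits_eq_iff intro!: sum.cong)
    then have "digit_determined k {x \<in> Irr. s - \<sigma> < (\<Sum>i\<in>{n..<k}. real (min (cf_digit x (Suc i)) M))}"
      unfolding digit_determined_def by (metis (mono_tags, lifting) mem_Collect_eq subsetI)
    then show ?thesis unfolding T_def by (intro digit_determined_Int digit_determined_mono[OF X nk])
  qed
  have T_fm: "T \<in> fmeasurable lborel" using digit_determined_fmeasurable[OF T_digit_determined] .
  have sub: "X \<inter> {x \<in> Irr. s < real (digit_sum x k)} \<subseteq> (\<Union>i\<in>{n..<k}. E i M) \<union> T"
  proof
    fix x assume x: "x \<in> X \<inter> {x \<in> Irr. s < real (digit_sum x k)}"
    show "x \<in> (\<Union>i\<in>{n..<k}. E i M) \<union> T"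
    proof (cases "x \<in> (\<Union>i\<in>{n..<k}. E i M)")
      case False
      then have le: "cf_digit x (Suc i) \<le> M" if "i \<in> {n..<k}" for i
        using that x by (force simp: E_def not_le dest: less_imp_le)
      have "digit_sum x k = digit_sum x n + (\<Sum>i\<in>{n..<k}. cf_digit x (Suc i))"
        using nk
      proof (induction k rule: dec_induct)
        case (step k)
        then show ?case by (simp add: digit_sum_def)
      qed simp
      also have "(\<Sum>i\<in>{n..<k}. cf_digit x (Suc i)) = (\<Sum>i\<in>{n..<k}. min (cf_digit x (Suc i)) M)"
        using le by (intro sum.cong) (auto simp: min_absorb1)
      finally have "real (digit_sum x k) = real (digit_sum x n) + (\<Sum>i\<in>{n..<k}. real (min (cf_digit x (Suc i)) M))"
        by simp
      then show ?thesis using x S[of x] XI by (auto simp: T_def)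
    qed simp
  qed
  have "measure lborel (X \<inter> {x \<in> Irr. s < real (digit_sum x k)}) \<le> measure lborel ((\<Union>i\<in>{n..<k}. E i M) \<union> T)"
  proof (rule measure_mono_fmeasurable[OF sub])
    show "X \<inter> {x \<in> Irr. s < real (digit_sum x k)} \<in> sets lborel"
      using digit_determined_borel[OF digit_determined_Int[OF digit_determined_mono[OF X nk] digit_determined_digit_sum]] by simp
    show "(\<Union>i\<in>{n..<k}. E i M) \<union> T \<in> fmeasurable lborel"
      using E_fm T_fm by (intro fmeasurable.Un fmeasurable.finite_UN) auto
  qed
  also have "\<dots> \<le> measure lborel (\<Union>i\<in>{n..<k}. E i M) + measure lborel T"
    using E_fm T_fm by (intro measure_Un_le sets.finite_UN) (auto simp: fmeasurable_def)
  also have "measure lborel (\<Union>i\<in>{n..<k}. E i M) \<le> (\<Sum>i\<in>{n..<k}. measure lborel (E i M))"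
    using E_fm by (intro measure_UNION_le) (auto simp: fmeasurable_def)
  also have "\<dots> \<le> (\<Sum>i\<in>{n..<k}. 2 / real M * measure lborel X)"
    using E_le M by (intro sum_mono) auto
  also have "\<dots> = real (k - n) * (2 / real M * measure lborel X)" by simp
  also have "\<dots> \<le> real k * (2 / real M * measure lborel X)" by (intro mult_right_mono) auto
  finally have 1: "measure lborel (X \<inter> {x \<in> Irr. s < real (digit_sum x k)})
      \<le> 2 * real k / real M * measure lborel X + measure lborel T" by (simp add: mult_ac)
  have "(s - \<sigma>) * measure lborel T \<le> 2 * real k * (1 + ln (real M)) * measure lborel X"
  proof -
    \<comment> \<open>Summed over the levels \<open>m\<close>, the tail bounds \<open>2 / m\<close>
      give a harmonic sum: the truncation costs a factor \<open>ln M\<close>, although a digit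
      itself has infinite mean.\<close>
    define F where "F = (\<lambda>x. \<Sum>i\<in>{n..<k}. \<Sum>m=1..M. indicator (E i m) x :: real)"
    have int_E: "integrable lborel (indicator (E i m) :: real \<Rightarrow> real)" if "i \<in> {n..<k}" for i m
      using E_fm[of i m] that by (intro integrable_real_indicator) (auto simp: fmeasurable_def)
    have int_T: "integrable lborel (indicator T :: real \<Rightarrow> real)"
      using T_fm by (intro integrable_real_indicator) (auto simp: fmeasurable_def)
    have int_F: "integrable lborel F"
      unfolding F_def by (intro Bochner_Integration.integrable_sum int_E) auto
    have ptw: "(s - \<sigma>) * indicator T x \<le> F x" for x
    proof (cases "x \<in> T")
      case True
      then have xX: "x \<in> X" "x \<in> Irr" by (auto simp: T_def)
      have "F x = (\<Sum>i\<in>{n..<k}. \<Sum>m=1..M. indicator {m. m \<le> cf_digit x (Suc i)} m)"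
        using xX unfolding F_def by (intro sum.cong) (auto simp: E_def indicator_def)
      also have "\<dots> = (\<Sum>i\<in>{n..<k}. real (min (cf_digit x (Suc i)) M))" by (simp only: count_le)
      finally show ?thesis using True by (simp add: T_def)
    next
      case False
      then show ?thesis by (simp add: F_def sum_nonneg)
    qed
    have "(s - \<sigma>) * measure lborel T = (\<integral>x. (s - \<sigma>) * indicator T x \<partial>lborel)"
      by simp
    also have "\<dots> \<le> (\<integral>x. F x \<partial>lborel)"
      using int_T int_F ptw by (intro integral_mono integrable_mult_right) auto
    also have "\<dots> = (\<Sum>i\<in>{n..<k}. \<integral>x. (\<Sum>m=1..M. indicator (E i m) x) \<partial>lborel)"
      unfolding F_def by (rule Bochner_Integration.integral_sum) (intro Bochner_Integration.integrable_sum int_E)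
    also have "\<dots> = (\<Sum>i\<in>{n..<k}. \<Sum>m=1..M. \<integral>x. indicator (E i m) x \<partial>lborel)"
      by (intro sum.cong refl Bochner_Integration.integral_sum int_E)
    also have "\<dots> = (\<Sum>i\<in>{n..<k}. \<Sum>m=1..M. measure lborel (E i m))"
      by simp
    also have "\<dots> \<le> (\<Sum>i\<in>{n..<k}. \<Sum>m=1..M. 2 / real m * measure lborel X)"
      using E_le by (intro sum_mono) auto
    also have "\<dots> = real (k - n) * (2 * (\<Sum>m=1..M. 1 / real m) * measure lborel X)"
      by (simp add: sum_distrib_left sum_distrib_right)
    also have "\<dots> \<le> real k * (2 * (1 + ln (real M)) * measure lborel X)"
      using sum_inverse_le_ln[OF M] by (intro mult_mono mult_nonneg_nonneg sum_nonneg mult_right_mono mult_left_mono) auto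
    finally show ?thesis by (simp add: algebra_simps)
  qed
  then have "measure lborel T \<le> 2 * real k * (1 + ln (real M)) * measure lborel X / (s - \<sigma>)"
    using s by (simp add: field_simps)
  then show ?thesis using 1 by (simp add: algebra_simps)
qed

text \<open>The order \<open>k * ln k\<close> is the typical size of the digit sum, and it is just
  small enough for the reciprocals to diverge; an extra factor \<open>ln k\<close> would already
  make them summable. The factor 64 only provides slack.\<close>

definition sum_threshold :: "nat \<Rightarrow> real" where
  "sum_threshold k = 64 * real k * ln (real k)"

text \<open>Truncation at the square of \<open>k\<close> keeps both errors below
  \<open>1 / 4\<close>: some digit exceeds it on a share of at most \<open>2 / k\<close>, while its
  logarithm is still only \<open>2 * ln k\<close>, so the Markov term is at most
  \<open>6 / 32\<close>.\<close>

lemma digit_sum_tight: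
  assumes X: "digit_determined n X" and nk: "n \<le> k" and k8: "8 \<le> k"
    and S: "\<And>x. x \<in> X \<Longrightarrow> real (digit_sum x n) \<le> real k"
  shows "1 / 2 * measure lborel X \<le> measure lborel (X \<inter> {x \<in> Irr. real (digit_sum x k) \<le> sum_threshold k})"
proof -
  have ln1: "1 \<le> ln (real k)"
  proof -
    have "exp 1 \<le> real k" using exp_le k8 by linarith
    then show ?thesis using k8 by (metis exp_gt_zero ln_exp ln_le_cancel_iff less_le_trans)
  qed
  have sum_threshold_ge: "32 * real k * ln (real k) \<le> sum_threshold k - real k" "real k < sum_threshold k"
  proof -
    have "real k * 1 \<le> real k * ln (real k)" using ln1 by (intro mult_left_mono) auto
    then show "32 * real k * ln (real k) \<le> sum_threshold k - real k" "real k < sum_threshold k"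
      using k8 by (auto simp: sum_threshold_def)
  qed
  have b: "2 * real k / real (k\<^sup>2) + 2 * real k * (1 + ln (real (k\<^sup>2))) / (sum_threshold k - real k) \<le> 1 / 2"
  proof -
    have "2 * real k / real (k\<^sup>2) = 2 / real k" using k8 by (simp add: power2_eq_square)
    also have "\<dots> \<le> 1 / 4" using k8 by simp
    finally have 1: "2 * real k / real (k\<^sup>2) \<le> 1 / 4" .
    have l: "ln (real (k\<^sup>2)) = 2 * ln (real k)" using k8 by (simp add: ln_realpow)
    have "2 * real k * (1 + ln (real (k\<^sup>2))) \<le> 2 * real k * (3 * ln (real k))"
      unfolding l using ln1 by (intro mult_left_mono) auto
    also have "\<dots> = 6 * (real k * ln (real k))" by simp
    also have "\<dots> \<le> (32 * real k * ln (real k)) / 4" using ln1 by simp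
    also have "\<dots> \<le> (sum_threshold k - real k) / 4" using sum_threshold_ge(1) by (intro divide_right_mono) auto
    finally have "2 * real k * (1 + ln (real (k\<^sup>2))) / (sum_threshold k - real k) \<le> 1 / 4"
      using sum_threshold_ge(2) by (simp add: field_simps)
    then show ?thesis using 1 by linarith
  qed
  have lv: "digit_determined k (X \<inter> {x \<in> Irr. sum_threshold k < real (digit_sum x k)})"
    by (intro digit_determined_Int digit_determined_mono[OF X nk] digit_determined_digit_sum)
  have "measure lborel (X \<inter> {x \<in> Irr. sum_threshold k < real (digit_sum x k)}) \<le> 
      (2 * real k / real (k\<^sup>2) + 2 * real k * (1 + ln (real (k\<^sup>2))) / (sum_threshold k - real k)) * measure lborel X"
    using k8 by (intro digit_sum_tail[OF X nk _ S sum_threshold_ge(2)]) auto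
  also have "\<dots> \<le> 1 / 2 * measure lborel X"
    using b by (intro mult_right_mono) auto
  finally have "measure lborel (X \<inter> {x \<in> Irr. sum_threshold k < real (digit_sum x k)}) \<le> 1 / 2 * measure lborel X" .
  moreover have "X \<inter> {x \<in> Irr. real (digit_sum x k) \<le> sum_threshold k} = X - X \<inter> {x \<in> Irr. sum_threshold k < real (digit_sum x k)}"
    using digit_determined_subset[OF X] by auto
  moreover have "measure lborel (X - X \<inter> {x \<in> Irr. sum_threshold k < real (digit_sum x k)})
      = measure lborel X - measure lborel (X \<inter> {x \<in> Irr. sum_threshold k < real (digit_sum x k)})"
    using measurable_measure_Diff[OF digit_determined_fmeasurable[OF X] fmeasurableD[OF digit_determined_fmeasurable[OF lv]]] by auto
  ultimately show ?thesis by simp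
qed

text \<open>The sets \<open>G k\<close> become disjoint after removing all later \<open>E j\<close>, and each keeps at least half of its measure.\<close>

lemma disjointified_union_bound:
  fixes m :: "nat \<Rightarrow> real" and K :: "nat set"
  assumes K: "finite K" and G: "\<And>k. k \<in> K \<Longrightarrow> G k \<in> fmeasurable lborel"
    and E: "\<And>k. k \<in> K \<Longrightarrow> E k \<in> sets lborel" and GE: "\<And>k. k \<in> K \<Longrightarrow> G k \<subseteq> E k"
    and ind: "\<And>j k. j \<in> K \<Longrightarrow> k \<in> K \<Longrightarrow> j < k \<Longrightarrow> measure lborel (G j \<inter> E k) \<le> 2 / m k * measure lborel (G j)"
    and m: "\<And>k. k \<in> K \<Longrightarrow> 0 < m k" and up: "(\<Sum>k\<in>K. 1 / m k) \<le> 1 / 4" and lo: "1 / 8 \<le> (\<Sum>k\<in>K. 1 / m k)"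
    and low: "\<And>k. k \<in> K \<Longrightarrow> \<gamma> / m k \<le> measure lborel (G k)" and \<gamma>: "0 \<le> \<gamma>"
  shows "\<gamma> / 16 \<le> measure lborel (\<Union>k\<in>K. G k)"
proof -
  define H where "H = (\<lambda>j. G j - (\<Union>k\<in>{k\<in>K. j < k}. E k))"
  have GEs: "G j \<inter> E k \<in> sets lborel" if "j \<in> K" "k \<in> K" for j k
    using G[OF that(1)] E[OF that(2)] by (auto simp: fmeasurable_def)
  have H_fm: "H j \<in> fmeasurable lborel" if "j \<in> K" for j
    unfolding H_def using G[OF that] E K by (intro fmeasurable_Diff sets.finite_UN) auto
  have H_ge: "1 / 2 * measure lborel (G j) \<le> measure lborel (H j)" if j: "j \<in> K" for j
  proof -
    define U where "U = (\<Union>k\<in>{k\<in>K. j < k}. G j \<inter> E k)"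
    have Us: "U \<in> sets lborel" unfolding U_def using GEs j K by (intro sets.finite_UN) auto
    have "measure lborel U \<le> (\<Sum>k\<in>{k\<in>K. j < k}. measure lborel (G j \<inter> E k))"
      unfolding U_def using GEs j K by (intro measure_UNION_le) auto
    also have "\<dots> \<le> (\<Sum>k\<in>{k\<in>K. j < k}. 2 / m k * measure lborel (G j))"
      using ind j by (intro sum_mono) auto
    also have "\<dots> \<le> (\<Sum>k\<in>K. 2 / m k * measure lborel (G j))"
      using K m by (intro sum_mono2) (auto intro!: divide_nonneg_pos)
    also have "\<dots> = 2 * (\<Sum>k\<in>K. 1 / m k) * measure lborel (G j)"
      by (simp add: sum_distrib_left sum_distrib_right)
    also have "\<dots> \<le> 1 / 2 * measure lborel (G j)"
      using up by (intro mult_right_mono) auto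
    finally have "measure lborel U \<le> 1 / 2 * measure lborel (G j)" .
    moreover have "H j = G j - U" by (auto simp: H_def U_def)
    moreover have "measure lborel (G j - U) = measure lborel (G j) - measure lborel U"
      by (rule measurable_measure_Diff[OF G[OF j] Us]) (auto simp: U_def)
    ultimately show ?thesis by simp
  qed
  have disj: "disjoint_family_on H K"
    unfolding disjoint_family_on_def
  proof (intro ballI impI)
    fix j k assume jk: "j \<in> K" "k \<in> K" "j \<noteq> k"
    then consider "j < k" | "k < j" by linarith
    then show "H j \<inter> H k = {}"
      by cases (use jk GE in \<open>auto simp: H_def\<close>)
  qed
  \<comment> \<open>The factor 16 is 2 times 8: half of each \<open>\<gamma> / m k\<close> survives,
    and the reciprocals sum to at least \<open>1 / 8\<close>.\<close>
  have "\<gamma> / 16 \<le> \<gamma> / 2 * (\<Sum>k\<in>K. 1 / m k)"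
    using mult_left_mono[OF lo, of "\<gamma> / 2"] \<gamma> by simp
  also have "\<dots> = (\<Sum>k\<in>K. 1 / 2 * (\<gamma> / m k))" by (simp add: sum_distrib_left)
  also have "\<dots> \<le> (\<Sum>k\<in>K. measure lborel (H k))"
  proof (rule sum_mono)
    fix k assume "k \<in> K"
    then show "1 / 2 * (\<gamma> / m k) \<le> measure lborel (H k)" using low[of k] H_ge[of k] by linarith
  qed
  also have "\<dots> = measure lborel (\<Union>k\<in>K. H k)"
    using K H_fm disj by (intro measure_finite_Union[symmetric]) (auto simp: fmeasurable_def less_top)
  also have "\<dots> \<le> measure lborel (\<Union>k\<in>K. G k)"
  proof (rule measure_mono_fmeasurable)
    show "(\<Union>k\<in>K. H k) \<subseteq> (\<Union>k\<in>K. G k)" by (auto simp: H_def)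
    show "(\<Union>k\<in>K. H k) \<in> sets lborel"
      using K H_fm by (intro sets.finite_UN) (auto simp: fmeasurable_def)
    show "(\<Union>k\<in>K. G k) \<in> fmeasurable lborel"
      using K G by (intro fmeasurable.finite_UN) auto
  qed
  finally show ?thesis .
qed

text \<open>Stop at the first index where the partial sum reaches \<open>1 / 8\<close>; the last
  term overshoots by at most another \<open>1 / 8\<close>.\<close>

lemma divergent_window:
  fixes a :: "nat \<Rightarrow> real"
  assumes a: "\<not> summable a" "\<And>i. 0 \<le> a i" and small: "\<And>i. N \<le> i \<Longrightarrow> a i \<le> 1 / 8"
  shows "\<exists>N'. 1 / 8 \<le> (\<Sum>i\<in>{N..<N'}. a i) \<and> (\<Sum>i\<in>{N..<N'}. a i) \<le> 1 / 4"
proof -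
  have "\<exists>N'. 1 / 8 \<le> (\<Sum>i\<in>{N..<N'}. a i)"
  proof (rule ccontr)
    assume "\<not> ?thesis"
    then have b: "(\<Sum>i\<in>{N..<N'}. a i) \<le> 1 / 8" for N' by (meson linear)
    have "(\<Sum>i<n. a (i + N)) = (\<Sum>i\<in>{N..<n + N}. a i)" for n
      using sum.shift_bounds_nat_ivl[of a 0 N n] by (simp add: atLeast0LessThan add.commute)
    then have "summable (\<lambda>i. a (i + N))"
      using b a(2) by (intro summableI_nonneg_bounded[where x = "1/8"]) auto
    then show False using a(1) by (simp add: summable_iff_shift)
  qed
  then obtain N' where N': "1 / 8 \<le> (\<Sum>i\<in>{N..<N'}. a i)"
      "\<And>j. j < N' \<Longrightarrow> \<not> 1 / 8 \<le> (\<Sum>i\<in>{N..<j}. a i)"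
    using exists_least_iff[of "\<lambda>N'. 1 / 8 \<le> (\<Sum>i\<in>{N..<N'}. a i)"] by auto
  have "N < N'" using N'(1) by (cases "N < N'") auto
  then obtain j where j: "N' = Suc j" "N \<le> j" by (cases N') auto
  have "(\<Sum>i\<in>{N..<N'}. a i) = (\<Sum>i\<in>{N..<j}. a i) + a j" using j by simp
  then show ?thesis using N'(1) N'(2)[of j] small[of j] j by (intro exI[of _ N']) auto
qed

text \<open>Neither ergodicity nor a density theorem is invoked. If the complement \<open>D\<close>
  had positive measure, an open \<open>U\<close> around it with tiny excess would be exhausted, up
  to rationals, by determined sets \<open>V n\<close>. Inside each of them \<open>B\<close> has
  share at least \<open>c\<close>, yet \<open>B\<close> inside \<open>U\<close> is part of that
  excess.\<close>

lemma full_measure_if_uniform_on_cylinders: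
  assumes B: "B \<in> sets borel" "B \<subseteq> Irr" and c: "0 < c"
    and cylinder: "\<And>n x. x \<in> Irr \<Longrightarrow> c * measure lborel (cylinder n x) \<le> measure lborel (B \<inter> cylinder n x)"
  shows "measure lborel (Irr - B) = 0"
proof (rule ccontr)
  define D where "D = Irr - B"
  have D: "D \<in> sets borel" "D \<subseteq> Irr" using B Irr_borel by (auto simp: D_def)
  assume "measure lborel (Irr - B) \<noteq> 0"
  then have dpos: "0 < measure lborel D" by (simp add: D_def zero_less_measure_iff)
  define e where "e = c * measure lborel D / 2"
  have e: "0 < e" using c dpos by (simp add: e_def)
  obtain U where U: "open U" "D \<subseteq> U" "emeasure lborel (U - D) < ennreal e"
    using outer_regular_lborel[OF D(1) e] by auto
  define V where "V = (\<lambda>n. {x \<in> Irr. cylinder n x \<subseteq> U})"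
  have V_digit_determined: "digit_determined n (V n)" for n
    by (auto simp: V_def digit_determined_def cylinder_def)
  have cylinder_self: "x \<in> Irr \<Longrightarrow> x \<in> cylinder n x" for n x by (simp add: cylinder_def)
  have VU: "V n \<subseteq> U" for n using cylinder_self by (auto simp: V_def)
  have V_mono: "incseq V"
  proof (rule incseq_SucI)
    fix n
    have "cylinder (Suc n) x \<subseteq> cylinder n x" for x by (auto simp: cylinder_def digits_Suc)
    then show "V n \<subseteq> V (Suc n)" by (auto simp: V_def)
  qed
  have V_UN: "(\<Union>n. V n) = Irr \<inter> U"
  proof
    show "(\<Union>n. V n) \<subseteq> Irr \<inter> U" using VU by (auto simp: V_def)
    show "Irr \<inter> U \<subseteq> (\<Union>n. V n)"
    proof
      fix x assume x: "x \<in> Irr \<inter> U"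
      then obtain r where r: "0 < r" "ball x r \<subseteq> U" using U(1) by (auto simp: open_contains_ball)
      obtain n :: nat where n: "2 / r < real n" using reals_Archimedean2 by blast
      then have n0: "0 < n" using r by (metis divide_pos_pos less_trans of_nat_0_less_iff zero_less_numeral)
      \<comment> \<open>All points of the cylinder share the n-th convergent and lie within
        \<open>1 / n\<close> of it, because the denominator is at least \<open>n\<close>.\<close>
      have "cylinder n x \<subseteq> ball x r"
      proof
        fix y assume "y \<in> cylinder n x"
        then have y: "y \<in> Irr" "digits n y = digits n x" by (auto simp: cylinder_def)
        define c where "c = cf_digit x"
        have c1: "\<And>i. 1 \<le> i \<Longrightarrow> 1 \<le> c i" using x cf_digit_pos by (auto simp: c_def)
        have q: "real n \<le> real (den c n)" using den_ge[of c n] c1 by simp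
        have near: "\<bar>z - real (num c n) / real (den c n)\<bar> \<le> 1 / real n"
          if z: "z \<in> Irr" "digits n z = digits n x" for z
        proof -
          have eq: "num (cf_digit z) n = num c n" "den (cf_digit z) n = den c n"
            using cpair_digits[OF z(2)] by (simp_all add: c_def)
          have "1 \<le> den (cf_digit z) (Suc n)" using den_bounds[of "Suc n" "cf_digit z"] cf_digit_pos[OF z(1)] by blast
          then have w: "1 \<le> real (den (cf_digit z) (Suc n)) + gauss z (Suc n) * real (den (cf_digit z) n)"
            using gauss_pos[OF z(1), of "Suc n"]
            by (intro add_increasing2 mult_nonneg_nonneg) (simp_all del: cpair.simps)
          have "\<bar>z - real (num c n) / real (den c n)\<bar> = 1 / (real (den c n) *
             (real (den (cf_digit z) (Suc n)) + gauss z (Suc n) * real (den (cf_digit z) n)))"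
            using cf_approx[OF z(1), of n] w unfolding eq by (simp add: abs_mult power_abs)
          also have "\<dots> \<le> 1 / (real n * 1)"
            using q n0 w by (intro divide_left_mono mult_mono mult_pos_pos) auto
          finally show ?thesis by simp
        qed
        have "\<bar>x - y\<bar> \<le> 2 / real n"
          using near[of x] near[of y] x y by auto
        also have "\<dots> < r" using n r n0 by (simp add: field_simps)
        finally show "y \<in> ball x r" by (simp add: dist_real_def)
      qed
      then show "x \<in> (\<Union>n. V n)" using r x by (auto simp: V_def)
    qed
  qed
  have B_V: "c * measure lborel (V n) \<le> measure lborel (U - D)" for n
  proof -
    have "c * measure lborel (V n) \<le> measure lborel (V n \<inter> B)"
      using B(1) c cylinder by (intro measure_digit_determined_lower[OF V_digit_determined]) (auto simp: V_def Int_commute)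
    also have "\<dots> \<le> measure lborel (U - D)"
    proof (rule measure_mono_fmeasurable)
      show "V n \<inter> B \<subseteq> U - D" using VU by (auto simp: D_def)
      show "V n \<inter> B \<in> sets lborel" using digit_determined_borel[OF V_digit_determined] B(1) by auto
      show "U - D \<in> fmeasurable lborel"
        using U(1,3) D(1) by (auto simp: fmeasurable_def intro: less_trans)
    qed
    finally show ?thesis .
  qed
  have "(\<lambda>n. measure lborel (V n)) \<longlonglongrightarrow> measure lborel (Irr \<inter> U)"
  proof -
    have IU: "Irr \<inter> U \<in> fmeasurable lborel"
      using U(1) Irr_borel by (intro Irr_fmeasurable) auto
    show ?thesis unfolding V_UN[symmetric]
      using V_mono digit_determined_borel[OF V_digit_determined] IU unfolding V_UN[symmetric]
      by (intro Lim_measure_incseq) (auto simp: fmeasurable_def)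
  qed
  then have "c * measure lborel (Irr \<inter> U) \<le> measure lborel (U - D)"
    using B_V by (intro LIMSEQ_le_const2[OF tendsto_mult_left]) auto
  moreover have "measure lborel (U - D) < e"
  proof -
    have "U - D \<in> fmeasurable lborel"
      using U(1,3) D(1) by (auto simp: fmeasurable_def intro: less_trans)
    then have "ennreal (measure lborel (U - D)) < ennreal e" using U(3) by (simp add: emeasure_eq_measure2)
    then show ?thesis using e by (simp add: ennreal_less_iff)
  qed
  moreover have "measure lborel D \<le> measure lborel (Irr \<inter> U)"
    using D U(1,2) Irr_borel by (intro measure_mono_fmeasurable Irr_fmeasurable) auto
  ultimately have "c * measure lborel D < e"
    using c by (meson le_less_trans mult_left_mono less_imp_le)
  then show False using c dpos by (simp add: e_def)
qed

section \<open>Infinitely many dominating digits\<close>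

lemma bij_betw_residues:
  fixes p s :: int and q c :: nat
  assumes "coprime p (int q)" "0 < q"
  shows "bij_betw (\<lambda>n. nat ((s + int n * p) mod int q)) {c<..c + q} {..<q}"
proof -
  let ?f = "\<lambda>n. nat ((s + int n * p) mod int q)"
  have inj: "inj_on ?f {c<..c + q}"
  proof (rule inj_onI)
    fix n m assume nm: "n \<in> {c<..c + q}" "m \<in> {c<..c + q}" "?f n = ?f m"
    then have "(s + int n * p) mod int q = (s + int m * p) mod int q"
      using assms(2) by (simp add: eq_nat_nat_iff)
    then have "int q dvd (s + int n * p) - (s + int m * p)" by (simp add: mod_eq_dvd_iff)
    then have "int q dvd (int n - int m) * p" by (simp add: algebra_simps)
    then have "int q dvd int n - int m"
      using assms(1) by (simp add: coprime_commute coprime_dvd_mult_left_iff)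
    moreover have "\<bar>int n - int m\<bar> < int q" using nm by auto
    ultimately have "int n - int m = 0" using zdvd_not_zless[of "\<bar>int n - int m\<bar>" "int q"] by force
    then show "n = m" by simp
  qed
  moreover have "?f ` {c<..c + q} = {..<q}"
  proof (rule card_subset_eq)
    show "?f ` {c<..c + q} \<subseteq> {..<q}" using assms(2) by (auto simp: nat_less_iff)
    show "card (?f ` {c<..c + q}) = card {..<q}" using card_image[OF inj] by simp
  qed simp
  ultimately show ?thesis by (simp add: bij_betw_def)
qed

text \<open>The largest divisor of \<open>d\<close> coprime to \<open>b\<close> works.\<close>

lemma ex_coprime_extension:
  fixes a b d :: nat
  assumes ab: "coprime a b" and d: "1 \<le> d"
  shows "\<exists>u. 1 \<le> u \<and> u \<le> d \<and> coprime (u * a + b) d"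
proof -
  define S where "S = {u. u dvd d \<and> coprime u b}"
  have fin: "finite S" using d by (auto simp: S_def intro: finite_subset[OF _ finite_divisors_nat[of d]])
  have ne: "1 \<in> S" by (simp add: S_def)
  define u where "u = Max S"
  have "u \<in> S" unfolding u_def using Max_in[OF fin] ne by blast
  then have uS: "u dvd d" "coprime u b" by (auto simp: S_def)
  have u1: "1 \<le> u" "u \<le> d" using Max_ge[OF fin ne] dvd_imp_le[OF uS(1)] d by (auto simp: u_def)
  have "coprime (u * a + b) d"
  proof (rule ccontr)
    assume "\<not> ?thesis"
    then have "gcd (u * a + b) d \<noteq> 1" by (simp add: coprime_iff_gcd_eq_1)
    then obtain p where p: "prime p" "p dvd gcd (u * a + b) d" using prime_factor_nat by blast
    then have pd: "p dvd u * a + b" "p dvd d" by auto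
    show False
    proof (cases "p dvd b")
      case True
      then have "p dvd u * a" using pd(1) by (metis dvd_add_left_iff)
      then have "p dvd u \<or> p dvd a" using p(1) by (simp add: prime_dvd_mult_iff)
      then show False using True ab uS(2) p(1) by (metis coprime_common_divisor not_prime_unit)
    next
      case False
      have "\<not> p dvd u"
      proof
        assume "p dvd u"
        then have "p dvd b" using pd(1) by (metis dvd_add_right_iff dvd_mult2)
        then show False using False by simp
      qed
      \<comment> \<open>The prime \<open>p\<close> divides \<open>d\<close> but neither
        \<open>b\<close> nor \<open>u\<close>, so \<open>p * u\<close> would be a larger divisor of
        \<open>d\<close> coprime to \<open>b\<close>.\<close>
      then have "coprime p u" using p(1) by (simp add: prime_imp_coprime)
      then have "p * u dvd d" using pd(2) uS(1) by (simp add: divides_mult)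
      moreover have "coprime (p * u) b" using uS(2) False p(1) by (simp add: prime_imp_coprime)
      ultimately have "p * u \<in> S" by (simp add: S_def)
      then have "p * u \<le> u" using Max_ge[OF fin] by (simp add: u_def)
      then show False using u1 prime_gt_1_nat[OF p(1)] by simp
    qed
  qed
  then show ?thesis using u1 by blast
qed

text \<open>The reason for two extra digits: the congruence for \<open>v\<close> is solvable once
  the current denominator \<open>a\<close> is invertible modulo \<open>d\<close>, and the preceding
  digit is spent on achieving that.\<close>

lemma ex_divisible_extension:
  fixes a b d :: nat
  assumes "coprime a d" and d: "1 \<le> d"
  shows "\<exists>v. 1 \<le> v \<and> v \<le> d \<and> d dvd v * a + b"
proof -
  have "bij_betw (\<lambda>n. nat ((int b + int n * int a) mod int d)) {0<..0 + d} {..<d}"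
    using assms by (intro bij_betw_residues) (auto simp: coprime_int_iff)
  then have "0 \<in> (\<lambda>n. nat ((int b + int n * int a) mod int d)) ` {0<..0 + d}"
    using d by (simp add: bij_betw_def)
  then obtain v where v: "0 < v" "v \<le> d" "nat ((int b + int v * int a) mod int d) = 0" by auto
  have "(int b + int v * int a) mod int d = 0"
    using v(3) d pos_mod_sign[of "int d" "int b + int v * int a"] by linarith
  then have "int d dvd int (v * a + b)" by (simp add: dvd_eq_mod_eq_0 add.commute)
  then have "d dvd v * a + b" by (simp only: int_dvd_int_iff)
  then show ?thesis using v by (intro exI[of _ v]) auto
qed

text \<open>The terms dominate the increments of \<open>ln (ln i)\<close>, by two uses of
  \<open>ln z \<le> z - 1\<close>, and these telescope to something unbounded.\<close>

lemma not_summable_inverse_n_ln: "\<not> summable (\<lambda>i. 1 / (real i * ln (real i)))"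
proof
  let ?b = "\<lambda>i. 1 / (real i * ln (real i))"
  assume sm: "summable ?b"
  have nn: "0 \<le> ?b i" for i by (cases "i = 0") auto
  have step: "ln (ln (real (Suc i))) - ln (ln (real i)) \<le> ?b i" if "2 \<le> i" for i
  proof -
    have l: "0 < ln (real i)" "0 < ln (real (Suc i))" using that by auto
    have "ln (real (Suc i) / real i) \<le> real (Suc i) / real i - 1"
      using that by (intro ln_le_minus_one) auto
    also have "\<dots> = 1 / real i" using that by (simp add: field_simps)
    finally have d: "ln (real (Suc i)) - ln (real i) \<le> 1 / real i" using that by (simp add: ln_div)
    have "ln (ln (real (Suc i)) / ln (real i)) \<le> ln (real (Suc i)) / ln (real i) - 1"
      using l by (intro ln_le_minus_one) auto
    also have "\<dots> = (ln (real (Suc i)) - ln (real i)) / ln (real i)" using l by (simp add: field_simps)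
    also have "\<dots> \<le> (1 / real i) / ln (real i)" using d l by (intro divide_right_mono) auto
    finally show ?thesis using l by (simp add: ln_div)
  qed
  have "ln (ln (real n)) - ln (ln 2) \<le> (\<Sum>i\<in>{2..<n}. ?b i)" if "2 \<le> n" for n
    using that
  proof (induction n rule: dec_induct)
    case (step m)
    then show ?case using \<open>\<And>i. 2 \<le> i \<Longrightarrow> ln (ln (real (Suc i))) - ln (ln (real i)) \<le> ?b i\<close>[of m] by simp
  qed simp
  moreover have "(\<Sum>i\<in>{2..<n}. ?b i) \<le> suminf ?b" for n
    using sm nn by (intro sum_le_suminf) auto
  ultimately have bd: "ln (ln (real n)) \<le> suminf ?b + ln (ln 2)" if "2 \<le> n" for n
    using that by (meson diff_le_eq order_trans)
  define Z where "Z = suminf ?b + ln (ln 2)"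
  obtain n :: nat where n: "exp (exp (Z + 1)) < real n" using reals_Archimedean2 by blast
  have "exp (exp (Z + 1)) > 1" by simp
  then have "1 < real n" using n by linarith
  then have n2: "2 \<le> n" by simp
  have "exp (Z + 1) < ln (real n)" using n n2 by (metis exp_gt_zero less_trans ln_exp ln_less_cancel_iff)
  then have "Z + 1 < ln (ln (real n))" by (metis exp_gt_zero less_trans ln_exp ln_less_cancel_iff)
  then show False using bd[OF n2] by (simp add: Z_def)
qed

definition good :: "nat \<Rightarrow> nat \<Rightarrow> nat \<Rightarrow> real set" where
  "good d L k = {x \<in> Irr. d dvd den (cf_digit x) k \<and> L * digit_sum x k \<le> cf_digit x (Suc k)}"

lemma digit_determined_den: "digit_determined k {x \<in> Irr. P (den (cf_digit x) k)}"
  unfolding digit_determined_def using cpair_digits by (metis (mono_tags, lifting) mem_Collect_eq subsetI)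

lemma digit_determined_good: "digit_determined (Suc k) (good d L k)"
proof -
  have "digits k x = digits k y \<and> cf_digit x (Suc k) = cf_digit y (Suc k)"
    if "digits (Suc k) x = digits (Suc k) y" for x y
    using that by (simp add: digits_Suc)
  moreover have "digit_sum x k = digit_sum y k" if "digits k x = digits k y" for x y
    using that by (auto simp: digit_sum_def digits_eq_iff intro!: sum.cong)
  moreover have "den (cf_digit x) k = den (cf_digit y) k" if "digits k x = digits k y" for x y
    using cpair_digits[OF that] by simp
  ultimately show ?thesis
    unfolding digit_determined_def good_def by (metis (mono_tags, lifting) mem_Collect_eq subsetI)
qed

text \<open>The constant collects \<open>1 / 2\<close> for a moderate digit sum, one factor
  \<open>c\<close> for each of the two auxiliary digits, and \<open>1 / 16\<close> for the
  disjointification. It depends neither on the cylinder nor on \<open>n0\<close>, as the zero--one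
  argument requires. Restricting to \<open>2 * i + r\<close> fixes the parity, which the two
  auxiliary digits preserve.\<close>

lemma good_on_cylinders:
  fixes d L n0 r :: nat
  assumes d: "1 \<le> d" and L: "1 \<le> L" and x: "x \<in> Irr" and r: "r \<le> 1"
  defines "c \<equiv> 1 / (2 * real d * (real d + 1))"
  shows "c * c / 32 * measure lborel (cylinder n x)
    \<le> measure lborel ((\<Union>i\<in>{n0..}. good d L (2 * i + r + 2)) \<inter> cylinder n x)"
proof -
  define X where "X = cylinder n x"
  have X: "digit_determined n X" unfolding X_def by (rule digit_determined_cylinder)
  \<comment> \<open>An upper bound for \<open>L\<close> times the digit sum at \<open>k + 2\<close>:
    the threshold covers the first \<open>k\<close> digits, and the two auxiliary digits add at most
    \<open>2 * d\<close>.\<close>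
  define m where "m = (\<lambda>k. nat \<lceil>real L * (sum_threshold k + 2 * real d)\<rceil>)"
  have sum_threshold_nn: "0 \<le> sum_threshold k" for k by (cases "k = 0") (auto simp: sum_threshold_def)
  have m_ge: "real L * (sum_threshold k + 2 * real d) \<le> real (m k)" for k
    using sum_threshold_nn[of k] by (simp add: m_def)
  have m_le: "real (m k) \<le> real L * (sum_threshold k + 2 * real d) + 1" for k
  proof -
    have "0 \<le> real L * (sum_threshold k + 2 * real d)" using sum_threshold_nn[of k] by simp
    then show ?thesis unfolding m_def by linarith
  qed
  have m1: "1 \<le> m k" for k
  proof -
    have "1 * 1 \<le> real L * (sum_threshold k + 2 * real d)" using L d sum_threshold_nn[of k] by (intro mult_mono) auto
    then show ?thesis using m_ge[of k] by linarith
  qed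
  have ln_ge_half: "1 \<le> real k * ln (real k)" if "3 \<le> k" for k
  proof -
    have "1 \<le> ln (real k)" using that exp_le by (metis exp_gt_zero le_trans of_nat_le_iff of_nat_numeral order_trans ln_exp ln_le_cancel_iff less_le_trans)
    then have "1 * 1 \<le> real k * ln (real k)" using that by (intro mult_mono) auto
    then show ?thesis by simp
  qed
  define ki where "ki = (\<lambda>i. 2 * i + r)"
  define a where "a = (\<lambda>i. 1 / real (m (ki i)))"
  have "\<not> summable a"
  proof
    assume sm: "summable a"
    define C where "C = real L * (64 + 2 * real d) + 1"
    have C: "0 < C" using L by (simp add: C_def add_nonneg_pos)
    \<comment> \<open>With \<open>k = 2 * i + r\<close> one has
      \<open>k \<le> 3 * i \<le> i ^ 3\<close>, hence \<open>k * ln k\<close> is at most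
      \<open>(3 * i) * (3 * ln i)\<close>; this is the 9.\<close>
    have "1 / (real i * ln (real i)) \<le> 9 * C * a i" if i: "2 \<le> i" for i
    proof -
      define k where "k = ki i"
      have k: "3 \<le> k" "k \<le> 3 * i" using i r by (auto simp: k_def ki_def)
      have kl: "1 \<le> real k * ln (real k)" using ln_ge_half[OF k(1)] .
      have "real (m k) \<le> real L * (64 * (real k * ln (real k)) + 2 * real d * (real k * ln (real k))) + 1 * (real k * ln (real k))"
        using m_le[of k] mult_left_mono[OF kl, of "real L * (2 * real d)"] kl
        by (simp add: sum_threshold_def algebra_simps)
      also have "\<dots> = C * (real k * ln (real k))" by (simp add: C_def algebra_simps)
      also have "\<dots> \<le> C * ((3 * real i) * (3 * ln (real i)))"
      proof -
        have "3 * i \<le> i ^ 3" 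
        proof -
          have "2 * 2 \<le> i * i" using i by (intro mult_mono) auto
          then have "3 * i \<le> (i * i) * i" by (intro mult_right_mono) auto
          then show ?thesis by (simp add: power3_eq_cube)
        qed
        then have "real k \<le> real i ^ 3" using k(2) by (metis le_trans of_nat_le_iff of_nat_power)
        then have "ln (real k) \<le> ln (real i ^ 3)" using k by (intro ln_mono) auto
        also have "\<dots> = 3 * ln (real i)" using i by (simp add: ln_realpow)
        finally show ?thesis using k i C by (intro mult_left_mono mult_mono) auto
      qed
      finally have le: "real (m k) \<le> 9 * C * (real i * ln (real i))" by simp
      have "0 < real i * ln (real i)" using i by simp
      moreover have "0 < real (m k)" using m1[of k] by simp
      ultimately show ?thesis using le by (simp add: a_def k_def[symmetric] field_simps)
    qed
    then have "summable (\<lambda>i. 1 / (real i * ln (real i)))"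
      using sm C by (intro summable_comparison_test'[OF summable_mult[OF sm, of "9 * C"], of 2]) auto
    then show False using not_summable_inverse_n_ln by simp
  qed
  moreover have a0: "0 \<le> a i" for i by (simp add: a_def)
  \<comment> \<open>Beyond \<open>N\<close> the given cylinder is already determined, the index
    exceeds \<open>n0\<close>, \<open>digit_sum_tight\<close> applies, and the digits fixed by the
    cylinder sum to at most \<open>k\<close>.\<close>
  moreover define N where "N = Max {n, n0, 8, digit_sum x n}"
  have N: "n \<le> N" "n0 \<le> N" "8 \<le> N" "digit_sum x n \<le> N" by (auto simp: N_def)
  have kiN: "N \<le> ki i" if "N \<le> i" for i using that by (simp add: ki_def)
  moreover have "a i \<le> 1 / 8" if "N \<le> i" for i
  proof -
    define k where "k = ki i"
    have k: "8 \<le> k" using kiN[OF that] N by (simp add: k_def)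
    have "1 * (64 * 1) \<le> real L * (sum_threshold k + 2 * real d)"
      using ln_ge_half[of k] k L by (intro mult_mono) (auto simp: sum_threshold_def mult.assoc intro: add_increasing2)
    then have "8 \<le> real (m k)" using m_ge[of k] by linarith
    then show ?thesis by (simp add: a_def k_def[symmetric] field_simps)
  qed
  ultimately obtain N' where N': "1 / 8 \<le> (\<Sum>i\<in>{N..<N'}. a i)" "(\<Sum>i\<in>{N..<N'}. a i) \<le> 1 / 4"
    using divergent_window[of a N] by blast
  define K where "K = ki ` {N..<N'}"
  have inj: "inj_on ki {N..<N'}" by (auto simp: inj_on_def ki_def)
  have sumK: "(\<Sum>k\<in>K. 1 / real (m k)) = (\<Sum>i\<in>{N..<N'}. a i)"
    unfolding K_def a_def using inj by (simp add: sum.reindex)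
  define E where "E = (\<lambda>k. {y \<in> Irr. m k \<le> cf_digit y (Suc (k + 2))})"
  define S where "S = (\<lambda>k. {y \<in> Irr. real (digit_sum y k) \<le> sum_threshold k})"
  define Y1 where "Y1 = (\<lambda>k. {y \<in> Irr. coprime (den (cf_digit y) (Suc k)) d} \<inter> {y \<in> Irr. cf_digit y (Suc k) \<le> d})"
  define Y2 where "Y2 = (\<lambda>k. {y \<in> Irr. d dvd den (cf_digit y) (Suc (Suc k))} \<inter> {y \<in> Irr. cf_digit y (Suc (Suc k)) \<le> d})"
  define G where "G = (\<lambda>k. X \<inter> S k \<inter> Y1 k \<inter> Y2 k \<inter> E k)"
  have lE: "digit_determined (k + 3) (E k)" for k
    unfolding E_def by (intro digit_determined_digit[of "Suc (k + 2)" "k + 3"]) auto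
  have lS: "digit_determined k (S k)" for k unfolding S_def by (rule digit_determined_digit_sum)
  have lY1: "digit_determined (Suc k) (Y1 k)" for k
    unfolding Y1_def by (intro digit_determined_Int digit_determined_den digit_determined_digit[of "Suc k" "Suc k"]) auto
  have lY2: "digit_determined (Suc (Suc k)) (Y2 k)" for k
    unfolding Y2_def by (intro digit_determined_Int digit_determined_den digit_determined_digit[of "Suc (Suc k)" "Suc (Suc k)"]) auto
  have Kge: "N \<le> k" if "k \<in> K" for k using that kiN by (auto simp: K_def)
  have lXS: "digit_determined k (X \<inter> S k)" if "k \<in> K" for k
    using digit_determined_mono[OF X] Kge[OF that] N by (intro digit_determined_Int lS) auto
  have l1: "digit_determined (Suc k) (X \<inter> S k \<inter> Y1 k)" if "k \<in> K" for k
    using digit_determined_Int[OF digit_determined_mono[OF lXS[OF that], of "Suc k"] lY1] by simp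
  have l2: "digit_determined (k + 2) (X \<inter> S k \<inter> Y1 k \<inter> Y2 k)" if "k \<in> K" for k
    using digit_determined_Int[OF digit_determined_mono[OF l1[OF that], of "Suc (Suc k)"] lY2[of k]] by simp
  have lG: "digit_determined (k + 3) (G k)" if "k \<in> K" for k
    unfolding G_def using digit_determined_Int[OF digit_determined_mono[OF l2[OF that], of "k + 3"] lE] by simp
  have c0: "0 < c" using d by (simp add: c_def)
  have dsX: "real (digit_sum y n) \<le> real N" if "y \<in> X" for y
  proof -
    have "digit_sum y n = digit_sum x n"
      using that by (auto simp: X_def cylinder_def digit_sum_def digits_eq_iff intro!: sum.cong)
    then show ?thesis using N by simp
  qed
  have low: "c * c / 2 * measure lborel X / real (m k) \<le> measure lborel (G k)" if k: "k \<in> K" for k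
  proof -
    have 1: "1 / 2 * measure lborel X \<le> measure lborel (X \<inter> S k)"
      unfolding S_def using Kge[OF k] N dsX by (intro digit_sum_tight[OF X]) force+
    have 2: "c * measure lborel (X \<inter> S k) \<le> measure lborel (X \<inter> S k \<inter> Y1 k)"
      unfolding c_def
    proof (rule digit_determined_choice[OF lXS[OF k] lY1])
      fix z assume "z \<in> X \<inter> S k"
      then have z: "z \<in> Irr" by (auto simp: S_def)
      obtain u where u: "1 \<le> u" "u \<le> d" "coprime (u * den (cf_digit z) k + den' (cf_digit z) k) d"
        using ex_coprime_extension[OF coprime_den_den' d] by blast
      have "{y \<in> cylinder k z. cf_digit y (Suc k) = u} \<subseteq> Y1 k"
      proof
        fix y assume "y \<in> {y \<in> cylinder k z. cf_digit y (Suc k) = u}"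
        then have y: "y \<in> Irr" "digits k y = digits k z" "cf_digit y (Suc k) = u" by (auto simp: cylinder_def)
        show "y \<in> Y1 k" using y u cpair_digits[OF y(2)] by (simp add: Y1_def)
      qed
      then show "\<exists>u\<ge>1. u \<le> d \<and> {y \<in> cylinder k z. cf_digit y (Suc k) = u} \<subseteq> Y1 k" using u by blast
    qed
    have 3: "c * measure lborel (X \<inter> S k \<inter> Y1 k) \<le> measure lborel (X \<inter> S k \<inter> Y1 k \<inter> Y2 k)"
      unfolding c_def
    proof (rule digit_determined_choice[OF l1[OF k] lY2])
      fix z assume zz: "z \<in> X \<inter> S k \<inter> Y1 k"
      then have z: "z \<in> Irr" by (auto simp: S_def)
      obtain u where u: "1 \<le> u" "u \<le> d" "d dvd u * den (cf_digit z) (Suc k) + den' (cf_digit z) (Suc k)"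
        using ex_divisible_extension[OF _ d, of "den (cf_digit z) (Suc k)"] zz unfolding Y1_def by blast
      have "{y \<in> cylinder (Suc k) z. cf_digit y (Suc (Suc k)) = u} \<subseteq> Y2 k"
      proof
        fix y assume "y \<in> {y \<in> cylinder (Suc k) z. cf_digit y (Suc (Suc k)) = u}"
        then have y: "y \<in> Irr" "digits (Suc k) y = digits (Suc k) z" "cf_digit y (Suc (Suc k)) = u" by (auto simp: cylinder_def)
        have "den (cf_digit y) (Suc (Suc k)) = u * den (cf_digit z) (Suc k) + den' (cf_digit z) (Suc k)"
          using cpair_digits[OF y(2), of "(1, 0)"] y(3)
          by (subst cpair.simps) (simp del: cpair.simps)
        then show "y \<in> Y2 k" using y u by (simp add: Y2_def del: cpair.simps)
      qed
      then show "\<exists>u\<ge>1. u \<le> d \<and> {y \<in> cylinder (Suc k) z. cf_digit y (Suc (Suc k)) = u} \<subseteq> Y2 k" using u by blast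
    qed
    have 4: "1 / real (m k) * measure lborel (X \<inter> S k \<inter> Y1 k \<inter> Y2 k) \<le> measure lborel (G k)"
      unfolding G_def E_def using digit_determined_ge_lower[OF l2[OF k] m1[of k]] by simp
    have "c * c / 2 * measure lborel X \<le> c * c * measure lborel (X \<inter> S k)"
      using mult_left_mono[OF 1, of "c * c"] c0 by simp
    also have "\<dots> \<le> c * measure lborel (X \<inter> S k \<inter> Y1 k)"
      using mult_left_mono[OF 2, of c] c0 by simp
    also have "\<dots> \<le> measure lborel (X \<inter> S k \<inter> Y1 k \<inter> Y2 k)" by (rule 3)
    finally have "c * c / 2 * measure lborel X / real (m k) \<le> measure lborel (X \<inter> S k \<inter> Y1 k \<inter> Y2 k) / real (m k)"
      by (intro divide_right_mono) auto
    then show ?thesis using 4 by simp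
  qed
  have "c * c / 2 * measure lborel X / 16 \<le> measure lborel (\<Union>k\<in>K. G k)"
  proof (rule disjointified_union_bound[of K G E "\<lambda>k. real (m k)"])
    show "finite K" by (simp add: K_def)
    show "G k \<in> fmeasurable lborel" if "k \<in> K" for k using digit_determined_fmeasurable[OF lG[OF that]] .
    show "E k \<in> sets lborel" for k using digit_determined_borel[OF lE] by simp
    show "G k \<subseteq> E k" for k by (auto simp: G_def)
    \<comment> \<open>\<open>G j\<close> depends on the first \<open>j + 3 \<le> k + 2\<close>
      digits and \<open>E k\<close> only on digit \<open>k + 3\<close>, so the conditional tail
      bound applies.\<close>
    show "measure lborel (G j \<inter> E k) \<le> 2 / real (m k) * measure lborel (G j)"
      if "j \<in> K" "k \<in> K" "j < k" for j k
      unfolding E_def using that digit_determined_mono[OF lG[OF that(1)], of "k + 2"] by (intro digit_determined_ge_upper m1) auto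
    show "0 < real (m k)" for k using m1[of k] by simp
    show "c * c / 2 * measure lborel X / real (m k) \<le> measure lborel (G k)" if "k \<in> K" for k
      using low[OF that] .
  qed (use sumK N' in auto)
  also have "\<dots> \<le> measure lborel ((\<Union>i\<in>{n0..}. good d L (2 * i + r + 2)) \<inter> cylinder n x)"
  proof (rule measure_mono_fmeasurable)
    have "(\<Union>i\<in>{n0..}. good d L (2 * i + r + 2)) \<in> sets borel"
      by (intro sets.countable_UN'') (auto intro: digit_determined_borel[OF digit_determined_good])
    then show "(\<Union>i\<in>{n0..}. good d L (2 * i + r + 2)) \<inter> cylinder n x \<in> fmeasurable lborel"
      using cylinder_borel[OF x] by (intro Irr_fmeasurable) (auto simp: cylinder_def)
    show "(\<Union>k\<in>K. G k) \<in> sets lborel"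
      using digit_determined_borel[OF lG] by (intro sets.finite_UN) (auto simp: K_def)
    show "(\<Union>k\<in>K. G k) \<subseteq> (\<Union>i\<in>{n0..}. good d L (2 * i + r + 2)) \<inter> cylinder n x"
    proof
      fix y assume "y \<in> (\<Union>k\<in>K. G k)"
      then obtain i where i: "N \<le> i" "y \<in> G (ki i)" by (auto simp: K_def)
      define k where "k = ki i"
      have y: "y \<in> X" "y \<in> Irr" "real (digit_sum y k) \<le> sum_threshold k" "cf_digit y (Suc k) \<le> d"
          "d dvd den (cf_digit y) (Suc (Suc k))" "cf_digit y (Suc (Suc k)) \<le> d" "m k \<le> cf_digit y (Suc (k + 2))"
        using i(2) by (auto simp: G_def S_def Y1_def Y2_def E_def k_def simp del: cpair.simps)
      have "real (L * digit_sum y (k + 2)) = real L * (real (digit_sum y k) + real (cf_digit y (Suc k)) + real (cf_digit y (Suc (Suc k))))"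
        by (simp add: digit_sum_def)
      also have "\<dots> \<le> real L * (sum_threshold k + 2 * real d)" using y by (intro mult_left_mono) auto
      also have "\<dots> \<le> real (m k)" by (rule m_ge)
      also have "\<dots> \<le> real (cf_digit y (Suc (k + 2)))" using y by simp
      finally have "L * digit_sum y (k + 2) \<le> cf_digit y (Suc (k + 2))" by (simp only: of_nat_le_iff)
      then have "y \<in> good d L (k + 2)" using y by (simp add: good_def del: cpair.simps)
      then show "y \<in> (\<Union>i\<in>{n0..}. good d L (2 * i + r + 2)) \<inter> cylinder n x"
        using i(1) N y(1) by (auto simp: k_def ki_def X_def)
    qed
  qed
  finally show ?thesis by (simp add: X_def)
qed

text \<open>Multiple, starting index and parity range over countable sets, so one null set serves
  them all; having some \<open>k \<ge> n\<close> for every \<open>n\<close> expresses infinitely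
  many good indices.\<close>

lemma AE_good:
  assumes d: "1 \<le> d"
  shows "AE x in lborel. x \<in> Irr \<longrightarrow> (\<forall>L n r. r \<le> 1 \<longrightarrow>
    (\<exists>k\<ge>n. k mod 2 = r \<and> d dvd den (cf_digit x) k \<and> L * digit_sum x k \<le> cf_digit x (Suc k)))"
proof -
  have main: "AE x in lborel. x \<in> Irr \<longrightarrow> x \<in> (\<Union>i\<in>{n0..}. good d L (2 * i + r + 2))"
    if "1 \<le> L" "r \<le> 1" for L n0 r
  proof -
    define B where "B = (\<Union>i\<in>{n0..}. good d L (2 * i + r + 2))"
    have B: "B \<in> sets borel" unfolding B_def
      by (intro sets.countable_UN'') (auto intro: digit_determined_borel[OF digit_determined_good])
    have BI: "B \<subseteq> Irr" by (auto simp: B_def good_def)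
    have "measure lborel (Irr - B) = 0"
      using good_on_cylinders[OF d that(1) _ that(2)] d
      by (intro full_measure_if_uniform_on_cylinders[OF B BI,
            of "1 / (2 * real d * (real d + 1)) * (1 / (2 * real d * (real d + 1))) / 32"])
         (auto simp: B_def)
    moreover have fm: "Irr - B \<in> fmeasurable lborel" using B Irr_borel by (intro Irr_fmeasurable) auto
    ultimately have "emeasure lborel (Irr - B) = 0" using emeasure_eq_measure2[OF fm] by simp
    then have "Irr - B \<in> null_sets lborel" using fmeasurableD[OF fm] by (rule null_setsI)
    then show ?thesis unfolding B_def[symmetric] by (rule AE_I') auto
  qed
  have "AE x in lborel. \<forall>L\<in>{1..}. \<forall>n0. \<forall>r\<in>{..1::nat}. x \<in> Irr \<longrightarrow> x \<in> (\<Union>i\<in>{n0..}. good d L (2 * i + r + 2))"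
  proof (subst AE_ball_countable, simp, intro ballI, subst AE_all_countable, intro allI,
      subst AE_ball_countable, simp, intro ballI)
    fix L n0 r :: nat
    assume "L \<in> {1..}" "r \<in> {..1}"
    then show "AE x in lborel. x \<in> Irr \<longrightarrow> x \<in> (\<Union>i\<in>{n0..}. good d L (2 * i + r + 2))"
      by (intro main) auto
  qed
  then show ?thesis
  proof (eventually_elim, intro impI allI)
    fix x L n r :: nat and y :: real
    assume h: "\<forall>L\<in>{1..}. \<forall>n0. \<forall>r\<in>{..1::nat}. y \<in> Irr \<longrightarrow> y \<in> (\<Union>i\<in>{n0..}. good d L (2 * i + r + 2))"
      and y: "y \<in> Irr" and r: "r \<le> 1"
    \<comment> \<open>The multiple \<open>Suc L\<close> covers the value \<open>L = 0\<close>, which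
      the countable intersection leaves out.\<close>
    have "y \<in> (\<Union>i\<in>{n..}. good d (Suc L) (2 * i + r + 2))" using h[rule_format, of "Suc L" r n] y r by auto
    then obtain i where i: "n \<le> i" "d dvd den (cf_digit y) (2 * i + r + 2)"
        "Suc L * digit_sum y (2 * i + r + 2) \<le> cf_digit y (Suc (2 * i + r + 2))"
      by (auto simp: good_def simp del: cpair.simps)
    have "L * digit_sum y (2 * i + r + 2) \<le> cf_digit y (Suc (2 * i + r + 2))" using i(3) by simp
    moreover have "(2 * i + r + 2) mod 2 = r" using r by (cases "r = 0") auto
    ultimately show "\<exists>k\<ge>n. k mod 2 = r \<and> d dvd den (cf_digit y) k \<and> L * digit_sum y k \<le> cf_digit y (Suc k)"
      using i(1,2) by (intro exI[of _ "2 * i + r + 2"]) auto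
  qed
qed

text \<open>The tail measures are \<open>O(1 / k^2)\<close>, so Borel--Cantelli applies. The purpose
  is to keep the logarithm of a dominating digit of order \<open>ln q\<close>.\<close>

lemma AE_digit_bound:
  "AE x in lborel. x \<in> Irr \<longrightarrow> (\<forall>\<^sub>F k in sequentially. cf_digit x (Suc k) \<le> (Suc k)\<^sup>2)"
proof -
  define A where "A = (\<lambda>k. {x \<in> Irr. (Suc k)\<^sup>2 \<le> cf_digit x (Suc k)})"
  have lA: "digit_determined (Suc k) (A k)" for k
    unfolding A_def by (intro digit_determined_digit[of "Suc k" "Suc k"]) auto
  have mA: "measure lborel (A k) \<le> 2 / real ((Suc k)\<^sup>2) * measure lborel Irr" for k
    using digit_determined_ge_upper[OF digit_determined_Irr, of "(Suc k)\<^sup>2" k] by (simp add: A_def Int_absorb1 subset_eq)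
  have sm: "summable (\<lambda>k. 2 * measure lborel Irr * inverse (real (Suc k) ^ 2))"
    using inverse_power_summable[of 2, where 'a=real] by (intro summable_mult) (subst summable_Suc_iff, simp)
  have "AE x in lborel. eventually (\<lambda>n. x \<in> space lborel - A n) sequentially"
  proof (rule borel_cantelli_AE1)
    show "A k \<in> sets lborel" for k using digit_determined_borel[OF lA] by simp
    show "emeasure lborel (A k) < \<infinity>" for k using digit_determined_fmeasurable[OF lA] by (simp add: fmeasurable_def)
    show "summable (\<lambda>k. measure lborel (A k))"
      using mA by (intro summable_comparison_test'[OF sm, of 0]) (simp add: field_simps)
  qed
  then show ?thesis
  proof eventually_elim
    case (elim x)
    show ?case
    proof
      assume x: "x \<in> Irr"
      show "\<forall>\<^sub>F k in sequentially. cf_digit x (Suc k) \<le> (Suc k)\<^sup>2"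
        using elim by (rule eventually_mono) (use x in \<open>auto simp: A_def\<close>)
    qed
  qed
qed

section \<open>Periodic functions of bounded variation\<close>

lemma periodic_add_int:
  assumes "one_periodic u"
  shows "u (x + of_int k) = u x"
proof (induction k rule: int_induct[where k = 0])
  case (step1 i)
  have "u (x + of_int (i + 1)) = u ((x + of_int i) + 1)" by (simp add: algebra_simps)
  then show ?case using step1 assms by (simp add: one_periodic_def)
next
  case (step2 i)
  have "u (x + of_int (i - 1)) = u ((x + of_int (i - 1)) + 1)"
    using assms[unfolded one_periodic_def, rule_format, of "x + of_int (i - 1)"] by (rule sym)
  also have "(x + of_int (i - 1)) + 1 = x + of_int i" by simp
  finally show ?case using step2 by simp
qed simp

lemma periodic_frac: "one_periodic u \<Longrightarrow> u (frac x) = u x"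
  using periodic_add_int[of u "frac x" "\<lfloor>x\<rfloor>"] by (simp add: frac_def)

lemma has_integral_period:
  fixes u :: "real \<Rightarrow> real"
  assumes per: "one_periodic u" and I: "(u has_integral I) {0..1}"
  shows "(u has_integral I) {c..c + 1}"
proof -
  define s where "s = frac c"
  have s: "0 \<le> s" "s \<le> 1" using frac_lt_1[of c] by (auto simp: s_def less_imp_le)
  have int: "u integrable_on {0..1}" using I by (rule has_integral_integrable)
  have int1: "u integrable_on {0..s}" "u integrable_on {s..1}"
    using s by (auto intro: integrable_subinterval_real[OF int])
  define I1 where "I1 = integral {0..s} u"
  define I2 where "I2 = integral {s..1} u"
  have I12: "I1 + I2 = I"
    using Henstock_Kurzweil_Integration.integral_combine[OF s int] I by (simp add: I1_def I2_def integral_unique)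
  have h1: "(u has_integral I1) {0..s}" "(u has_integral I2) {s..1}"
    using int1 by (auto simp: I1_def I2_def integrable_integral)
  have shift: "(u has_integral J) {a + of_int k..b + of_int k}" if "(u has_integral J) {a..b}" for J a b and k :: int
  proof -
    have "((\<lambda>x. u (x + of_int (- k))) has_integral J) {a - of_int (- k)..b - of_int (- k)}"
      by (rule has_integral_shift_real_ivl[OF that])
    moreover have "u (x + of_int (- k)) = u x" for x by (rule periodic_add_int[OF per])
    ultimately show ?thesis by simp
  qed
  have "(u has_integral I1) {1..1 + s}" using shift[OF h1(1), of 1] by (simp add: add.commute)
  then have "(u has_integral I2 + I1) {s..1 + s}"
    using h1(2) s by (intro has_integral_combine[of s 1 "1 + s"]) auto
  then have "(u has_integral I2 + I1) {s + of_int \<lfloor>c\<rfloor>..1 + s + of_int \<lfloor>c\<rfloor>}" by (rule shift)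
  moreover have "s + of_int \<lfloor>c\<rfloor> = c" by (simp add: s_def frac_def)
  moreover have "1 + s + of_int \<lfloor>c\<rfloor> = c + 1" by (simp add: s_def frac_def)
  ultimately show ?thesis using I12 by (simp add: add.commute)
qed

text \<open>Total variation at most \<open>W\<close> over a period, encoded by a quasi-periodic monotone majorant \<open>w\<close> of the increments
on the whole line: sums over arbitrarily translated partitions then telescope.\<close>

definition bv_by :: "(real \<Rightarrow> real) \<Rightarrow> real \<Rightarrow> bool" where
  "bv_by u W \<longleftrightarrow> one_periodic u \<and> u integrable_on {0..1} \<and>
    (\<exists>w. (\<forall>y z. y \<le> z \<longrightarrow> \<bar>u z - u y\<bar> \<le> w z - w y) \<and> (\<forall>y. w (y + 1) = w y + W))"

text \<open>On each period \<open>w\<close> copies \<open>v\<close>, and it gains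
  \<open>2 * V\<close> at every integer: one \<open>V\<close> makes up for the drop of
  \<open>v\<close> back to its start, the other pays for the oscillation of \<open>u\<close> across
  the integer.\<close>

lemma periodic_majorant:
  fixes v :: "real \<Rightarrow> real"
  assumes per: "one_periodic u"
    and v: "\<And>y z. 0 \<le> y \<Longrightarrow> y \<le> z \<Longrightarrow> z < 1 \<Longrightarrow> \<bar>u z - u y\<bar> \<le> v z - v y"
    and vb: "\<And>y. 0 \<le> y \<Longrightarrow> y < 1 \<Longrightarrow> 0 \<le> v y \<and> v y \<le> V"
  shows "\<exists>w. (\<forall>y z. y \<le> z \<longrightarrow> \<bar>u z - u y\<bar> \<le> w z - w y) \<and> (\<forall>y. w (y + 1) = w y + 2 * V)"
proof -
  define w where "w = (\<lambda>y. v (frac y) + 2 * V * of_int \<lfloor>y\<rfloor>)"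
  have V: "0 \<le> V" using vb[of 0] by auto
  have frac01: "0 \<le> frac y" "frac y < 1" for y :: real by (auto simp: frac_lt_1)
  have osc: "\<bar>u a - u b\<bar> \<le> V" for a b
  proof -
    have *: "\<bar>u (frac a) - u (frac b)\<bar> \<le> V" if "frac b \<le> frac a" for a b
      using v[of "frac b" "frac a"] vb[of "frac a"] vb[of "frac b"] frac01[of a] frac01[of b] that by auto
    show ?thesis
      using *[of a b] *[of b a] periodic_frac[OF per, of a] periodic_frac[OF per, of b]
      by (cases "frac b \<le> frac a") (auto simp: abs_minus_commute)
  qed
  have "\<bar>u z - u y\<bar> \<le> w z - w y" if "y \<le> z" for y z
  proof (cases "\<lfloor>y\<rfloor> = \<lfloor>z\<rfloor>")
    case True
    then have "frac y \<le> frac z" using that by (simp add: frac_def)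
    then have "\<bar>u (frac z) - u (frac y)\<bar> \<le> v (frac z) - v (frac y)" using v frac01 by auto
    then show ?thesis using True periodic_frac[OF per] by (simp add: w_def)
  next
    case False
    then have "\<lfloor>y\<rfloor> + 1 \<le> \<lfloor>z\<rfloor>" using floor_mono[OF that] by linarith
    then have "1 \<le> real_of_int \<lfloor>z\<rfloor> - real_of_int \<lfloor>y\<rfloor>" by linarith
    then have "2 * V * 1 \<le> 2 * V * (real_of_int \<lfloor>z\<rfloor> - real_of_int \<lfloor>y\<rfloor>)" using V by (intro mult_left_mono) auto
    then have "2 * V \<le> 2 * V * real_of_int \<lfloor>z\<rfloor> - 2 * V * real_of_int \<lfloor>y\<rfloor>" by (simp add: algebra_simps)
    then show ?thesis
      using osc[of z y] vb[of "frac z"] vb[of "frac y"] frac01[of z] frac01[of y] by (simp add: w_def)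
  qed
  moreover have "w (y + 1) = w y + 2 * V" for y
  proof -
    have "frac (y + 1) = frac y" by (rule frac_1_eq)
    then show ?thesis by (simp add: w_def algebra_simps)
  qed
  ultimately show ?thesis by blast
qed

lemma bv_byI:
  fixes v :: "real \<Rightarrow> real"
  assumes "one_periodic u" "u integrable_on {0..1}"
    and "\<And>y z. 0 \<le> y \<Longrightarrow> y \<le> z \<Longrightarrow> z < 1 \<Longrightarrow> \<bar>u z - u y\<bar> \<le> v z - v y"
    and "\<And>y. 0 \<le> y \<Longrightarrow> y < 1 \<Longrightarrow> 0 \<le> v y \<and> v y \<le> V"
  shows "bv_by u (2 * V)"
  using assms periodic_majorant[of u v V] unfolding bv_by_def by blast

lemma bv_by_reflect:
  assumes "bv_by u W"
  shows "bv_by (\<lambda>y. u (- y)) W" and "integral {0..1} (\<lambda>y. u (- y)) = integral {0..1} u"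
proof -
  have per: "one_periodic u" and int: "u integrable_on {0..1}" using assms by (auto simp: bv_by_def)
  obtain w where w: "\<And>y z. y \<le> z \<Longrightarrow> \<bar>u z - u y\<bar> \<le> w z - w y" "\<And>y. w (y + 1) = w y + W"
    using assms by (auto simp: bv_by_def)
  have per': "one_periodic (\<lambda>y. u (- y))"
    unfolding one_periodic_def
  proof
    fix x show "u (- (x + 1)) = u (- x)" using periodic_add_int[OF per, of "- x" "-1"] by (simp add: algebra_simps)
  qed
  have hi: "((\<lambda>y. u (- y)) has_integral integral {0..1} u) {0..1}"
  proof -
    have "(u has_integral integral {0..1} u) {- 1..- 1 + 1}"
      by (intro has_integral_period[OF per] integrable_integral int)
    then have "((\<lambda>y. u (- y)) has_integral integral {0..1} u) {- 0..- (- 1)}"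
      by (subst has_integral_reflect_real) simp
    then show ?thesis by simp
  qed
  show "integral {0..1} (\<lambda>y. u (- y)) = integral {0..1} u" using hi by (rule integral_unique)
  have "\<bar>u (- z) - u (- y)\<bar> \<le> (- w (- z)) - (- w (- y))" if "y \<le> z" for y z
    using w(1)[of "- z" "- y"] that by (simp add: abs_minus_commute)
  moreover have "(- w (- (y + 1))) = (- w (- y)) + W" for y
    using w(2)[of "- (y + 1)"] by simp
  ultimately show "bv_by (\<lambda>y. u (- y)) W"
    using per' has_integral_integrable[OF hi] unfolding bv_by_def
    by (intro conjI exI[of _ "\<lambda>y. - w (- y)"]) auto
qed

section \<open>The Denjoy--Koksma inequality\<close>

lemma sum_periodic_reindex:
  fixes p :: int and q :: nat
  assumes per: "one_periodic F" and q: "0 < q" and cop: "coprime p (int q)"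
  shows "(\<Sum>n = 1..q. F (c + real n * real_of_int p / real q)) = (\<Sum>m<q. F (c + real m / real q))"
proof -
  define \<rho> where "\<rho> = (\<lambda>n::nat. nat ((0 + int n * p) mod int q))"
  have "F (c + real n * real_of_int p / real q) = F (c + real (\<rho> n) / real q)" for n
  proof -
    have "int n * p = int (\<rho> n) + ((int n * p) div int q) * int q"
      using q by (simp add: \<rho>_def)
    then have "real_of_int (int n * p) = real_of_int (int (\<rho> n) + ((int n * p) div int q) * int q)" by simp
    then have e: "real n * real_of_int p = real (\<rho> n) + real_of_int ((int n * p) div int q) * real q" by simp
    have "c + real n * real_of_int p / real q = (c + real (\<rho> n) / real q) + of_int ((int n * p) div int q)"
      unfolding e using q by (simp add: add_divide_distrib)
    then show ?thesis using periodic_add_int[OF per] by metis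
  qed
  then have "(\<Sum>n = 1..q. F (c + real n * real_of_int p / real q)) = (\<Sum>n\<in>{0<..0 + q}. F (c + real (\<rho> n) / real q))"
    by (intro sum.cong) auto
  also have "\<dots> = (\<Sum>m<q. F (c + real m / real q))"
    unfolding \<rho>_def by (rule sum.reindex_bij_betw[OF bij_betw_residues[OF cop q]])
  finally show ?thesis .
qed

text \<open>Each orbit point lies in its own cell of length \<open>h = 1 / q\<close>, and the cells
  tile one period. Replacing \<open>u\<close> at the point by its mean over the cell costs at most
  the increment \<open>D\<close> of the majorant there, and these increments telescope to
  \<open>W\<close>.\<close>

lemma denjoy_koksma:
  fixes p :: int and q :: nat
  assumes u: "bv_by u W" and q: "0 < q" and cop: "coprime p (int q)"
    and close: "\<bar>\<alpha> - real_of_int p / real q\<bar> * real q \<le> 1 / real q"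
  shows "\<bar>(\<Sum>n = 1..q. u (y + real n * \<alpha>)) - real q * integral {0..1} u\<bar> \<le> W"
proof -
  have per: "one_periodic u" and int: "u integrable_on {0..1}" using u by (auto simp: bv_by_def)
  obtain w where w: "\<And>y z. y \<le> z \<Longrightarrow> \<bar>u z - u y\<bar> \<le> w z - w y" "\<And>y. w (y + 1) = w y + W"
    using u by (auto simp: bv_by_def)
  have per_hi: "(u has_integral integral {0..1} u) {c..c + 1}" for c
    using has_integral_period[OF per] int by (simp add: integrable_integral)
  define h where "h = 1 / real q"
  have h: "0 < h" "h \<le> 1" using q by (auto simp: h_def)
  have int': "u integrable_on {s..t}" if "t \<le> s + 1" for s t
    using has_integral_integrable[OF per_hi[of s]] that by (rule_tac integrable_subinterval_real) auto
  define \<theta> where "\<theta> = \<alpha> - real_of_int p / real q"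
  \<comment> \<open>The points drift to one side of the lattice by at most \<open>h\<close>, so for
    negative drift the cells have to end at the lattice points instead of starting there.\<close>
  define e where "e = (if 0 \<le> \<theta> then 0 else - h)"
  define c where "c = y + e"
  define D where "D = (\<lambda>s. w (s + h) - w s)"
  define J where "J = (\<lambda>s. integral {s..s + h} u)"
  have perD: "one_periodic D"
    unfolding one_periodic_def D_def
  proof
    fix x show "w (x + 1 + h) - w (x + 1) = w (x + h) - w x"
      using w(2)[of "x + h"] w(2)[of x] by (simp add: add_ac)
  qed
  have perJ: "one_periodic J"
    unfolding one_periodic_def J_def
  proof
    fix s
    have "(u has_integral integral {s..s + h} u) {s..s + h}"
      using int'[of "s + h" s] h by (simp add: integrable_integral)
    then have "((\<lambda>x. u (x + (- 1))) has_integral integral {s..s + h} u) {s - (- 1)..s + h - (- 1)}"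
      by (rule has_integral_shift_real_ivl)
    moreover have "u (x + (- 1)) = u x" for x using periodic_add_int[OF per, of x "- 1"] by simp
    ultimately have "(u has_integral integral {s..s + h} u) {s + 1..s + 1 + h}" by (simp add: algebra_simps)
    then show "integral {s + 1..s + 1 + h} u = integral {s..s + h} u" by (rule integral_unique)
  qed
  have pt: "\<bar>u x - real q * J s\<bar> \<le> D s" if x: "s \<le> x" "x \<le> s + h" for x s
  proof -
    have hi: "((\<lambda>z. u x - u z) has_integral (h * u x - J s)) {s..s + h}"
      using has_integral_diff[OF has_integral_const_real[of "u x" s "s + h"] integrable_integral[OF int'[of "s + h" s]]] h
      by (simp add: J_def)
    have bd: "norm (u x - u z) \<le> D s" if z: "z \<in> {s..s + h}" for z
    proof (cases "z \<le> x")
      case True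
      have "\<bar>u x - u z\<bar> \<le> w x - w z" using w(1)[OF True] .
      moreover have "0 \<le> w z - w s" "0 \<le> w (s + h) - w x"
        using w(1)[of s z] w(1)[of x "s + h"] z x by auto
      ultimately show ?thesis by (simp add: D_def)
    next
      case False
      have "\<bar>u z - u x\<bar> \<le> w z - w x" using w(1)[of x z] False by simp
      moreover have "0 \<le> w x - w s" "0 \<le> w (s + h) - w z"
        using w(1)[of s x] w(1)[of z "s + h"] z x by auto
      ultimately show ?thesis by (simp add: D_def abs_minus_commute)
    qed
    have D0: "0 \<le> D s" using w(1)[of s "s + h"] h by (simp add: D_def)
    have "norm (h * u x - J s) \<le> D s * measure lborel {s..s + h}"
      using has_integral_bound[OF D0 hi[unfolded box_real[symmetric]]] bd by (simp add: box_real)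
    then have "\<bar>h * u x - J s\<bar> \<le> D s * h" using h by simp
    then have "\<bar>h * u x - J s\<bar> / h \<le> D s" using h by (simp add: field_simps)
    moreover have "u x - real q * J s = (h * u x - J s) / h" using h q by (simp add: h_def field_simps)
    ultimately show ?thesis using h by simp
  qed
  have near: "\<bar>u (y + real n * \<alpha>) - real q * J (c + real n * real_of_int p / real q)\<bar>
      \<le> D (c + real n * real_of_int p / real q)" if n: "n \<in> {1..q}" for n
  proof (rule pt)
    have eq: "y + real n * \<alpha> = y + real n * real_of_int p / real q + real n * \<theta>"
      by (simp add: \<theta>_def algebra_simps)
    have "real n * \<bar>\<theta>\<bar> \<le> real q * \<bar>\<theta>\<bar>" using n by (intro mult_right_mono) auto
    also have "\<dots> \<le> h" using close by (simp add: \<theta>_def h_def mult.commute)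
    finally have b: "real n * \<bar>\<theta>\<bar> \<le> h" .
    show "c + real n * real_of_int p / real q \<le> y + real n * \<alpha>"
      unfolding eq using b by (auto simp: c_def e_def)
    show "y + real n * \<alpha> \<le> c + real n * real_of_int p / real q + h"
      unfolding eq using b h n by (auto simp: c_def e_def mult_le_0_iff)
  qed
  have "\<bar>(\<Sum>n = 1..q. u (y + real n * \<alpha>)) - (\<Sum>n = 1..q. real q * J (c + real n * real_of_int p / real q))\<bar>
      \<le> (\<Sum>n = 1..q. D (c + real n * real_of_int p / real q))"
    unfolding sum_subtractf[symmetric] using near by (intro order_trans[OF sum_abs] sum_mono)
  also have "\<dots> = (\<Sum>m<q. D (c + real m / real q))" by (rule sum_periodic_reindex[OF perD q cop])
  also have "\<dots> = (\<Sum>m<q. w (c + real (Suc m) / real q) - w (c + real m / real q))"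
    by (intro sum.cong) (auto simp: D_def h_def add_divide_distrib algebra_simps)
  also have "\<dots> = w (c + real q / real q) - w (c + real 0 / real q)"
    by (rule sum_lessThan_telescope)
  also have "\<dots> = W" using q w(2)[of c] by simp
  finally have 1: "\<bar>(\<Sum>n = 1..q. u (y + real n * \<alpha>)) - (\<Sum>n = 1..q. real q * J (c + real n * real_of_int p / real q))\<bar> \<le> W" .
  have "(\<Sum>n = 1..q. real q * J (c + real n * real_of_int p / real q)) = real q * (\<Sum>m<q. J (c + real m / real q))"
    using sum_periodic_reindex[OF perJ q cop, of c] by (simp only: sum_distrib_left[symmetric])
  also have "(\<Sum>m<q. J (c + real m / real q)) = integral {0..1} u"
  proof -
    have "(\<Sum>m<k. J (c + real m / real q)) = integral {c..c + real k / real q} u" if "k \<le> q" for k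
      using that
    proof (induction k)
      case (Suc k)
      have le: "c + real (Suc k) / real q \<le> c + 1" using Suc.prems q by (simp add: field_simps)
      have "c + real k / real q + h = c + real (Suc k) / real q" by (simp add: h_def add_divide_distrib)
      then have e: "J (c + real k / real q) = integral {c + real k / real q..c + real (Suc k) / real q} u"
        by (simp only: J_def)
      have "(\<Sum>m<Suc k. J (c + real m / real q)) = integral {c..c + real k / real q} u + J (c + real k / real q)"
        using Suc by simp
      also have "\<dots> = integral {c..c + real (Suc k) / real q} u"
        unfolding e using int'[OF le] by (intro Henstock_Kurzweil_Integration.integral_combine) (auto simp: divide_right_mono)
      finally show ?case .
    qed simp
    from this[of q] show ?thesis using q integral_unique[OF per_hi[of c]] by simp
  qed
  finally show ?thesis using 1 by simp
qed

section \<open>Stirling's formula\<close>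

lemma ln_ge_rational:
  fixes y :: real
  assumes "1 \<le> y"
  shows "2 * (y - 1) / (y + 1) \<le> ln y"
proof -
  define F where "F = (\<lambda>y::real. ln y - 2 * (y - 1) / (y + 1))"
  have "F 1 \<le> F y"
  proof (rule DERIV_nonneg_imp_nondecreasing[OF assms])
    fix x :: real assume x: "1 \<le> x" "x \<le> y"
    have "(F has_real_derivative (1 / x - (2 * (x + 1) - 2 * (x - 1)) / (x + 1)\<^sup>2)) (at x)"
      unfolding F_def using x by (auto intro!: derivative_eq_intros simp: power2_eq_square)
    moreover have "0 \<le> 1 / x - (2 * (x + 1) - 2 * (x - 1)) / (x + 1)\<^sup>2"
    proof -
      have "4 * x \<le> (x + 1)\<^sup>2" using sum_squares_ge_zero[of "x - 1" 0] by (simp add: power2_eq_square algebra_simps)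
      then have "4 / (x + 1)\<^sup>2 \<le> 1 / x" using x by (simp add: divide_simps mult.commute)
      then show ?thesis by simp
    qed
    ultimately show "\<exists>z. (F has_real_derivative z) (at x) \<and> 0 \<le> z" by blast
  qed
  then show ?thesis by (simp add: F_def)
qed

text \<open>Like the rational lower bound, this agrees with \<open>ln\<close> to second order at 1.
  At \<open>y = (N + 1) / N\<close> the two bounds place \<open>(N + 1 / 2) * ln y\<close> between 1
  and \<open>1 + 1 / (4 * N * (N + 1))\<close>.\<close>

lemma ln_le_trapezoid:
  fixes y :: real
  assumes "1 \<le> y"
  shows "ln y \<le> (y - 1 / y) / 2"
proof -
  define F where "F = (\<lambda>y::real. (y - 1 / y) / 2 - ln y)"
  have "F 1 \<le> F y"
  proof (rule DERIV_nonneg_imp_nondecreasing[OF assms])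
    fix x :: real assume x: "1 \<le> x" "x \<le> y"
    have "(F has_real_derivative ((1 + 1 / x\<^sup>2) / 2 - 1 / x)) (at x)"
      unfolding F_def using x by (auto intro!: derivative_eq_intros simp: power2_eq_square)
    moreover have "0 \<le> (1 + 1 / x\<^sup>2) / 2 - 1 / x"
      using zero_le_power2[of "1 - 1 / x"] by (simp add: power2_eq_square algebra_simps)
    ultimately show "\<exists>z. (F has_real_derivative z) (at x) \<and> 0 \<le> z" by blast
  qed
  then show ?thesis by (simp add: F_def)
qed

text \<open>From \<open>D 1 = 1\<close> on, \<open>D\<close> decreases, and by no more than
  \<open>1 / (2 * n)\<close> does. Carrying that term in the lower bound is what closes the
  induction.\<close>

lemma stirling_bounds:
  assumes "1 \<le> n"
  shows "(real n + 1 / 2) * ln (real n) - real n + 1 / 2 \<le> ln (fact n)"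
    and "ln (fact n) \<le> (real n + 1 / 2) * ln (real n) - real n + 1"
proof -
  define D where "D = (\<lambda>n. ln (fact n) - (real n + 1 / 2) * ln (real n) + real n)"
  have "1 / 2 + 1 / (2 * real n) \<le> D n \<and> D n \<le> 1"
    using assms
  proof (induction n rule: dec_induct)
    case base
    then show ?case by (simp add: D_def)
  next
    case (step n)
    define N where "N = real n"
    have N: "1 \<le> N" using step by (simp add: N_def)
    define l where "l = ln ((N + 1) / N)"
    have ll: "ln (N + 1) = l + ln N" using N by (simp add: l_def ln_div)
    have "ln (fact (Suc n) :: real) = ln (real (Suc n) * fact n)" by (simp only: fact_Suc of_nat_mult)
    also have "\<dots> = ln (N + 1) + ln (fact n)" by (subst ln_mult) (auto simp: N_def add.commute)
    finally have fs: "ln (fact (Suc n) :: real) = ln (N + 1) + ln (fact n)" .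
    have rs: "real (Suc n) = N + 1" by (simp add: N_def)
    have diff: "D (Suc n) = D n + 1 - (N + 1 / 2) * l"
      unfolding D_def fs rs N_def[symmetric] ll by (simp add: algebra_simps)
    have y1: "1 \<le> (N + 1) / N" using N by simp
    have "2 / (2 * N + 1) = 2 * ((N + 1) / N - 1) / ((N + 1) / N + 1)"
      using N by (simp add: divide_simps)
    also have "\<dots> \<le> l" unfolding l_def by (rule ln_ge_rational[OF y1])
    finally have lo: "1 \<le> (N + 1 / 2) * l" using N by (simp add: field_simps)
    have "l \<le> ((N + 1) / N - 1 / ((N + 1) / N)) / 2" unfolding l_def by (rule ln_le_trapezoid[OF y1])
    also have "\<dots> = (2 * N + 1) / (2 * (N * (N + 1)))" using N by (simp add: field_simps)
    finally have "(N + 1 / 2) * l \<le> (N + 1 / 2) * ((2 * N + 1) / (2 * (N * (N + 1))))"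
      using N by (intro mult_left_mono) auto
    also have "\<dots> = (4 * (N * (N + 1)) + 1) / (4 * (N * (N + 1)))" using N by (simp add: field_simps)
    also have "\<dots> = 1 + 1 / (4 * (N * (N + 1)))" using N by (simp only: add_divide_distrib) simp
    also have "\<dots> \<le> 1 + 1 / (2 * (N * (N + 1)))" using N by (intro add_left_mono divide_left_mono mult_right_mono mult_pos_pos) auto
    also have "\<dots> = 1 + (1 / (2 * N) - 1 / (2 * (N + 1)))" using N by (simp add: field_simps)
    finally have up: "(N + 1 / 2) * l \<le> 1 + (1 / (2 * N) - 1 / (2 * (N + 1)))" .
    show ?case using step.IH lo up unfolding diff rs N_def[symmetric] by linarith
  qed
  moreover have "0 \<le> 1 / (2 * real n)" by simp
  ultimately have "1 / 2 \<le> D n" "D n \<le> 1" by linarith+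
  then show "(real n + 1 / 2) * ln (real n) - real n + 1 / 2 \<le> ln (fact n)"
    and "ln (fact n) \<le> (real n + 1 / 2) * ln (real n) - real n + 1"
    by (simp_all add: D_def)
qed

lemma sum_ln_eq: "(\<Sum>m = 1..n. ln (real m)) = ln (fact n)"
proof (induction n)
  case (Suc n)
  have "ln (fact (Suc n) :: real) = ln (real (Suc n) * fact n)" by (simp only: fact_Suc of_nat_mult)
  also have "\<dots> = ln (real (Suc n)) + ln (fact n)" by (subst ln_mult) auto
  finally show ?case using Suc by simp
qed simp

text \<open>The source of every \<open>ln q / 2\<close>: the mean of \<open>ln\<close> over the unit
  interval is -1, and the sum over the lattice contains the end where \<open>ln\<close> vanishes but
  not the singular end.\<close>

lemma sum_ln_fractions:
  assumes "1 \<le> q"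
  shows "ln (real q) / 2 - real q \<le> (\<Sum>m = 1..q. ln (real m / real q))"
    and "(\<Sum>m = 1..q. ln (real m / real q)) \<le> ln (real q) / 2 - real q + 1"
proof -
  have "(\<Sum>m = 1..q. ln (real m / real q)) = (\<Sum>m = 1..q. ln (real m) - ln (real q))"
    using assms by (intro sum.cong) (auto simp: ln_div)
  also have "\<dots> = ln (fact q) - real q * ln (real q)"
    by (simp add: sum_subtractf sum_ln_eq[unfolded One_nat_def])
  finally have e: "(\<Sum>m = 1..q. ln (real m / real q)) = ln (fact q) - real q * ln (real q)" .
  show "ln (real q) / 2 - real q \<le> (\<Sum>m = 1..q. ln (real m / real q))"
    and "(\<Sum>m = 1..q. ln (real m / real q)) \<le> ln (real q) / 2 - real q + 1"
    unfolding e using stirling_bounds[OF assms] by (simp_all add: algebra_simps)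
qed

section \<open>Logarithms along a perturbed lattice\<close>

lemma continuous_on_x_ln: "continuous_on {0..b} (\<lambda>y::real. y * ln y)"
  unfolding continuous_on_eq_continuous_within
proof
  fix y :: real assume y: "y \<in> {0..b}"
  show "continuous (at y within {0..b}) (\<lambda>y. y * ln y)"
  proof (cases "y = 0")
    case False
    then show ?thesis using y by (intro continuous_intros) auto
  next
    case True
    have "((\<lambda>y. y * ln y) \<longlongrightarrow> 0) (at 0 within {0..b})"
    proof (rule tendsto_0_le[where f = sqrt and K = 2])
      show "(sqrt \<longlongrightarrow> 0) (at 0 within {0..b})"
        using tendsto_real_sqrt[OF tendsto_ident_at, of 0 "{0..b}"] by simp
      have "norm (z * ln z) \<le> norm (sqrt z) * 2" if z: "0 < z" "z < 1" for z
      proof -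
        have "ln (1 / sqrt z) \<le> 1 / sqrt z" using z by (intro ln_bound) auto
        then have "- ln z \<le> 2 / sqrt z" using z by (simp add: ln_div ln_sqrt)
        then have "z * (- ln z) \<le> z * (2 / sqrt z)" using z by (intro mult_left_mono) auto
        also have "\<dots> = 2 * (z / sqrt z)" by simp
        also have "z / sqrt z = sqrt z" using z by (simp add: real_div_sqrt)
        finally show ?thesis using z by (simp add: abs_mult abs_of_neg)
      qed
      then show "\<forall>\<^sub>F z in at 0 within {0..b}. norm (z * ln z) \<le> norm (sqrt z) * 2"
        unfolding eventually_at by (intro exI[of _ 1]) (auto simp: dist_real_def)
    qed
    then show ?thesis using True by (simp add: continuous_within)
  qed
qed

lemma ln_has_integral:
  fixes b :: real
  assumes "0 \<le> b"
  shows "(ln has_integral (b * ln b - b)) {0..b}"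
proof -
  have "(ln has_integral ((b * ln b - b) - (0 * ln 0 - 0))) {0..b}"
  proof (rule fundamental_theorem_of_calculus_interior[OF assms])
    show "continuous_on {0..b} (\<lambda>y. y * ln y - y)"
      by (intro continuous_on_diff continuous_on_x_ln continuous_on_id)
    fix x :: real assume x: "x \<in> {0<..<b}"
    show "((\<lambda>y. y * ln y - y) has_vector_derivative ln x) (at x)"
      unfolding has_real_derivative_iff_has_vector_derivative[symmetric]
      using x by (auto intro!: derivative_eq_intros)
  qed
  then show ?thesis by simp
qed

lemma ln_frac_has_integral: "((\<lambda>y::real. ln (frac y)) has_integral - 1) {0..1}"
proof (rule has_integral_spike_finite)
  show "((ln :: real \<Rightarrow> real) has_integral - 1) {0..1}" using ln_has_integral[of 1] by simp
  fix x :: real assume "x \<in> {0..1} - {1}"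
  then have "frac x = x" unfolding frac_eq by simp
  then show "ln (frac x) = ln x" by simp
qed simp

text \<open>The one-sided logarithm cut off at height \<open>ln g\<close>: its variation is of order
  \<open>- ln g\<close>, and nothing changes at points with \<open>frac y \<ge> g\<close>.\<close>

definition tlog :: "real \<Rightarrow> real \<Rightarrow> real" where
  "tlog g y = ln (max (frac y) g)"

lemma tlog_has_integral:
  assumes g: "0 < g" "g < 1"
  shows "(tlog g has_integral (g - 1)) {0..1}"
proof -
  have 1: "(tlog g has_integral (g * ln g)) {0..g}"
  proof -
    have "((\<lambda>_. ln g) has_integral (g * ln g)) {0..g}"
      using has_integral_const_real[of "ln g" 0 g] g by simp
    then show ?thesis
    proof (rule has_integral_eq[rotated])
      fix x assume x: "x \<in> {0..g}"
      then have "frac x = x" unfolding frac_eq using g by simp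
      then show "ln g = tlog g x" using x by (simp add: tlog_def max_def)
    qed
  qed
  have "(ln has_integral ((1 * ln 1 - 1) - (g * ln g - g))) {g..1}"
  proof (rule fundamental_theorem_of_calculus_interior)
    show "continuous_on {g..1} (\<lambda>y. y * ln y - y)"
      using g by (intro continuous_intros) auto
    fix x :: real assume x: "x \<in> {g<..<1}"
    show "((\<lambda>y. y * ln y - y) has_vector_derivative ln x) (at x)"
      unfolding has_real_derivative_iff_has_vector_derivative[symmetric]
      using x g by (auto intro!: derivative_eq_intros)
  qed (use g in auto)
  then have 2: "(tlog g has_integral ((1 * ln 1 - 1) - (g * ln g - g))) {g..1}"
  proof (rule has_integral_spike_finite[rotated -1])
    fix x assume x: "x \<in> {g..1} - {1}"
    then have "frac x = x" unfolding frac_eq using g by simp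
    then show "tlog g x = ln x" using x by (simp add: tlog_def max_absorb1)
  qed simp
  show ?thesis using has_integral_combine[OF _ _ 1 2] g by simp
qed

lemma bv_by_tlog:
  assumes g: "0 < g" "g < 1"
  shows "bv_by (tlog g) (2 * (- ln g))"
proof (rule bv_byI[where v = "\<lambda>y. tlog g y - ln g"])
  show "one_periodic (tlog g)" by (simp add: one_periodic_def tlog_def frac_1_eq)
  show "tlog g integrable_on {0..1}" using tlog_has_integral[OF g] by (rule has_integral_integrable)
  show "\<bar>tlog g z - tlog g y\<bar> \<le> tlog g z - ln g - (tlog g y - ln g)" if "0 \<le> y" "y \<le> z" "z < 1" for y z
  proof -
    have "ln (max y g) \<le> ln (max z g)" using that g by (intro ln_mono) auto
    moreover have "frac y = y" "frac z = z" unfolding frac_eq using that by auto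
    ultimately show ?thesis by (simp add: tlog_def)
  qed
  show "0 \<le> tlog g y - ln g \<and> tlog g y - ln g \<le> - ln g" if "0 \<le> y" "y < 1" for y
  proof -
    have "ln g \<le> ln (max y g)" "ln (max y g) \<le> ln 1" using that g by (auto intro!: ln_mono)
    moreover have "frac y = y" unfolding frac_eq using that by auto
    ultimately show ?thesis by (simp add: tlog_def)
  qed
qed

lemma frac_shifted_fraction:
  fixes q :: nat
  assumes "0 < q" "0 \<le> t" "t < 1 / real q"
  shows "frac (real_of_int k / real q + t) = real (nat (k mod int q)) / real q + t"
proof -
  have r: "nat (k mod int q) < q" using assms(1) by (simp add: nat_less_iff)
  have "k = int (nat (k mod int q)) + (k div int q) * int q" using assms(1) by simp
  then have "real_of_int k = real (nat (k mod int q)) + real_of_int (k div int q) * real q"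
    by (metis of_int_add of_int_mult of_int_of_nat_eq)
  then have e: "real_of_int k / real q = real (nat (k mod int q)) / real q + real_of_int (k div int q)"
    using assms(1) by (simp add: add_divide_distrib)
  have "real (nat (k mod int q)) + 1 \<le> real q" using r by linarith
  then have "real (nat (k mod int q)) / real q + 1 / real q \<le> 1"
    using assms(1) by (simp add: add_divide_distrib[symmetric])
  then show ?thesis unfolding frac_unique_iff e using assms by auto
qed

lemma ln_le_ln_add: "0 < (x::real) \<Longrightarrow> 0 \<le> t \<Longrightarrow> ln (x + t) \<le> ln x + t / x"
  using ln_diff_le[of "x + t" x] by simp

text \<open>The points are \<open>r / q + n * \<theta>\<close> with every residue \<open>r\<close>
  occurring once and a small positive push. For \<open>ln (frac x)\<close> the residue 0 contributes
  at most \<open>- ln q\<close> where the full lattice sum has the term \<open>ln 1\<close>, which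
  turns \<open>+ ln q / 2\<close> into \<open>- ln q / 2\<close>. For \<open>ln (1 - frac x)\<close>
  the distances are \<open>(q - r) / q\<close> with \<open>q - r\<close> from 1 to \<open>q\<close>,
  so the sign stays. The push costs a harmonic sum with factor \<epsilon>. The point of residue 0
  may be extremely close to the singularity; its logarithm is kept as
  \<open>ln (c * \<theta>)\<close>.\<close>

lemma block_sums:
  fixes p s :: int and q c :: nat and \<theta> \<epsilon> :: real
  assumes q: "1 \<le> q" and cop: "coprime p (int q)" and c: "1 \<le> c" and \<theta>: "0 < \<theta>"
    and \<epsilon>: "0 < \<epsilon>" "\<epsilon> \<le> 1 / 2" and small: "real (c + q) * \<theta> \<le> \<epsilon> / real q"
  defines "x \<equiv> \<lambda>n. real_of_int s / real q + real n * (real_of_int p / real q + \<theta>)"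
  defines "SX \<equiv> \<Sum>n\<in>{c<..c + q}. ln (frac (x n))"
    and "SY \<equiv> \<Sum>n\<in>{c<..c + q}. ln (1 - frac (x n))"
  shows "SX + real q \<le> - ln (real q) / 2 + 2 + \<epsilon> * (1 + ln (real q))"
    and "ln (real q) / 2 + ln (real c * \<theta>) \<le> SX + real q"
    and "SY + real q \<le> ln (real q) / 2 + 1"
    and "ln (real q) / 2 - 2 * \<epsilon> * (1 + ln (real q)) \<le> SY + real q"
proof -
  define \<rho> where "\<rho> = (\<lambda>n::nat. nat ((s + int n * p) mod int q))"
  have bij: "bij_betw \<rho> {c<..c + q} {..<q}"
    unfolding \<rho>_def using bij_betw_residues[OF cop] q by auto
  have re: "(\<Sum>n\<in>{c<..c + q}. G (\<rho> n)) = (\<Sum>r<q. G r)" for G :: "nat \<Rightarrow> real"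
    using sum.reindex_bij_betw[OF bij] .
  have t: "0 < real n * \<theta>" "real n * \<theta> \<le> \<epsilon> / real q" "real c * \<theta> \<le> real n * \<theta>" "real n * \<theta> < 1 / real q"
    if "n \<in> {c<..c + q}" for n
  proof -
    show "0 < real n * \<theta>" "real c * \<theta> \<le> real n * \<theta>" using that \<theta> by auto
    have "real n * \<theta> \<le> real (c + q) * \<theta>" using that \<theta> by (intro mult_right_mono) auto
    then show 1: "real n * \<theta> \<le> \<epsilon> / real q" using small by linarith
    have "\<epsilon> / real q < 1 / real q" using \<epsilon> q by (intro divide_strict_right_mono) auto
    then show "real n * \<theta> < 1 / real q" using 1 by linarith
  qed
  have fr: "frac (x n) = real (\<rho> n) / real q + real n * \<theta>" if "n \<in> {c<..c + q}" for n
  proof -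
    have "x n = real_of_int (s + int n * p) / real q + real n * \<theta>"
      by (simp add: x_def add_divide_distrib algebra_simps)
    then show ?thesis using frac_shifted_fraction[of q "real n * \<theta>" "s + int n * p"] t[OF that] q
      by (simp add: \<rho>_def)
  qed
  have \<rho>q: "\<rho> n < q" if "n \<in> {c<..c + q}" for n using bij that by (auto simp: bij_betw_def)
  have ins: "{..<q} = insert 0 {1..<q}" using q by auto
  have split0: "(\<Sum>r<q. if r = 0 then a else G r) = a + (\<Sum>r\<in>{1..<q}. G r)" for a and G :: "nat \<Rightarrow> real"
    unfolding ins by (subst sum.insert) auto
  have last: "{1..q} = insert q {1..<q}" using q by auto
  have lnsum: "(\<Sum>r\<in>{1..<q}. ln (real r / real q)) = (\<Sum>r = 1..q. ln (real r / real q))"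
    unfolding last by (subst sum.insert) (use q in auto)
  have harm: "(\<Sum>r = 1..q. \<delta> / real r) \<le> \<delta> * (1 + ln (real q))" if "0 \<le> \<delta>" for \<delta>
    using mult_left_mono[OF sum_inverse_le_ln[OF q] that] by (simp add: sum_distrib_left)
  have refl: "(\<Sum>r<q. G (q - r)) = (\<Sum>m = 1..q. G m)" for G :: "nat \<Rightarrow> real"
    by (rule sum.reindex_bij_witness[of _ "\<lambda>m. q - m" "\<lambda>r. q - r"]) auto
  have "SX \<le> (\<Sum>n\<in>{c<..c + q}. (\<lambda>r. if r = 0 then - ln (real q) else ln (real r / real q) + \<epsilon> / real r) (\<rho> n))"
    unfolding SX_def
  proof (rule sum_mono)
    fix n assume n: "n \<in> {c<..c + q}"
    note tn = t[OF n]
    show "ln (frac (x n)) \<le> (\<lambda>r. if r = 0 then - ln (real q) else ln (real r / real q) + \<epsilon> / real r) (\<rho> n)"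
    proof (cases "\<rho> n = 0")
      case True
      have "ln (real n * \<theta>) \<le> ln (1 / real q)" using tn by (intro ln_mono) auto
      then show ?thesis using True fr[OF n] q by (simp add: ln_div)
    next
      case False
      define r where "r = real (\<rho> n)"
      have r: "1 \<le> r" using False by (simp add: r_def)
      have "ln (r / real q + real n * \<theta>) \<le> ln (r / real q) + (real n * \<theta>) / (r / real q)"
        using r q tn by (intro ln_le_ln_add) auto
      also have "(real n * \<theta>) / (r / real q) \<le> (\<epsilon> / real q) / (r / real q)"
        using r q tn by (intro divide_right_mono) auto
      also have "(\<epsilon> / real q) / (r / real q) = \<epsilon> / r" using q by simp
      finally show ?thesis using False fr[OF n] by (simp add: r_def)
    qed
  qed
  also have "\<dots> = - ln (real q) + (\<Sum>r\<in>{1..<q}. ln (real r / real q) + \<epsilon> / real r)"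
    by (rule trans[OF re[of "\<lambda>r. if r = 0 then - ln (real q) else ln (real r / real q) + \<epsilon> / real r"] split0])
  also have "\<dots> = - ln (real q) + (\<Sum>r = 1..q. ln (real r / real q)) + (\<Sum>r\<in>{1..<q}. \<epsilon> / real r)"
    by (simp only: sum.distrib lnsum add.assoc)
  also have "(\<Sum>r\<in>{1..<q}. \<epsilon> / real r) \<le> (\<Sum>r = 1..q. \<epsilon> / real r)"
    using \<epsilon> by (intro sum_mono2) auto
  also have "\<dots> \<le> \<epsilon> * (1 + ln (real q))" using harm[of \<epsilon>] \<epsilon> by simp
  finally show "SX + real q \<le> - ln (real q) / 2 + 2 + \<epsilon> * (1 + ln (real q))"
    using sum_ln_fractions(2)[OF q] by simp
  have "(\<Sum>n\<in>{c<..c + q}. (\<lambda>r. if r = 0 then ln (real c * \<theta>) else ln (real r / real q)) (\<rho> n)) \<le> SX"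
    unfolding SX_def
  proof (rule sum_mono)
    fix n assume n: "n \<in> {c<..c + q}"
    note tn = t[OF n]
    show "(\<lambda>r. if r = 0 then ln (real c * \<theta>) else ln (real r / real q)) (\<rho> n) \<le> ln (frac (x n))"
    proof (cases "\<rho> n = 0")
      case True
      have "ln (real c * \<theta>) \<le> ln (real n * \<theta>)" using tn \<theta> c by (intro ln_mono) auto
      then show ?thesis using True fr[OF n] by simp
    next
      case False
      have "ln (real (\<rho> n) / real q) \<le> ln (real (\<rho> n) / real q + real n * \<theta>)"
        using False q tn by (intro ln_mono) auto
      then show ?thesis using False fr[OF n] by simp
    qed
  qed
  also have "(\<Sum>n\<in>{c<..c + q}. (\<lambda>r. if r = 0 then ln (real c * \<theta>) else ln (real r / real q)) (\<rho> n))
      = ln (real c * \<theta>) + (\<Sum>r = 1..q. ln (real r / real q))"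
    using trans[OF re[of "\<lambda>r. if r = 0 then ln (real c * \<theta>) else ln (real r / real q)"] split0] lnsum by simp
  finally show "ln (real q) / 2 + ln (real c * \<theta>) \<le> SX + real q"
    using sum_ln_fractions(1)[OF q] by simp
  have one_minus: "1 - frac (x n) = real (q - \<rho> n) / real q - real n * \<theta>" if n: "n \<in> {c<..c + q}" for n
  proof -
    have "real (q - \<rho> n) = real q - real (\<rho> n)" using \<rho>q[OF n] by simp
    then show ?thesis using fr[OF n] q by (simp add: diff_divide_distrib)
  qed
  have mge: "1 / real q \<le> real (q - \<rho> n) / real q" if n: "n \<in> {c<..c + q}" for n
    using \<rho>q[OF n] by (intro divide_right_mono) auto
  have "SY \<le> (\<Sum>n\<in>{c<..c + q}. (\<lambda>r. ln (real (q - r) / real q)) (\<rho> n))"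
    unfolding SY_def
  proof (rule sum_mono)
    fix n assume n: "n \<in> {c<..c + q}"
    show "ln (1 - frac (x n)) \<le> (\<lambda>r. ln (real (q - r) / real q)) (\<rho> n)"
    proof -
      have "0 < real (q - \<rho> n) / real q - real n * \<theta>" using t(4)[OF n] mge[OF n] by linarith
      then have "ln (real (q - \<rho> n) / real q - real n * \<theta>) \<le> ln (real (q - \<rho> n) / real q)"
        using t(1)[OF n] by (intro ln_mono) linarith+
      then show ?thesis by (simp only: one_minus[OF n])
    qed
  qed
  also have "\<dots> = (\<Sum>m = 1..q. ln (real m / real q))"
    by (rule trans[OF re[of "\<lambda>r. ln (real (q - r) / real q)"] refl[of "\<lambda>m. ln (real m / real q)"]])
  finally show "SY + real q \<le> ln (real q) / 2 + 1" using sum_ln_fractions(2)[OF q] by simp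
  have "(\<Sum>n\<in>{c<..c + q}. (\<lambda>r. ln (real (q - r) / real q) - 2 * \<epsilon> / real (q - r)) (\<rho> n)) \<le> SY"
    unfolding SY_def
  proof (rule sum_mono)
    fix n assume n: "n \<in> {c<..c + q}"
    note tn = t[OF n]
    define m where "m = real (q - \<rho> n)"
    have m: "1 \<le> m" using \<rho>q[OF n] by (simp add: m_def)
    define z where "z = m / real q - real n * \<theta>"
    \<comment> \<open>Since \<open>\<epsilon> \<le> 1 / 2\<close>, the push removes at most half of
      the distance \<open>m / q\<close>; this doubling gives the factor 2 in front of
      \<epsilon>.\<close>
    have z: "m / (2 * real q) \<le> z"
    proof -
      have "\<epsilon> / real q \<le> (m / 2) / real q" using m \<epsilon> by (intro divide_right_mono) auto
      then have "real n * \<theta> \<le> m / (2 * real q)" using tn by simp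
      moreover have "m / real q = 2 * (m / (2 * real q))" using q by simp
      ultimately show ?thesis unfolding z_def by linarith
    qed
    have zp: "0 < m / (2 * real q)" using m q by simp
    then have z0: "0 < z" using z by linarith
    have "ln (m / real q) - ln z \<le> (m / real q - z) / z" using z0 m q by (intro ln_diff_le) auto
    also have "\<dots> = (real n * \<theta>) / z" by (simp add: z_def)
    also have "\<dots> \<le> (\<epsilon> / real q) / (m / (2 * real q))" using tn z zp \<epsilon> q by (intro frac_le) auto
    also have "\<dots> = 2 * \<epsilon> / m" using q by simp
    finally show "(\<lambda>r. ln (real (q - r) / real q) - 2 * \<epsilon> / real (q - r)) (\<rho> n) \<le> ln (1 - frac (x n))"
      unfolding one_minus[OF n] by (simp add: z_def m_def)
  qed
  also have "(\<Sum>n\<in>{c<..c + q}. (\<lambda>r. ln (real (q - r) / real q) - 2 * \<epsilon> / real (q - r)) (\<rho> n))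
     = (\<Sum>m = 1..q. ln (real m / real q) - 2 * \<epsilon> / real m)"
    by (rule trans[OF re[of "\<lambda>r. ln (real (q - r) / real q) - 2 * \<epsilon> / real (q - r)"] refl[of "\<lambda>m. ln (real m / real q) - 2 * \<epsilon> / real m"]])
  also have "\<dots> = (\<Sum>m = 1..q. ln (real m / real q)) - (\<Sum>m = 1..q. 2 * \<epsilon> / real m)"
    by (rule sum_subtractf)
  finally show "ln (real q) / 2 - 2 * \<epsilon> * (1 + ln (real q)) \<le> SY + real q"
    using sum_ln_fractions(1)[OF q] harm[of "2 * \<epsilon>"] \<epsilon> by simp
qed

section \<open>Birkhoff sums of logarithmic singularities\<close>

text \<open>A Denjoy--Koksma bound for incomplete blocks, with \<open>S\<close> standing for the
  digit sum. It is stated without continued fractions so that it can be transferred to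
  \<open>- \<alpha>\<close>.\<close>

definition orbit_bound :: "real \<Rightarrow> nat \<Rightarrow> real \<Rightarrow> bool" where
  "orbit_bound \<alpha> q S \<longleftrightarrow> (\<forall>v V y n. bv_by v V \<longrightarrow> n \<le> q \<longrightarrow>
     \<bar>(\<Sum>i = 1..n. v (y + real i * \<alpha>)) - real n * integral {0..1} v\<bar> \<le> V * S)"

lemma orbit_boundD:
  "orbit_bound \<alpha> q S \<Longrightarrow> bv_by v V \<Longrightarrow> n \<le> q \<Longrightarrow>
     \<bar>(\<Sum>i = 1..n. v (y + real i * \<alpha>)) - real n * integral {0..1} v\<bar> \<le> V * S"
  unfolding orbit_bound_def by blast

lemma orbit_bound_minus:
  assumes "orbit_bound \<alpha> q S"
  shows "orbit_bound (- \<alpha>) q S"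
  unfolding orbit_bound_def
proof (intro allI impI)
  fix v V y n assume v: "bv_by v V" and n: "n \<le> q"
  have "\<bar>(\<Sum>i = 1..n. v (- (- y + real i * \<alpha>))) - real n * integral {0..1} (\<lambda>y. v (- y))\<bar> \<le> V * S"
    using orbit_boundD[OF assms bv_by_reflect(1)[OF v] n, of "- y"] .
  then show "\<bar>(\<Sum>i = 1..n. v (y + real i * - \<alpha>)) - real n * integral {0..1} v\<bar> \<le> V * S"
    using bv_by_reflect(2)[OF v] by simp
qed

text \<open>The singularity is moved to 0, with \<open>A\<close> the coefficient on its right and
  \<open>B\<close> on its left. The prescribed integral of \<open>u\<close> encodes mean zero, since
  each one-sided logarithm has mean -1.\<close>

definition log_form :: "(real \<Rightarrow> real) \<Rightarrow> real \<Rightarrow> real \<Rightarrow> (real \<Rightarrow> real) \<Rightarrow> real \<Rightarrow> bool" where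
  "log_form h A B u W \<longleftrightarrow> bv_by u W \<and> integral {0..1} u = A + B \<and>
     (\<forall>y. y \<notin> \<int> \<longrightarrow> h y = A * ln (frac y) + B * ln (1 - frac y) + u y)"

lemma log_form_reflect:
  assumes "log_form h A B u W"
  shows "log_form (\<lambda>y. h (- y)) B A (\<lambda>y. u (- y)) W"
  using assms unfolding log_form_def
  by (auto simp: bv_by_reflect frac_neg)

lemma sum_shift_orbit:
  fixes c m :: nat
  shows "(\<Sum>n\<in>{c<..c + m}. F (z + real n * \<alpha>)) = (\<Sum>i = 1..m. F ((z + real c * \<alpha>) + real i * \<alpha>))"
  by (rule sum.reindex_bij_witness[of _ "\<lambda>i. i + c" "\<lambda>n. n - c"]) (auto simp: algebra_simps of_nat_diff)

text \<open>No point comes closer to the singularity than \<theta>, so both logarithms may be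
  replaced by \<open>tlog \<theta>\<close>, to which the bound for bounded variation applies. The
  means almost cancel: what is left is \<open>(A + B) * m * \<theta>\<close>, at most
  \<open>\<bar>A + B\<bar>\<close> in absolute value.\<close>

lemma short_orbit_sum:
  fixes c m q :: nat
  assumes lf: "log_form h A B u W" and ob: "orbit_bound \<alpha> q S" and m: "m \<le> q"
    and \<theta>: "0 < \<theta>" "\<theta> < 1" "real m * \<theta> \<le> 1"
    and sep: "\<And>n. n \<in> {c<..c + m} \<Longrightarrow> \<theta> \<le> frac (\<beta> + real n * \<alpha>) \<and> \<theta> \<le> 1 - frac (\<beta> + real n * \<alpha>)"
  shows "\<bar>\<Sum>n\<in>{c<..c + m}. h (\<beta> + real n * \<alpha>)\<bar> \<le> S * ((\<bar>A\<bar> + \<bar>B\<bar>) * (2 * (- ln \<theta>)) + W) + \<bar>A + B\<bar>"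
proof -
  define y where "y = \<beta> + real c * \<alpha>"
  have u: "bv_by u W" "integral {0..1} u = A + B" using lf by (auto simp: log_form_def)
  define T1 where "T1 = (\<Sum>i = 1..m. tlog \<theta> (y + real i * \<alpha>))"
  define T2 where "T2 = (\<Sum>i = 1..m. (\<lambda>z. tlog \<theta> (- z)) (y + real i * \<alpha>))"
  define T3 where "T3 = (\<Sum>i = 1..m. u (y + real i * \<alpha>))"
  have iT: "integral {0..1} (tlog \<theta>) = \<theta> - 1" using tlog_has_integral[OF \<theta>(1,2)] by (rule integral_unique)
  have b1: "\<bar>T1 - real m * (\<theta> - 1)\<bar> \<le> 2 * (- ln \<theta>) * S"
    using orbit_boundD[OF ob bv_by_tlog[OF \<theta>(1,2)] m, of y] by (simp add: T1_def iT)
  have b2: "\<bar>T2 - real m * (\<theta> - 1)\<bar> \<le> 2 * (- ln \<theta>) * S"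
    using orbit_boundD[OF ob bv_by_reflect(1)[OF bv_by_tlog[OF \<theta>(1,2)]] m, of y]
      bv_by_reflect(2)[OF bv_by_tlog[OF \<theta>(1,2)]] by (simp add: T2_def iT)
  have b3: "\<bar>T3 - real m * (A + B)\<bar> \<le> W * S"
    using orbit_boundD[OF ob u(1) m, of y] by (simp add: T3_def u(2))
  have "(\<Sum>n\<in>{c<..c + m}. h (\<beta> + real n * \<alpha>)) = (\<Sum>n\<in>{c<..c + m}.
      A * tlog \<theta> (\<beta> + real n * \<alpha>) + B * tlog \<theta> (- (\<beta> + real n * \<alpha>)) + u (\<beta> + real n * \<alpha>))"
  proof (rule sum.cong[OF refl])
    fix n assume n: "n \<in> {c<..c + m}"
    define z where "z = \<beta> + real n * \<alpha>"
    have z: "\<theta> \<le> frac z" "\<theta> \<le> 1 - frac z" using sep[OF n] by (auto simp: z_def)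
    then have "frac z > 0" using \<theta> by linarith
    then have zi: "z \<notin> \<int>" by simp
    have "frac (- z) = 1 - frac z" using zi by (simp add: frac_neg)
    then have "tlog \<theta> z = ln (frac z)" "tlog \<theta> (- z) = ln (1 - frac z)"
      using z by (auto simp: tlog_def max_absorb1)
    then show "h (\<beta> + real n * \<alpha>) = A * tlog \<theta> (\<beta> + real n * \<alpha>) + B * tlog \<theta> (- (\<beta> + real n * \<alpha>)) + u (\<beta> + real n * \<alpha>)"
      using lf zi by (simp add: log_form_def z_def)
  qed
  also have "\<dots> = (\<Sum>i = 1..m. A * tlog \<theta> (y + real i * \<alpha>) + B * tlog \<theta> (- (y + real i * \<alpha>)) + u (y + real i * \<alpha>))"
    unfolding y_def by (rule sum_shift_orbit[of "\<lambda>z. A * tlog \<theta> z + B * tlog \<theta> (- z) + u z"])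
  also have "\<dots> = A * T1 + B * T2 + T3"
    by (simp add: T1_def T2_def T3_def sum.distrib sum_distrib_left)
  also have "\<dots> = A * (T1 - real m * (\<theta> - 1)) + B * (T2 - real m * (\<theta> - 1)) + (T3 - real m * (A + B)) + (A + B) * (real m * \<theta>)"
    by (simp add: algebra_simps)
  finally have e: "(\<Sum>n\<in>{c<..c + m}. h (\<beta> + real n * \<alpha>)) = \<dots>" .
  have tri: "\<bar>t1 + t2 + t3 + t4\<bar> \<le> b1 + b2 + b3 + b4"
    if "\<bar>t1\<bar> \<le> b1" "\<bar>t2\<bar> \<le> b2" "\<bar>t3\<bar> \<le> b3" "\<bar>t4\<bar> \<le> b4"
    for t1 t2 t3 t4 b1 b2 b3 b4 :: real
    using that by linarith
  have "\<bar>A * (T1 - real m * (\<theta> - 1))\<bar> \<le> \<bar>A\<bar> * (2 * (- ln \<theta>) * S)"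
    unfolding abs_mult by (intro mult_left_mono b1) auto
  moreover have "\<bar>B * (T2 - real m * (\<theta> - 1))\<bar> \<le> \<bar>B\<bar> * (2 * (- ln \<theta>) * S)"
    unfolding abs_mult by (intro mult_left_mono b2) auto
  moreover have "\<bar>(A + B) * (real m * \<theta>)\<bar> \<le> \<bar>A + B\<bar> * 1"
    unfolding abs_mult using \<theta> by (intro mult_left_mono) auto
  ultimately have "\<bar>\<Sum>n\<in>{c<..c + m}. h (\<beta> + real n * \<alpha>)\<bar>
      \<le> \<bar>A\<bar> * (2 * (- ln \<theta>) * S) + \<bar>B\<bar> * (2 * (- ln \<theta>) * S) + W * S + \<bar>A + B\<bar>"
    unfolding e using b3 tri by (simp only: mult_1_right)
  also have "\<dots> = S * ((\<bar>A\<bar> + \<bar>B\<bar>) * (2 * (- ln \<theta>)) + W) + \<bar>A + B\<bar>"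
    by (simp add: algebra_simps)
  finally show ?thesis .
qed

text \<open>The first \<open>q\<close> points are kept apart because \<open>block_sums\<close> needs
  a start \<open>c \<ge> 1\<close>; otherwise its term \<open>ln (c * \<theta>)\<close> carries no
  information.\<close>

lemma sum_blocks:
  fixes F :: "nat \<Rightarrow> real"
  shows "(\<Sum>n = 1..(J + 1) * q + \<rho>. F n) = (\<Sum>n\<in>{0<..0 + q}. F n)
    + (\<Sum>j = 1..J. \<Sum>n\<in>{j * q<..j * q + q}. F n) + (\<Sum>n\<in>{(J + 1) * q<..(J + 1) * q + \<rho>}. F n)"
proof -
  have sp: "(\<Sum>n\<in>{0<..a + b}. F n) = (\<Sum>n\<in>{0<..a}. F n) + (\<Sum>n\<in>{a<..a + b}. F n)" for a b :: nat
  proof -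
    have "{0<..a + b} = {0<..a} \<union> {a<..a + b}" by auto
    then show ?thesis by (simp add: sum.union_disjoint)
  qed
  have "(\<Sum>n\<in>{0<..(J + 1) * q}. F n) = (\<Sum>n\<in>{0<..0 + q}. F n) + (\<Sum>j = 1..J. \<Sum>n\<in>{j * q<..j * q + q}. F n)"
  proof (induction J)
    case (Suc J)
    have "(Suc J + 1) * q = (J + 1) * q + q" by simp
    then have "(\<Sum>n\<in>{0<..(Suc J + 1) * q}. F n) = (\<Sum>n\<in>{0<..(J + 1) * q}. F n) + (\<Sum>n\<in>{(J + 1) * q<..(J + 1) * q + q}. F n)"
      using sp by metis
    then show ?case using Suc by simp
  qed simp
  moreover have "{1..(J + 1) * q + \<rho>} = {0<..(J + 1) * q + \<rho>}" by auto
  ultimately show ?thesis using sp[of "(J + 1) * q" \<rho>] by simp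
qed

text \<open>The push is between \<theta> and half a lattice step: the first bounds the distance on
  one side of the singularity, the remaining half step bounds it on the other.\<close>

lemma orbit_separation:
  fixes p s :: int and q n N :: nat
  assumes q: "1 \<le> q" and \<theta>: "0 < \<theta>" and n: "1 \<le> n" "n \<le> N" and small: "real N * \<theta> \<le> (1 / 2) / real q"
  defines "x \<equiv> real_of_int s / real q + real n * (real_of_int p / real q + \<theta>)"
  shows "\<theta> \<le> frac x \<and> \<theta> \<le> 1 - frac x"
proof -
  have "real n * \<theta> \<le> real N * \<theta>" using n \<theta> by (intro mult_right_mono) auto
  then have nt1: "real n * \<theta> \<le> (1 / 2) / real q" using small by linarith
  have "1 * \<theta> \<le> real n * \<theta>" using n \<theta> by (intro mult_right_mono) auto
  then have nt2: "\<theta> \<le> real n * \<theta>" by simp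
  define r where "r = nat ((s + int n * p) mod int q)"
  have "r < q" using q by (simp add: r_def nat_less_iff)
  then have rq: "real r + 1 \<le> real q" by linarith
  have hq: "0 < (1 / 2) / real q" "(1 / 2) / real q + (1 / 2) / real q = 1 / real q" using q by auto
  have "x = real_of_int (s + int n * p) / real q + real n * \<theta>"
    by (simp add: x_def add_divide_distrib algebra_simps)
  moreover have "real n * \<theta> < 1 / real q" using nt1 hq by linarith
  moreover have "0 \<le> real n * \<theta>" using \<theta> by simp
  ultimately have f: "frac x = real r / real q + real n * \<theta>"
    using frac_shifted_fraction[of q "real n * \<theta>" "s + int n * p"] q by (simp add: r_def)
  have "real r / real q + 1 / real q \<le> 1"
    using rq q by (simp add: add_divide_distrib[symmetric])
  then have "\<theta> \<le> 1 - frac x" using f nt1 nt2 hq by linarith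
  moreover have "\<theta> \<le> frac x" using nt2 unfolding f by (intro add_increasing) auto
  ultimately show ?thesis by simp
qed

lemma bv_by_nonneg:
  assumes "bv_by u W"
  shows "0 \<le> W"
proof -
  obtain w where w: "\<And>y z. y \<le> z \<Longrightarrow> \<bar>u z - u y\<bar> \<le> w z - w y" "\<And>y. w (y + 1) = w y + W"
    using assms by (auto simp: bv_by_def)
  show ?thesis using w(1)[of 0 "0 + 1"] w(2)[of 0] by linarith
qed

text \<open>Each of the \<open>J\<close> middle blocks contributes \<open>(B - A) / 2 * ln q\<close>
  up to a smaller error; only the first and the incomplete last block pay the factor
  \<open>S\<close>. Since \<open>S\<close> is not multiplied by \<open>J\<close>, a dominating digit
  makes these two negligible.\<close>

lemma orbit_sum:
  fixes p s :: int and q J \<rho> :: nat and \<theta> \<epsilon> a \<kappa> :: real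
  assumes lf: "log_form h A B u W" and ob: "orbit_bound \<alpha> q S"
    and q: "1 \<le> q" and cop: "coprime p (int q)" and \<theta>: "0 < \<theta>"
    and \<alpha>: "\<alpha> = real_of_int p / real q + \<theta>" and \<beta>: "\<beta> = real_of_int s / real q"
    and \<epsilon>: "0 < \<epsilon>" "\<epsilon> \<le> 1 / 2"
    and N: "N = (J + 1) * q + \<rho>" and \<rho>: "\<rho> < q" and small: "real N * \<theta> \<le> \<epsilon> / real q"
    and a: "0 < a" "1 / (4 * a * (real q)\<^sup>2) \<le> \<theta>" and J: "1 \<le> J" "\<kappa> * a \<le> real J" and \<kappa>: "0 < \<kappa>"
    and S: "0 \<le> S"
  shows "\<bar>(\<Sum>n = 1..N. h (\<beta> + real n * \<alpha>)) - real J * ((B - A) / 2 * ln (real q))\<bar>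
    \<le> real J * ((\<bar>A\<bar> + \<bar>B\<bar>) * (3 + 2 * \<epsilon> * (1 + ln (real q)) + ln (4 / \<kappa>)) + W)
      + 2 * (S * ((\<bar>A\<bar> + \<bar>B\<bar>) * (2 * ln (4 * a * (real q)\<^sup>2)) + W) + \<bar>A + B\<bar>)"
proof -
  define x where "x = (\<lambda>n::nat. real_of_int s / real q + real n * (real_of_int p / real q + \<theta>))"
  have xe: "\<beta> + real n * \<alpha> = x n" for n by (simp add: x_def \<alpha> \<beta>)
  define D where "D = \<bar>A\<bar> + \<bar>B\<bar>"
  have D: "0 \<le> D" by (simp add: D_def)
  have lnq: "0 \<le> ln (real q)" using q by simp
  have qN: "q \<le> N" unfolding N by simp
  have u: "bv_by u W" "integral {0..1} u = A + B" using lf by (auto simp: log_form_def)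
  have W: "0 \<le> W" using bv_by_nonneg[OF u(1)] .
  have \<theta>q: "\<theta> \<le> \<epsilon> / real q"
  proof -
    have "1 * \<theta> \<le> real N * \<theta>" using qN q \<theta> by (intro mult_right_mono) auto
    then show ?thesis using small by simp
  qed
  have \<epsilon>q: "\<epsilon> / real q \<le> (1 / 2) / real q" using \<epsilon> by (intro divide_right_mono) auto
  have q1: "1 / real q \<le> 1" using q by simp
  have hq2: "(1 / 2) / real q \<le> 1 / real q" by (intro divide_right_mono) auto
  have \<theta>1: "\<theta> < 1"
  proof -
    have "(1 / 2) / real q \<le> 1 / 2" using q by simp
    then show ?thesis using \<theta>q \<epsilon>q by linarith
  qed
  have sep: "\<theta> \<le> frac (x n) \<and> \<theta> \<le> 1 - frac (x n)" if n: "n \<in> {0<..N}" for n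
    unfolding x_def using n small \<epsilon>q by (intro orbit_separation[OF q \<theta>, of _ N]) auto
  have qth: "real m * \<theta> \<le> 1" if "m \<le> q" for m
  proof -
    have "real m * \<theta> \<le> real N * \<theta>" using that qN \<theta> by (intro mult_right_mono) auto
    then show ?thesis using small \<epsilon>q q1 by simp
  qed
  define R where "R = S * (D * (2 * (- ln \<theta>)) + W) + \<bar>A + B\<bar>"
  have first: "\<bar>\<Sum>n\<in>{0<..0 + q}. h (\<beta> + real n * \<alpha>)\<bar> \<le> R"
    unfolding R_def D_def using sep qN qth
    by (intro short_orbit_sum[OF lf ob _ \<theta> \<theta>1]) (auto simp: xe)
  have last: "\<bar>\<Sum>n\<in>{(J + 1) * q<..(J + 1) * q + \<rho>}. h (\<beta> + real n * \<alpha>)\<bar> \<le> R"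
    unfolding R_def D_def using sep \<rho> qth
    by (intro short_orbit_sum[OF lf ob _ \<theta> \<theta>1]) (auto simp: xe N)
  have Rle: "R \<le> S * (D * (2 * ln (4 * a * (real q)\<^sup>2)) + W) + \<bar>A + B\<bar>"
  proof -
    have pos: "0 < 4 * a * (real q)\<^sup>2" using a q by simp
    have "ln (1 / (4 * a * (real q)\<^sup>2)) \<le> ln \<theta>" using a pos by (intro ln_mono) auto
    moreover have "ln (1 / z) = - ln z" if "0 < z" for z :: real using that by (simp add: ln_div)
    ultimately have "- ln \<theta> \<le> ln (4 * a * (real q)\<^sup>2)" using pos by fastforce
    then show ?thesis unfolding R_def using D S by (intro add_right_mono mult_left_mono) auto
  qed
  have jN: "j * q + q \<le> N" if "j \<in> {1..J}" for j
  proof -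
    have "j * q \<le> J * q" using that by (intro mult_right_mono) auto
    moreover have "(J + 1) * q = J * q + q" by simp
    ultimately show ?thesis unfolding N by linarith
  qed
  have block: "\<bar>(\<Sum>n\<in>{j * q<..j * q + q}. h (\<beta> + real n * \<alpha>)) - (B - A) / 2 * ln (real q)\<bar>
     \<le> D * (2 + 2 * \<epsilon> * (1 + ln (real q)) + ln (4 * a / real j)) + W" if j: "j \<in> {1..J}" for j
  proof -
    define c where "c = j * q"
    have c1: "1 \<le> c" using j q by (simp add: c_def)
    have cs: "real (c + q) * \<theta> \<le> \<epsilon> / real q"
    proof -
      have "real (c + q) \<le> real N" unfolding c_def using jN[OF j] by (simp only: of_nat_le_iff)
      then have "real (c + q) * \<theta> \<le> real N * \<theta>" using \<theta> by (intro mult_right_mono) auto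
      then show ?thesis using small by linarith
    qed
    define X where "X = (\<Sum>n\<in>{c<..c + q}. ln (frac (x n))) + real q"
    define Y where "Y = (\<Sum>n\<in>{c<..c + q}. ln (1 - frac (x n))) + real q"
    define U where "U = (\<Sum>n\<in>{c<..c + q}. u (x n)) - real q * (A + B)"
    have bs: "X \<le> - ln (real q) / 2 + 2 + \<epsilon> * (1 + ln (real q))"
        "ln (real q) / 2 + ln (real c * \<theta>) \<le> X"
        "Y \<le> ln (real q) / 2 + 1"
        "ln (real q) / 2 - 2 * \<epsilon> * (1 + ln (real q)) \<le> Y"
      unfolding X_def Y_def x_def by (rule block_sums[OF q cop c1 \<theta> \<epsilon> cs])+
    \<comment> \<open>With \<open>c = j * q\<close> the product \<open>q * (c * \<theta>)\<close>
      lies between \<open>j / (4 * a)\<close> and 1, so the closest point spoils the value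
      \<open>- ln q\<close> by at most \<open>ln (4 * a / j)\<close>.\<close>
    have ln_nn: "0 \<le> ln (4 * a / real j)" and low: "ln (real q) + ln (real c * \<theta>) \<ge> - ln (4 * a / real j)"
    proof -
      have j0: "0 < real j" using j by simp
      have "real c * \<theta> \<le> real (c + q) * \<theta>" using \<theta> by (intro mult_right_mono) auto
      then have "real c * \<theta> \<le> 1 / real q" using cs \<epsilon>q hq2 by linarith
      then have 1: "real j * (real q)\<^sup>2 * \<theta> \<le> 1" using q by (simp add: c_def field_simps power2_eq_square)
      have "real j * (real q)\<^sup>2 * (1 / (4 * a * (real q)\<^sup>2)) \<le> real j * (real q)\<^sup>2 * \<theta>"
        using a by (intro mult_left_mono) auto
      moreover have "real j * (real q)\<^sup>2 * (1 / (4 * a * (real q)\<^sup>2)) = real j / (4 * a)" using q by simp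
      ultimately have 2: "real j / (4 * a) \<le> real j * (real q)\<^sup>2 * \<theta>" by simp
      have "real j / (4 * a) \<le> 1" using 1 2 by linarith
      then have "1 \<le> 4 * a / real j" using j0 a by (simp add: field_simps)
      then show "0 \<le> ln (4 * a / real j)" by simp
      have "- ln (4 * a / real j) = ln (real j / (4 * a))" using j0 a by (simp add: ln_div)
      also have "\<dots> \<le> ln (real j * (real q)\<^sup>2 * \<theta>)" using 2 j0 a by (intro ln_mono) auto
      also have "real j * (real q)\<^sup>2 * \<theta> = real q * (real c * \<theta>)" by (simp add: c_def power2_eq_square)
      also have "ln (real q * (real c * \<theta>)) = ln (real q) + ln (real c * \<theta>)"
        using q c1 \<theta> by (subst ln_mult) auto
      finally show "ln (real q) + ln (real c * \<theta>) \<ge> - ln (4 * a / real j)" .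
    qed
    define M where "M = 2 + 2 * \<epsilon> * (1 + ln (real q)) + ln (4 * a / real j)"
    have el: "0 \<le> \<epsilon> * (1 + ln (real q))" using \<epsilon> lnq by simp
    have Xb: "\<bar>X + ln (real q) / 2\<bar> \<le> M"
      using bs(1,2) ln_nn low el unfolding M_def abs_le_iff by (simp only: mult.assoc) linarith
    have Yb: "\<bar>Y - ln (real q) / 2\<bar> \<le> M"
      using bs(3,4) ln_nn el unfolding M_def abs_le_iff by (simp only: mult.assoc) linarith
    have Ub: "\<bar>U\<bar> \<le> W"
    proof -
      have \<alpha>c: "\<bar>\<alpha> - real_of_int p / real q\<bar> * real q \<le> 1 / real q"
      proof -
        have "\<theta> * real q \<le> real N * \<theta>" using qN \<theta> by (simp add: mult.commute mult_right_mono)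
        also have "\<dots> \<le> 1 / real q" using small \<epsilon>q hq2 by linarith
        finally show ?thesis using \<theta> by (simp add: \<alpha>)
      qed
      have "(\<Sum>n\<in>{c<..c + q}. u (x n)) = (\<Sum>i = 1..q. u ((\<beta> + real c * \<alpha>) + real i * \<alpha>))"
        using sum_shift_orbit[of u \<beta> \<alpha> c q] by (simp add: xe)
      then show ?thesis
        using denjoy_koksma[OF u(1) _ cop \<alpha>c, of "\<beta> + real c * \<alpha>"] q by (simp add: U_def u(2))
    qed
    have "(\<Sum>n\<in>{c<..c + q}. h (\<beta> + real n * \<alpha>)) = (\<Sum>n\<in>{c<..c + q}. A * ln (frac (x n)) + B * ln (1 - frac (x n)) + u (x n))"
    proof (rule sum.cong[OF refl])
      fix n assume "n \<in> {c<..c + q}"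
      then have "n \<in> {0<..N}" using jN[OF j] by (auto simp: c_def)
      then have "0 < frac (x n)" using sep[of n] \<theta> by linarith
      then have "x n \<notin> \<int>" by simp
      then show "h (\<beta> + real n * \<alpha>) = A * ln (frac (x n)) + B * ln (1 - frac (x n)) + u (x n)"
        using lf by (simp add: xe log_form_def)
    qed
    also have "\<dots> = A * X + B * Y + U"
      by (simp add: X_def Y_def U_def sum.distrib sum_distrib_left algebra_simps)
    finally have "(\<Sum>n\<in>{c<..c + q}. h (\<beta> + real n * \<alpha>)) - (B - A) / 2 * ln (real q)
        = A * (X + ln (real q) / 2) + B * (Y - ln (real q) / 2) + U"
      by (simp add: field_simps)
    moreover have "\<bar>A * (X + ln (real q) / 2)\<bar> \<le> \<bar>A\<bar> * M" "\<bar>B * (Y - ln (real q) / 2)\<bar> \<le> \<bar>B\<bar> * M"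
      unfolding abs_mult by (intro mult_left_mono Xb Yb; simp)+
    ultimately have "\<bar>(\<Sum>n\<in>{c<..c + q}. h (\<beta> + real n * \<alpha>)) - (B - A) / 2 * ln (real q)\<bar> \<le> \<bar>A\<bar> * M + \<bar>B\<bar> * M + W"
      using Ub by linarith
    then show ?thesis by (simp add: M_def D_def c_def algebra_simps)
  qed
  \<comment> \<open>For small \<open>j\<close> the single defects grow with \<open>a\<close>, but
    their average over \<open>j \<le> J\<close> is bounded, because \<open>J\<close> is at least a
    fixed share of \<open>a\<close> and \<open>ln (fact J) \<ge> J * ln J - J\<close>.\<close>
  have lnJ: "(\<Sum>j = 1..J. ln (4 * a / real j)) \<le> real J * (1 + ln (4 / \<kappa>))"
  proof -
    have "(\<Sum>j = 1..J. ln (4 * a / real j)) = (\<Sum>j = 1..J. ln (4 * a) - ln (real j))"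
      using a by (intro sum.cong) (auto simp: ln_div)
    also have "\<dots> = real J * ln (4 * a) - ln (fact J)" by (simp add: sum_subtractf sum_ln_eq[unfolded One_nat_def])
    also have "\<dots> \<le> real J * ln (4 * a) - (real J * ln (real J) - real J)"
    proof -
      have "0 \<le> ln (real J)" using J by simp
      then show ?thesis using stirling_bounds(1)[OF J(1)] by (simp add: algebra_simps)
    qed
    also have "\<dots> = real J * (1 + ln (4 * a / real J))" using a J by (simp add: ln_div algebra_simps)
    also have "\<dots> \<le> real J * (1 + ln (4 / \<kappa>))"
    proof -
      have "4 * a / real J \<le> 4 / \<kappa>" using J(2) \<kappa> J(1) by (simp add: field_simps)
      then show ?thesis using a J \<kappa> by (intro mult_left_mono add_left_mono ln_mono) auto
    qed
    finally show ?thesis .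
  qed
  define Z where "Z = (\<Sum>j = 1..J. \<Sum>n\<in>{j * q<..j * q + q}. h (\<beta> + real n * \<alpha>))"
  have "\<bar>Z - real J * ((B - A) / 2 * ln (real q))\<bar>
      = \<bar>\<Sum>j = 1..J. (\<Sum>n\<in>{j * q<..j * q + q}. h (\<beta> + real n * \<alpha>)) - (B - A) / 2 * ln (real q)\<bar>"
    by (simp add: Z_def sum_subtractf)
  also have "\<dots> \<le> (\<Sum>j = 1..J. D * (2 + 2 * \<epsilon> * (1 + ln (real q)) + ln (4 * a / real j)) + W)"
    using block by (intro order_trans[OF sum_abs] sum_mono) auto
  also have "\<dots> = real J * (D * (2 + 2 * \<epsilon> * (1 + ln (real q))) + W) + D * (\<Sum>j = 1..J. ln (4 * a / real j))"
    by (simp add: sum.distrib sum_distrib_left algebra_simps)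
  also have "\<dots> \<le> real J * (D * (2 + 2 * \<epsilon> * (1 + ln (real q))) + W) + D * (real J * (1 + ln (4 / \<kappa>)))"
    using lnJ D by (intro add_left_mono mult_left_mono) auto
  also have "\<dots> = real J * (D * (3 + 2 * \<epsilon> * (1 + ln (real q)) + ln (4 / \<kappa>)) + W)"
    by (simp add: algebra_simps)
  finally have mid: "\<bar>Z - real J * ((B - A) / 2 * ln (real q))\<bar>
      \<le> real J * (D * (3 + 2 * \<epsilon> * (1 + ln (real q)) + ln (4 / \<kappa>)) + W)" .
  have "(\<Sum>n = 1..N. h (\<beta> + real n * \<alpha>)) = (\<Sum>n\<in>{0<..0 + q}. h (\<beta> + real n * \<alpha>)) + Z
     + (\<Sum>n\<in>{(J + 1) * q<..(J + 1) * q + \<rho>}. h (\<beta> + real n * \<alpha>))"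
    unfolding N Z_def by (rule sum_blocks)
  moreover have "\<bar>T - m\<bar> \<le> P + 2 * Q"
    if "T = x1 + z + x2" "\<bar>x1\<bar> \<le> R" "\<bar>x2\<bar> \<le> R" "\<bar>z - m\<bar> \<le> P" "R \<le> Q" for T m P Q x1 x2 z :: real
    using that by linarith
  ultimately show ?thesis using first last mid Rle unfolding D_def by blast
qed

section \<open>Application to continued fraction convergents\<close>

lemma digit_sum_pos: "x \<in> Irr \<Longrightarrow> 1 \<le> k \<Longrightarrow> k \<le> digit_sum x k"
proof -
  assume x: "x \<in> Irr"
  have "(\<Sum>i = 1..k. 1) \<le> digit_sum x k" unfolding digit_sum_def using cf_digit_pos[OF x] by (intro sum_mono) auto
  then show ?thesis by simp
qed

lemma den_Suc_ge:
  assumes "x \<in> Irr"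
  shows "den (cf_digit x) k \<le> den (cf_digit x) (Suc k)" "1 \<le> den (cf_digit x) k"
    "den' (cf_digit x) k \<le> den (cf_digit x) k"
proof -
  have c: "\<And>i. 1 \<le> i \<Longrightarrow> 1 \<le> cf_digit x i" using cf_digit_pos[OF assms] by auto
  show "1 \<le> den (cf_digit x) k" "den' (cf_digit x) k \<le> den (cf_digit x) k"
    using den_bounds[of k "cf_digit x"] c by auto
  have "1 * den (cf_digit x) k \<le> cf_digit x (Suc k) * den (cf_digit x) k"
    using c[of "Suc k"] by (intro mult_right_mono) auto
  then have "den (cf_digit x) k \<le> cf_digit x (Suc k) * den (cf_digit x) k + den' (cf_digit x) k" by linarith
  then show "den (cf_digit x) k \<le> den (cf_digit x) (Suc k)" by simp
qed

lemma convergent_error: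
  fixes x :: real and k :: nat
  assumes x: "x \<in> Irr"
  defines "Q \<equiv> real (den (cf_digit x) k)" and "a \<equiv> real (cf_digit x (Suc k))"
    and "\<theta> \<equiv> x - real (num (cf_digit x) k) / real (den (cf_digit x) k)"
  shows "sgn \<theta> = (- 1) ^ k" and "\<bar>\<theta>\<bar> \<le> 1 / (a * Q\<^sup>2)" and "1 / (4 * a * Q\<^sup>2) \<le> \<bar>\<theta>\<bar>"
    and "\<bar>\<theta>\<bar> * Q \<le> 1 / Q"
proof -
  define Z where "Z = real (den (cf_digit x) (Suc k)) + gauss x (Suc k) * real (den (cf_digit x) k)"
  have Q: "1 \<le> Q" using den_Suc_ge(2)[OF x, of k] by (simp add: Q_def)
  have a: "1 \<le> a" using cf_digit_Suc_pos[OF x, of k] by (simp add: a_def)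
  have g: "0 < gauss x (Suc k)" "gauss x (Suc k) < 1" using gauss_pos[OF x] gauss_less_1[OF x] by auto
  have dS: "real (den (cf_digit x) (Suc k)) = a * Q + real (den' (cf_digit x) k)"
    by (simp add: a_def Q_def)
  have d': "0 \<le> real (den' (cf_digit x) k)" "real (den' (cf_digit x) k) \<le> Q"
    using den_Suc_ge(3)[OF x, of k] by (auto simp: Q_def)
  have gQ: "0 \<le> gauss x (Suc k) * Q" "gauss x (Suc k) * Q \<le> Q"
    using g Q by (auto simp: mult_le_cancel_right1)
  have aQ: "Q \<le> a * Q" using a Q by simp
  have Z: "a * Q \<le> Z" "Z \<le> 4 * (a * Q)"
    using d' gQ aQ unfolding Z_def dS Q_def[symmetric] by linarith+
  have Z0: "0 < Z" using Z(1) aQ Q by linarith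
  have \<theta>: "\<theta> = (- 1) ^ k / (Q * Z)"
    using cf_approx[OF x, of k] by (simp only: \<theta>_def Q_def Z_def)
  then have abs: "\<bar>\<theta>\<bar> = 1 / (Q * Z)" using Q Z0 by (simp add: abs_mult power_abs)
  have "sgn \<theta> = sgn ((- 1) ^ k) / sgn (Q * Z)" unfolding \<theta> by (simp only: sgn_divide)
  also have "sgn (Q * Z) = 1" using Q Z0 by simp
  finally show "sgn \<theta> = (- 1) ^ k" by (cases "even k") auto
  show "\<bar>\<theta>\<bar> \<le> 1 / (a * Q\<^sup>2)"
  proof -
    have "a * Q\<^sup>2 \<le> Q * Z" using Z(1) Q by (simp add: power2_eq_square)
    then show ?thesis unfolding abs using a Q Z0 by (intro divide_left_mono mult_pos_pos) auto
  qed
  show "1 / (4 * a * Q\<^sup>2) \<le> \<bar>\<theta>\<bar>"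
  proof -
    have "Q * Z \<le> Q * (4 * (a * Q))" using Z(2) Q by (intro mult_left_mono) auto
    then have "Q * Z \<le> 4 * a * Q\<^sup>2" by (simp add: power2_eq_square mult_ac)
    then show ?thesis unfolding abs using a Q Z0 by (intro divide_left_mono mult_pos_pos) auto
  qed
  have "Q \<le> Z" using Z(1) aQ by linarith
  then have "1 / Z \<le> 1 / Q" using Q Z0 by (intro divide_left_mono mult_pos_pos) auto
  then show "\<bar>\<theta>\<bar> * Q \<le> 1 / Q" unfolding abs using Q by simp
qed

lemma denjoy_koksma_cf:
  fixes x :: real and k :: nat
  assumes x: "x \<in> Irr" and v: "bv_by v V"
  defines "q \<equiv> den (cf_digit x) k"
  shows "\<bar>(\<Sum>n = 1..q. v (y + real n * x)) - real q * integral {0..1} v\<bar> \<le> V"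
proof (rule denjoy_koksma[OF v, where p = "int (num (cf_digit x) k)"])
  show "0 < q" using den_Suc_ge(2)[OF x, of k] by (simp add: q_def)
  show "coprime (int (num (cf_digit x) k)) (int q)" unfolding q_def by (rule coprime_num_den)
  show "\<bar>x - real_of_int (int (num (cf_digit x) k)) / real q\<bar> * real q \<le> 1 / real q"
    using convergent_error(4)[OF x, of k] by (simp add: q_def)
qed

text \<open>The greedy (Ostrowski) decomposition of \<open>n\<close>: at level \<open>k\<close> at
  most \<open>cf_digit x (Suc k)\<close> full blocks fit, each costing \<open>V\<close> by
  Denjoy--Koksma, and the remainder is handled one level below.\<close>

lemma partial_orbit_bound:
  assumes x: "x \<in> Irr" and v: "bv_by v V"
  shows "n < den (cf_digit x) k \<Longrightarrow>
    \<bar>(\<Sum>i = 1..n. v (y + real i * x)) - real n * integral {0..1} v\<bar> \<le> V * real (digit_sum x k)"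
proof (induction k arbitrary: n y)
  case 0
  then show ?case by (simp add: digit_sum_def)
next
  case (Suc k)
  define I where "I = integral {0..1} v"
  define q where "q = den (cf_digit x) k"
  have V: "0 \<le> V" using bv_by_nonneg[OF v] .
  have q: "1 \<le> q" using den_Suc_ge(2)[OF x] by (simp add: q_def)
  have split: "(\<Sum>i = 1..m + l. F i) = (\<Sum>i = 1..m. F i) + (\<Sum>i = 1..l. F (m + i))" for m l :: nat and F :: "nat \<Rightarrow> real"
    by (induction l) auto
  have shift: "(\<Sum>i = 1..l. v (y + real (m + i) * x)) = (\<Sum>i = 1..l. v ((y + real m * x) + real i * x))" for m l
    by (intro sum.cong) (auto simp: algebra_simps)
  have blocks: "\<bar>(\<Sum>i = 1..b * q. v (y + real i * x)) - real (b * q) * I\<bar> \<le> V * real b" for b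
  proof (induction b)
    case (Suc b)
    have e: "Suc b * q = b * q + q" by simp
    have "(\<Sum>i = 1..Suc b * q. v (y + real i * x)) - real (Suc b * q) * I
      = ((\<Sum>i = 1..b * q. v (y + real i * x)) - real (b * q) * I)
        + ((\<Sum>i = 1..q. v ((y + real (b * q) * x) + real i * x)) - real q * I)"
      unfolding e split shift by (simp add: algebra_simps)
    moreover have "\<bar>(\<Sum>i = 1..q. v ((y + real (b * q) * x) + real i * x)) - real q * I\<bar> \<le> V"
      unfolding q_def I_def by (rule denjoy_koksma_cf[OF x v])
    ultimately have "\<bar>(\<Sum>i = 1..Suc b * q. v (y + real i * x)) - real (Suc b * q) * I\<bar> \<le> V * real b + V"
      using Suc by linarith
    then show ?case by (simp add: algebra_simps)
  qed simp
  define b where "b = n div q"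
  define \<rho> where "\<rho> = n mod q"
  have n: "n = b * q + \<rho>" and \<rho>: "\<rho> < q" using q by (auto simp: b_def \<rho>_def)
  have bd: "b \<le> cf_digit x (Suc k)"
  proof -
    have "b * q \<le> n" by (simp add: n)
    also have "n < cf_digit x (Suc k) * q + den' (cf_digit x) k" using Suc.prems by (simp add: q_def)
    also have "\<dots> \<le> (cf_digit x (Suc k) + 1) * q" using den_Suc_ge(3)[OF x, of k] by (simp add: q_def)
    finally have "b < cf_digit x (Suc k) + 1" by (meson mult_less_cancel2)
    then show ?thesis by simp
  qed
  have "(\<Sum>i = 1..n. v (y + real i * x)) - real n * I
      = ((\<Sum>i = 1..b * q. v (y + real i * x)) - real (b * q) * I)
        + ((\<Sum>i = 1..\<rho>. v ((y + real (b * q) * x) + real i * x)) - real \<rho> * I)"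
    unfolding n split shift by (simp add: algebra_simps)
  moreover have "\<bar>(\<Sum>i = 1..\<rho>. v ((y + real (b * q) * x) + real i * x)) - real \<rho> * I\<bar> \<le> V * real (digit_sum x k)"
    unfolding I_def using Suc.IH \<rho> by (simp add: q_def)
  moreover have "V * real b \<le> V * real (cf_digit x (Suc k))" using bd V by (intro mult_left_mono) auto
  ultimately have "\<bar>(\<Sum>i = 1..n. v (y + real i * x)) - real n * I\<bar> \<le> V * real (cf_digit x (Suc k)) + V * real (digit_sum x k)"
    using blocks[of b] by linarith
  then show ?case by (simp add: I_def digit_sum_def algebra_simps)
qed

lemma orbit_bound_cf:
  assumes x: "x \<in> Irr" and k: "1 \<le> k"
  shows "orbit_bound x (den (cf_digit x) k) (real (digit_sum x k))"
  unfolding orbit_bound_def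
proof (intro allI impI)
  fix v V y n assume v: "bv_by v V" and n: "n \<le> den (cf_digit x) k"
  show "\<bar>(\<Sum>i = 1..n. v (y + real i * x)) - real n * integral {0..1} v\<bar> \<le> V * real (digit_sum x k)"
  proof (cases "n = den (cf_digit x) k")
    case True
    have "V * 1 \<le> V * real (digit_sum x k)"
      using digit_sum_pos[OF x k] k bv_by_nonneg[OF v] by (intro mult_left_mono) auto
    then show ?thesis using denjoy_koksma_cf[OF x v, of y k] True by simp
  next
    case False
    then show ?thesis using partial_orbit_bound[OF x v, of n k] n by simp
  qed
qed

text \<open>For negative \<theta> the reflection \<open>y \<mapsto> - y\<close> reverses the push
  and exchanges \<open>A\<close> with \<open>B\<close>; this is where the parity of the convergent
  becomes the sign of the main term.\<close>

lemma orbit_sum_signed: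
  fixes p s :: int and q J \<rho> :: nat and \<theta> \<epsilon> a \<kappa> :: real
  assumes lf: "log_form h A B u W" and ob: "orbit_bound \<alpha> q S"
    and q: "1 \<le> q" and cop: "coprime p (int q)" and \<theta>: "\<theta> \<noteq> 0"
    and \<alpha>: "\<alpha> = real_of_int p / real q + \<theta>" and \<beta>: "\<beta> = real_of_int s / real q"
    and \<epsilon>: "0 < \<epsilon>" "\<epsilon> \<le> 1 / 2"
    and N: "N = (J + 1) * q + \<rho>" and \<rho>: "\<rho> < q" and small: "real N * \<bar>\<theta>\<bar> \<le> \<epsilon> / real q"
    and a: "0 < a" "1 / (4 * a * (real q)\<^sup>2) \<le> \<bar>\<theta>\<bar>" and J: "1 \<le> J" "\<kappa> * a \<le> real J" and \<kappa>: "0 < \<kappa>"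
    and S: "0 \<le> S"
  shows "\<bar>(\<Sum>n = 1..N. h (\<beta> + real n * \<alpha>)) - sgn \<theta> * (real J * ((B - A) / 2 * ln (real q)))\<bar>
    \<le> real J * ((\<bar>A\<bar> + \<bar>B\<bar>) * (3 + 2 * \<epsilon> * (1 + ln (real q)) + ln (4 / \<kappa>)) + W)
      + 2 * (S * ((\<bar>A\<bar> + \<bar>B\<bar>) * (2 * ln (4 * a * (real q)\<^sup>2)) + W) + \<bar>A + B\<bar>)"
proof (cases "0 < \<theta>")
  case True
  then show ?thesis
    using orbit_sum[OF lf ob q cop True \<alpha> \<beta> \<epsilon> N \<rho> _ a(1) _ J \<kappa> S] small a(2) by simp
next
  case False
  then have \<theta>': "0 < - \<theta>" using \<theta> by simp
  have cop': "coprime (- p) (int q)" using cop by simp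
  have \<alpha>': "- \<alpha> = real_of_int (- p) / real q + (- \<theta>)" using \<alpha> by simp
  have \<beta>': "- \<beta> = real_of_int (- s) / real q" using \<beta> by simp
  have "\<bar>(\<Sum>n = 1..N. h (- (- \<beta> + real n * - \<alpha>))) - real J * ((A - B) / 2 * ln (real q))\<bar>
    \<le> real J * ((\<bar>B\<bar> + \<bar>A\<bar>) * (3 + 2 * \<epsilon> * (1 + ln (real q)) + ln (4 / \<kappa>)) + W)
      + 2 * (S * ((\<bar>B\<bar> + \<bar>A\<bar>) * (2 * ln (4 * a * (real q)\<^sup>2)) + W) + \<bar>B + A\<bar>)"
    using orbit_sum[OF log_form_reflect[OF lf] orbit_bound_minus[OF ob] q cop' \<theta>' \<alpha>' \<beta>' \<epsilon> N \<rho> _ a(1) _ J \<kappa> S]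
      small a(2) \<theta>' by simp
  moreover have "- (- \<beta> + real n * - \<alpha>) = \<beta> + real n * \<alpha>" for n by simp
  moreover have "real J * ((A - B) / 2 * ln (real q)) = sgn \<theta> * (real J * ((B - A) / 2 * ln (real q)))"
    using \<theta>' by (simp add: field_simps)
  ultimately show ?thesis
    by (simp only: add.commute[of "\<bar>B\<bar>" "\<bar>A\<bar>"] add.commute[of B A])
qed

text \<open>The lower bound is the separation of the orbit. For the upper bound, one of the first
  \<open>q\<close> points has residue 0 and is pushed off the singularity by at most
  \<open>q * \<bar>\<theta>\<bar>\<close>. The sign \<sigma> reflects the orbit so that the push is
  positive.\<close>

lemma gmin_bounds:
  fixes p s :: int and q N :: nat
  assumes q: "1 \<le> q" and cop: "coprime p (int q)" and \<theta>: "\<theta> \<noteq> 0"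
    and \<alpha>: "\<alpha> = real_of_int p / real q + \<theta>" and \<beta>: "q0 - x1 = real_of_int s / real q"
    and N: "q \<le> N" and small: "real N * \<bar>\<theta>\<bar> \<le> (1 / 2) / real q"
  shows "\<bar>\<theta>\<bar> \<le> gmin \<alpha> q0 x1 N" and "gmin \<alpha> q0 x1 N \<le> real q * \<bar>\<theta>\<bar>"
    and "\<exists>n\<in>{1..N}. gmin \<alpha> q0 x1 N = dist_int (real n * \<alpha> + q0 - x1)"
proof -
  define G where "G = (\<lambda>n. dist_int (real n * \<alpha> + q0 - x1)) ` {1..N}"
  have fin: "finite G" "G \<noteq> {}" using q N by (auto simp: G_def)
  have ge: "gmin \<alpha> q0 x1 N = Min G" by (simp add: gmin_def G_def)
  have "Min G \<in> G" using Min_in[OF fin] .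
  then show "\<exists>n\<in>{1..N}. gmin \<alpha> q0 x1 N = dist_int (real n * \<alpha> + q0 - x1)" unfolding ge by (auto simp: G_def)
  define \<sigma> :: int where "\<sigma> = (if 0 < \<theta> then 1 else - 1)"
  define x where "x = (\<lambda>n::nat. real_of_int (\<sigma> * s) / real q + real n * (real_of_int (\<sigma> * p) / real q + \<bar>\<theta>\<bar>))"
  have \<sigma>\<theta>: "\<bar>\<theta>\<bar> = of_int \<sigma> * \<theta>" by (simp add: \<sigma>_def)
  have xs: "x n = of_int \<sigma> * (real n * \<alpha> + q0 - x1)" for n
  proof -
    have "real n * \<alpha> + q0 - x1 = real n * (real_of_int p / real q + \<theta>) + real_of_int s / real q"
      using \<beta> by (simp add: \<alpha>)
    then show ?thesis unfolding x_def \<sigma>\<theta> by (simp add: algebra_simps)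
  qed
  have sep: "\<bar>\<theta>\<bar> \<le> frac (x n) \<and> \<bar>\<theta>\<bar> \<le> 1 - frac (x n)" if "1 \<le> n" "n \<le> N" for n
    unfolding x_def by (rule orbit_separation[OF q _ that small]) (use \<theta> in simp)
  have dist: "dist_int (real n * \<alpha> + q0 - x1) = min (frac (x n)) (1 - frac (x n))" if "1 \<le> n" "n \<le> N" for n
  proof -
    have "0 < frac (x n)" using sep[OF that] \<theta> by linarith
    then have nz: "x n \<notin> \<int>" by simp
    show ?thesis
    proof (cases "0 < \<theta>")
      case True
      then show ?thesis by (simp add: xs \<sigma>_def dist_int_def)
    next
      case False
      then have "real n * \<alpha> + q0 - x1 = - x n" by (simp add: xs \<sigma>_def)
      then show ?thesis using nz by (simp add: dist_int_def frac_neg min.commute)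
    qed
  qed
  show "\<bar>\<theta>\<bar> \<le> gmin \<alpha> q0 x1 N"
    unfolding ge using fin sep dist by (subst Min_ge_iff) (auto simp: G_def)
  have cop': "coprime (\<sigma> * p) (int q)" using cop by (simp add: \<sigma>_def)
  have "bij_betw (\<lambda>n. nat ((\<sigma> * s + int n * (\<sigma> * p)) mod int q)) {0<..0 + q} {..<q}"
    using q by (intro bij_betw_residues[OF cop']) auto
  then have "0 \<in> (\<lambda>n. nat ((\<sigma> * s + int n * (\<sigma> * p)) mod int q)) ` {0<..0 + q}"
    using q by (simp add: bij_betw_def)
  then obtain n where n0: "0 = nat ((\<sigma> * s + int n * (\<sigma> * p)) mod int q)" "n \<in> {0<..0 + q}" by (rule imageE)
  then have n: "1 \<le> n" "n \<le> q" "nat ((\<sigma> * s + int n * (\<sigma> * p)) mod int q) = 0" by simp_all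
  have "real n * \<bar>\<theta>\<bar> \<le> real N * \<bar>\<theta>\<bar>" using n N by (intro mult_right_mono) auto
  moreover have "(1 / 2) / real q < 1 / real q" using q by (intro divide_strict_right_mono) auto
  ultimately have lt: "real n * \<bar>\<theta>\<bar> < 1 / real q" using small by linarith
  have "x n = real_of_int (\<sigma> * s + int n * (\<sigma> * p)) / real q + real n * \<bar>\<theta>\<bar>"
    by (simp add: x_def add_divide_distrib algebra_simps)
  then have "frac (x n) = real n * \<bar>\<theta>\<bar>"
    using frac_shifted_fraction[of q "real n * \<bar>\<theta>\<bar>" "\<sigma> * s + int n * (\<sigma> * p)"] q lt n(3) by simp
  then have "dist_int (real n * \<alpha> + q0 - x1) \<le> real n * \<bar>\<theta>\<bar>"
    using dist[of n] n N by simp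
  also have "\<dots> \<le> real q * \<bar>\<theta>\<bar>" using n by (intro mult_right_mono) auto
  finally have "dist_int (real n * \<alpha> + q0 - x1) \<le> real q * \<bar>\<theta>\<bar>" .
  moreover have "gmin \<alpha> q0 x1 N \<le> dist_int (real n * \<alpha> + q0 - x1)"
    unfolding ge using fin n N by (intro Min_le) (auto simp: G_def)
  ultimately show "gmin \<alpha> q0 x1 N \<le> real q * \<bar>\<theta>\<bar>" by linarith
qed

section \<open>Size of the function away from and around its singularity\<close>

lemma log_form_abs_le:
  assumes lf: "log_form h A B u W" and T: "\<And>y. \<bar>u y\<bar> \<le> T"
    and g: "0 < g" "g \<le> frac y" "g \<le> 1 - frac y"
  shows "\<bar>h y\<bar> \<le> (\<bar>A\<bar> + \<bar>B\<bar>) * (- ln g) + T"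
proof -
  have "y \<notin> \<int>" using g by (metis frac_eq_0_iff not_le)
  then have h: "h y = A * ln (frac y) + B * ln (1 - frac y) + u y" using lf by (simp add: log_form_def)
  have "ln g \<le> ln (frac y)" "ln g \<le> ln (1 - frac y)" using g by (auto intro!: ln_mono)
  moreover have "0 < frac y" "frac y \<le> 1" "0 < 1 - frac y" "1 - frac y \<le> 1"
    using g frac_lt_1[of y] by linarith+
  then have "ln (frac y) \<le> 0" "ln (1 - frac y) \<le> 0" by simp_all
  ultimately have "\<bar>ln (frac y)\<bar> \<le> - ln g" "\<bar>ln (1 - frac y)\<bar> \<le> - ln g" by auto
  then have "\<bar>A * ln (frac y)\<bar> \<le> \<bar>A\<bar> * (- ln g)" "\<bar>B * ln (1 - frac y)\<bar> \<le> \<bar>B\<bar> * (- ln g)"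
    unfolding abs_mult by (intro mult_left_mono; simp)+
  then have "\<bar>h y\<bar> \<le> \<bar>A\<bar> * (- ln g) + \<bar>B\<bar> * (- ln g) + T" unfolding h using T[of y] by linarith
  then show ?thesis by (simp add: algebra_simps)
qed

lemma SUP_outside_le:
  assumes lf: "log_form h A B u W" and T: "\<And>y. \<bar>u y\<bar> \<le> T" and f: "\<And>x. f x = h (x - x1)"
    and g: "0 < g" and ne: "outside_A x1 g \<noteq> {}"
  shows "(SUP x\<in>outside_A x1 g. \<bar>f x\<bar>) \<le> (\<bar>A\<bar> + \<bar>B\<bar>) * (- ln g) + T"
proof (rule cSUP_least[OF ne])
  fix x assume "x \<in> outside_A x1 g"
  then have "g \<le> dist_int (x - x1)" by (simp add: outside_A_def)
  then show "\<bar>f x\<bar> \<le> (\<bar>A\<bar> + \<bar>B\<bar>) * (- ln g) + T"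
    unfolding f using log_form_abs_le[OF lf T g] by (simp add: dist_int_def)
qed

lemma neg_ln_abs_has_integral:
  fixes g :: real
  assumes "0 < g"
  shows "((\<lambda>x. - ln \<bar>x\<bar>) has_integral (2 * (g - g * ln g))) {- g..g}"
proof -
  have 1: "((\<lambda>x. - ln \<bar>x\<bar>) has_integral (g - g * ln g)) {0..g}"
  proof (rule has_integral_eq)
    show "((\<lambda>x. - ln x) has_integral (g - g * ln g)) {0..g}"
      using has_integral_neg[OF ln_has_integral[of g]] assms by simp
    show "- ln x = - ln \<bar>x\<bar>" if "x \<in> {0..g}" for x :: real using that by simp
  qed
  have "((\<lambda>x. - ln \<bar>- x\<bar>) has_integral (g - g * ln g)) {- g..- 0}"
    by (subst has_integral_reflect_real) (rule 1)
  then have 2: "((\<lambda>x. - ln \<bar>x\<bar>) has_integral (g - g * ln g)) {- g..0}" by simp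
  show ?thesis using has_integral_combine[OF _ _ 2 1] assms by simp
qed

lemma integral_near_singularity_le:
  assumes lf: "log_form h A B u W" and T: "\<And>y. \<bar>u y\<bar> \<le> T" and f: "\<And>x. f x = h (x - x1)"
    and g: "0 < g" "g \<le> 1 / 2"
  shows "\<bar>integral {x1 - g<..<x1 + g} f\<bar> \<le> 2 * g * ((\<bar>A\<bar> + \<bar>B\<bar>) * (1 - ln g) + T)"
proof -
  define D where "D = \<bar>A\<bar> + \<bar>B\<bar>"
  have T0: "0 \<le> T" using T[of 0] by linarith
  have D0: "0 \<le> D" by (simp add: D_def)
  define G where "G = (\<lambda>x. D * (- ln \<bar>x - x1\<bar>) + T)"
  \<comment> \<open>\<open>log_form\<close> says nothing about the value at the singularity itself,
    so the majorant is adjusted at that one point.\<close>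
  define G' where "G' = (\<lambda>x. if x = x1 then \<bar>f x1\<bar> else G x)"
  have "((\<lambda>x. - ln \<bar>x + - x1\<bar>) has_integral (2 * (g - g * ln g))) {- g - - x1..g - - x1}"
    by (rule has_integral_shift_real_ivl[OF neg_ln_abs_has_integral[OF g(1)]])
  then have "((\<lambda>x. - ln \<bar>x - x1\<bar>) has_integral (2 * (g - g * ln g))) {x1 - g..x1 + g}"
    by (simp add: algebra_simps)
  then have "(G has_integral (D * (2 * (g - g * ln g)) + T * (2 * g))) {x1 - g..x1 + g}"
    unfolding G_def using has_integral_const_real[of T "x1 - g" "x1 + g"] g
    by (intro has_integral_add has_integral_mult_right) (auto simp: mult.commute)
  then have "(G' has_integral (D * (2 * (g - g * ln g)) + T * (2 * g))) {x1 - g..x1 + g}"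
    by (rule has_integral_spike_finite[of "{x1}", rotated 2]) (auto simp: G'_def)
  then have Gi: "(G' has_integral (D * (2 * (g - g * ln g)) + T * (2 * g))) {x1 - g<..<x1 + g}"
    by (simp add: has_integral_Icc_iff_Ioo)
  have bd: "norm (f x) \<le> G' x" if x: "x \<in> {x1 - g<..<x1 + g}" for x
  proof (cases "x = x1")
    case True
    then show ?thesis by (simp add: G'_def)
  next
    case False
    define y where "y = x - x1"
    have y: "y \<noteq> 0" "\<bar>y\<bar> < 1 / 2" using False x g by (auto simp: y_def abs_if)
    have fy: "frac y = (if 0 < y then y else 1 + y)"
      using y by (auto simp: frac_unique_iff)
    have "\<bar>y\<bar> \<le> frac y" "\<bar>y\<bar> \<le> 1 - frac y" using y by (auto simp: fy)
    then have "\<bar>h y\<bar> \<le> D * (- ln \<bar>y\<bar>) + T"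
      unfolding D_def using y by (intro log_form_abs_le[OF lf T]) auto
    then show ?thesis using False by (simp add: G'_def G_def f y_def)
  qed
  have "\<bar>integral {x1 - g<..<x1 + g} f\<bar> \<le> D * (2 * (g - g * ln g)) + T * (2 * g)"
  proof (cases "f integrable_on {x1 - g<..<x1 + g}")
    case True
    then have "norm (integral {x1 - g<..<x1 + g} f) \<le> integral {x1 - g<..<x1 + g} G'"
      using has_integral_integrable[OF Gi] bd by (intro Henstock_Kurzweil_Integration.integral_norm_bound_integral) auto
    then show ?thesis using integral_unique[OF Gi] by simp
  next
    case False
    \<comment> \<open>The integral of a non-integrable function is 0 by default, so here it suffices
      that the bound is nonnegative.\<close>
    have "ln g \<le> 0" using g by simp
    then have "g * ln g \<le> 0" using g by (simp add: mult_nonneg_nonpos)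
    then have "g * ln g \<le> g" using g(1) by (rule order_trans[OF _ less_imp_le])
    then have 0: "0 \<le> g - g * ln g" by (simp only: diff_ge_0_iff_ge)
    have "0 \<le> D * (2 * (g - g * ln g)) + T * (2 * g)"
      by (intro add_nonneg_nonneg mult_nonneg_nonneg 0 D0 T0 less_imp_le[OF g(1)]) simp_all
    then show ?thesis using False by (simp add: not_integrable_integral)
  qed
  then show ?thesis by (simp add: D_def algebra_simps)
qed


section \<open>Bounded variation and the normal form of the singularity\<close>

definition list_var :: "(real \<Rightarrow> real) \<Rightarrow> real list \<Rightarrow> real" where
  "list_var t xs = (\<Sum>i<length xs - 1. \<bar>t (xs ! Suc i) - t (xs ! i)\<bar>)"

lemma list_var_snoc:
  "list_var t (xs @ [a]) = list_var t xs + (if xs = [] then 0 else \<bar>t a - t (last xs)\<bar>)"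
proof (cases "xs = []")
  case False
  define m where "m = length xs - 1"
  have l: "length xs = Suc m" using False by (simp add: m_def)
  have "list_var t (xs @ [a]) = (\<Sum>i<Suc m. \<bar>t ((xs @ [a]) ! Suc i) - t ((xs @ [a]) ! i)\<bar>)"
    by (simp add: list_var_def l)
  also have "\<dots> = (\<Sum>i<m. \<bar>t ((xs @ [a]) ! Suc i) - t ((xs @ [a]) ! i)\<bar>)
      + \<bar>t ((xs @ [a]) ! Suc m) - t ((xs @ [a]) ! m)\<bar>" by simp
  also have "(\<Sum>i<m. \<bar>t ((xs @ [a]) ! Suc i) - t ((xs @ [a]) ! i)\<bar>) = list_var t xs"
    unfolding list_var_def m_def[symmetric] by (intro sum.cong) (auto simp: nth_append l)
  also have "(xs @ [a]) ! Suc m = a" by (simp add: nth_append l)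
  also have "(xs @ [a]) ! m = last xs" using False by (simp add: nth_append l last_conv_nth)
  finally show ?thesis using False by simp
qed (simp add: list_var_def)

text \<open>\<open>v y\<close> is the variation over \<open>[0, y]\<close>. Appending
  \<open>y, z\<close> to any list for \<open>y\<close> gives a list for \<open>z\<close> whose
  variation is larger by at least \<open>\<bar>t z - t y\<bar>\<close>.\<close>

lemma bounded_variation_on_majorant:
  assumes "bounded_variation_on t {0..<1}"
  obtains v V where "\<And>y z. 0 \<le> y \<Longrightarrow> y \<le> z \<Longrightarrow> z < 1 \<Longrightarrow> \<bar>t z - t y\<bar> \<le> v z - v y"
    and "\<And>y. 0 \<le> y \<Longrightarrow> y < 1 \<Longrightarrow> 0 \<le> v y \<and> v y \<le> V"
proof -
  obtain V where V: "\<And>xs. sorted xs \<Longrightarrow> set xs \<subseteq> {0..<1} \<Longrightarrow> list_var t xs \<le> V"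
    using assms by (auto simp: bounded_variation_on_def list_var_def)
  define P where "P = (\<lambda>y::real. {xs. sorted xs \<and> set xs \<subseteq> {0..y}})"
  define v where "v = (\<lambda>y. SUP xs\<in>P y. list_var t xs)"
  have PV: "list_var t xs \<le> V" if "xs \<in> P y" "y < 1" for xs y
    using that by (intro V) (auto simp: P_def)
  have bdd: "bdd_above (list_var t ` P y)" if "y < 1" for y
    using PV[OF _ that] by (intro bdd_aboveI[of _ V]) auto
  have nil: "[] \<in> P y" for y by (simp add: P_def)
  have 1: "\<bar>t z - t y\<bar> \<le> v z - v y" if yz: "0 \<le> y" "y \<le> z" "z < 1" for y z
  proof -
    have "v y \<le> v z - \<bar>t z - t y\<bar>"
      unfolding v_def[THEN fun_cong, of y]
    proof (rule cSUP_least)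
      show "P y \<noteq> {}" using nil by blast
      fix xs assume xs: "xs \<in> P y"
      have in_P: "xs @ [y, z] \<in> P z" using xs yz by (auto simp: P_def sorted_append)
      have "list_var t xs + \<bar>t z - t y\<bar> \<le> list_var t (xs @ [y, z])"
        using list_var_snoc[of t "xs @ [y]" z] list_var_snoc[of t xs y] by simp
      also have "\<dots> \<le> v z" unfolding v_def by (rule cSUP_upper[OF in_P bdd[OF yz(3)]])
      finally show "list_var t xs \<le> v z - \<bar>t z - t y\<bar>" by simp
    qed
    then show ?thesis by simp
  qed
  have 2: "0 \<le> v y \<and> v y \<le> V" if "0 \<le> y" "y < 1" for y
  proof
    have "list_var t [] \<le> v y" unfolding v_def by (rule cSUP_upper[OF nil bdd[OF that(2)]])
    then show "0 \<le> v y" by (simp add: list_var_def)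
    show "v y \<le> V" unfolding v_def using nil PV that by (intro cSUP_least) auto
  qed
  show ?thesis using 1 2 that by blast
qed

text \<open>Since \<open>min a b * max a b = a * b\<close>, the symmetric term \<open>ln (dist_int y)\<close> splits into the two one-sided logarithms up to the
Lipschitz function \<open>ln (max (frac y) (1 - frac y))\<close>.\<close>

lemma log_form_of_singularity:
  assumes "smooth_log_sing f x1 c1 c2"
  obtains u W where "log_form (\<lambda>y. f (x1 + y)) (c1 + c2) c1 u W"
proof -
  obtain t where perf: "one_periodic f" and intf: "(f has_integral 0) {0..1}"
    and pert: "one_periodic t" and bvt: "bounded_variation_on t {0..<1}"
    and ft: "\<And>x. x - x1 \<notin> \<int> \<Longrightarrow> f x = c1 * ln (dist_int (x - x1)) + c2 * ln (frac (x - x1)) + t x"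
    using assms unfolding smooth_log_sing_def by blast
  define h where "h = (\<lambda>y. f (x1 + y))"
  define m where "m = (\<lambda>y::real. ln (max (frac y) (1 - frac y)))"
  define u where "u = (\<lambda>y::real. t (x1 + y) - c1 * m y)"
  have hu: "h y = (c1 + c2) * ln (frac y) + c1 * ln (1 - frac y) + u y" if "y \<notin> \<int>" for y
  proof -
    have fp: "0 < frac y" "0 < 1 - frac y" using that frac_lt_1[of y] by simp_all
    have "ln (min (frac y) (1 - frac y)) + m y = ln (frac y) + ln (1 - frac y)"
      unfolding m_def by (cases "frac y \<le> 1 - frac y") (auto simp: min_def max_def)
    then have "c1 * (ln (min (frac y) (1 - frac y)) + m y) = c1 * (ln (frac y) + ln (1 - frac y))" by simp
    then have "c1 * ln (min (frac y) (1 - frac y)) = c1 * ln (frac y) + c1 * ln (1 - frac y) - c1 * m y"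
      by (simp only: distrib_left)
    moreover have "h y = c1 * ln (min (frac y) (1 - frac y)) + c2 * ln (frac y) + t (x1 + y)"
      using ft[of "x1 + y"] that by (simp add: h_def dist_int_def)
    ultimately show ?thesis by (simp add: u_def algebra_simps)
  qed
  have perm: "one_periodic m" by (simp add: one_periodic_def m_def frac_1_eq)
  have "one_periodic u"
    using pert perm unfolding one_periodic_def u_def by (metis add.assoc)
  obtain v1 V1 where v1: "\<And>y z. 0 \<le> y \<Longrightarrow> y \<le> z \<Longrightarrow> z < 1 \<Longrightarrow> \<bar>t z - t y\<bar> \<le> v1 z - v1 y"
      "\<And>y. 0 \<le> y \<Longrightarrow> y < 1 \<Longrightarrow> 0 \<le> v1 y \<and> v1 y \<le> V1"
    using bounded_variation_on_majorant[OF bvt] by blast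
  obtain w1 where w1: "\<And>y z. y \<le> z \<Longrightarrow> \<bar>t z - t y\<bar> \<le> w1 z - w1 y" "\<And>y. w1 (y + 1) = w1 y + 2 * V1"
    using periodic_majorant[OF pert v1] by blast
  have m_lip: "\<bar>m z - m y\<bar> \<le> 2 * z - 2 * y" if "0 \<le> y" "y \<le> z" "z < 1" for y z
  proof -
    have fr: "frac y = y" "frac z = z" unfolding frac_eq using that by auto
    \<comment> \<open>The larger of \<open>frac y\<close> and \<open>1 - frac y\<close> is at least
      \<open>1 / 2\<close>, where \<open>ln\<close> has slope at most 2.\<close>
    have lip: "ln a - ln b \<le> 2 * \<bar>a - b\<bar>" if "1 / 2 \<le> a" "1 / 2 \<le> b" for a b :: real
    proof -
      have "ln a - ln b \<le> (a - b) / b" using that by (intro ln_diff_le) auto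
      also have "\<dots> \<le> \<bar>a - b\<bar> / b" using that by (intro divide_right_mono) auto
      also have "\<dots> \<le> \<bar>a - b\<bar> / (1 / 2)" using that by (intro divide_left_mono) auto
      finally show ?thesis by simp
    qed
    have "\<bar>max z (1 - z) - max y (1 - y)\<bar> \<le> z - y" using that by (auto simp: max_def)
    moreover have half: "1 / 2 \<le> max z (1 - z)" "1 / 2 \<le> max y (1 - y)" by (auto simp: max_def)
    moreover have "\<bar>ln a - ln b\<bar> \<le> 2 * z - 2 * y"
      if "\<bar>a - b\<bar> \<le> z - y" "1 / 2 \<le> a" "1 / 2 \<le> b" for a b :: real
    proof -
      have "ln a - ln b \<le> 2 * (z - y)" "ln b - ln a \<le> 2 * (z - y)"
        using lip[OF that(2,3)] lip[OF that(3,2)] mult_left_mono[OF that(1), of 2]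
        unfolding abs_minus_commute[of b a] by (auto intro: order_trans)
      then show ?thesis by (simp add: abs_le_iff)
    qed
    ultimately show ?thesis unfolding m_def fr by blast
  qed
  obtain w2 where w2: "\<And>y z. y \<le> z \<Longrightarrow> \<bar>m z - m y\<bar> \<le> w2 z - w2 y" "\<And>y. w2 (y + 1) = w2 y + 2 * 2"
    using periodic_majorant[OF perm, of "\<lambda>y. 2 * y" 2] m_lip by auto
  define w where "w = (\<lambda>y. w1 (x1 + y) + \<bar>c1\<bar> * w2 y)"
  have w: "\<bar>u z - u y\<bar> \<le> w z - w y" if "y \<le> z" for y z
  proof -
    have "u z - u y = (t (x1 + z) - t (x1 + y)) - c1 * (m z - m y)" by (simp add: u_def algebra_simps)
    then have "\<bar>u z - u y\<bar> \<le> \<bar>t (x1 + z) - t (x1 + y)\<bar> + \<bar>c1\<bar> * \<bar>m z - m y\<bar>"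
      by (metis abs_mult abs_triangle_ineq4)
    also have "\<dots> \<le> (w1 (x1 + z) - w1 (x1 + y)) + \<bar>c1\<bar> * (w2 z - w2 y)"
      using that by (intro add_mono mult_left_mono w1 w2) auto
    finally show ?thesis by (simp add: w_def algebra_simps)
  qed
  have ww: "w (y + 1) = w y + (2 * V1 + \<bar>c1\<bar> * 4)" for y
    using w1(2)[of "x1 + y"] w2(2)[of y] by (simp add: w_def algebra_simps)
  have "(f has_integral 0) {x1..x1 + 1}" by (rule has_integral_period[OF perf intf])
  then have "((\<lambda>y. f (y + x1)) has_integral 0) {x1 - x1..x1 + 1 - x1}" by (rule has_integral_shift_real_ivl)
  then have ih: "(h has_integral 0) {0..1}" by (simp add: h_def add.commute)
  have perl: "one_periodic (\<lambda>y::real. ln (frac y))" by (simp add: one_periodic_def frac_1_eq)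
  have "((\<lambda>y::real. ln (frac y)) has_integral - 1) {- 1..- 1 + 1}"
    by (rule has_integral_period[OF perl ln_frac_has_integral])
  then have "((\<lambda>y::real. ln (frac (- y))) has_integral - 1) {- 0..- (- 1)}"
    by (subst has_integral_reflect_real) simp
  then have il: "((\<lambda>y::real. ln (frac (- y))) has_integral - 1) {0..1}" by simp
  have "((\<lambda>y. h y - (c1 + c2) * ln (frac y) - c1 * ln (frac (- y))) has_integral (0 - (c1 + c2) * (- 1) - c1 * (- 1))) {0..1}"
    by (intro has_integral_diff has_integral_mult_right ih il ln_frac_has_integral)
  then have iu: "(u has_integral (0 - (c1 + c2) * (- 1) - c1 * (- 1))) {0..1}"
  proof (rule has_integral_spike_finite[rotated -1])
    show "finite {0, 1 :: real}" by simp
    fix y :: real assume "y \<in> {0..1} - {0, 1}"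
    then have "frac y = y" "y \<noteq> 0" unfolding frac_eq by simp_all
    then have "y \<notin> \<int>" using frac_eq_0_iff[of y] by simp
    then show "u y = h y - (c1 + c2) * ln (frac y) - c1 * ln (frac (- y))"
      using hu[of y] by (simp add: frac_neg)
  qed
  have "bv_by u (2 * V1 + \<bar>c1\<bar> * 4)"
    unfolding bv_by_def using \<open>one_periodic u\<close> w ww iu by blast
  moreover have "integral {0..1} u = (c1 + c2) + c1" using integral_unique[OF iu] by simp
  ultimately have "log_form h (c1 + c2) c1 u (2 * V1 + \<bar>c1\<bar> * 4)"
    using hu by (simp add: log_form_def)
  then show ?thesis using that unfolding h_def by blast
qed

lemma bv_by_bounded:
  assumes "bv_by u W"
  shows "\<bar>u y\<bar> \<le> \<bar>u 0\<bar> + W"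
proof -
  obtain w where w: "\<And>y z. y \<le> z \<Longrightarrow> \<bar>u z - u y\<bar> \<le> w z - w y" "\<And>y. w (y + 1) = w y + W"
    using assms by (auto simp: bv_by_def)
  have f: "0 \<le> frac y" "frac y \<le> 1" using frac_lt_1[of y] by (auto simp: less_imp_le)
  have "\<bar>u (frac y) - u 0\<bar> \<le> w (frac y) - w 0" "0 \<le> w 1 - w (frac y)"
    using w(1)[OF f(1)] w(1)[OF f(2)] by auto
  moreover have "w 1 = w 0 + W" using w(2)[of 0] by simp
  moreover have "u (frac y) = u y" using assms by (intro periodic_frac) (simp add: bv_by_def)
  ultimately show ?thesis by linarith
qed

section \<open>The index \<open>K(N)\<close> and upper density from windows\<close>

lemma cf_K_eq:
  assumes x: "x \<in> Irr" and N: "den (cf_digit x) k \<le> N" "N < den (cf_digit x) (Suc k)"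
  shows "cf_K x N = Suc k"
  unfolding cf_K_def
proof (rule the_equality)
  show "1 \<le> Suc k \<and> cf_denom x (Suc k - 1) \<le> N \<and> N < cf_denom x (Suc k)"
    using N unfolding cf_denom_eq_den by (simp del: cpair.simps)
  have mono: "den (cf_digit x) i \<le> den (cf_digit x) j" if "i \<le> j" for i j
    by (rule lift_Suc_mono_le[of "\<lambda>n. den (cf_digit x) n", OF den_Suc_ge(1)[OF x] that])
  fix K assume K: "1 \<le> K \<and> cf_denom x (K - 1) \<le> N \<and> N < cf_denom x K"
  then have K': "den (cf_digit x) (K - 1) \<le> N" "N < den (cf_digit x) K" by (auto simp: cf_denom_eq_den)
  have "\<not> K \<le> k" using mono[of K k] K'(2) N(1) by linarith
  moreover have "\<not> Suc k \<le> K - 1" using mono[of "Suc k" "K - 1"] K'(1) N(2) by linarith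
  ultimately show "K = Suc k" using K by linarith
qed

text \<open>A window from \<open>(1 - r) * M\<close> to \<open>M\<close> contains at least
  \<open>r * M\<close> integers, both ends counted, and arbitrarily large windows suffice for a
  limsup.\<close>

lemma upper_density_ge:
  assumes r: "0 < r" "r < 1"
    and M: "\<And>n. \<exists>M\<ge>n. \<forall>N. (1 - r) * real M \<le> real N \<longrightarrow> N \<le> M \<longrightarrow> N \<in> X"
  shows "ereal r \<le> upper_density X"
proof (rule ccontr)
  assume "\<not> ereal r \<le> upper_density X"
  then have "limsup (\<lambda>M. ereal (real (card {N \<in> X. 1 \<le> N \<and> N \<le> M}) / real M)) < ereal r"
    by (simp add: upper_density_def)
  then have "\<forall>\<^sub>F M in sequentially. ereal (real (card {N \<in> X. 1 \<le> N \<and> N \<le> M}) / real M) < ereal r"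
    by (rule Limsup_lessD)
  then obtain n where n: "\<And>M. n \<le> M \<Longrightarrow> real (card {N \<in> X. 1 \<le> N \<and> N \<le> M}) / real M < r"
    by (auto simp: eventually_sequentially)
  obtain M where M': "Suc n \<le> M" "\<And>N. (1 - r) * real M \<le> real N \<Longrightarrow> N \<le> M \<Longrightarrow> N \<in> X"
    using M[of "Suc n"] by blast
  define N0 where "N0 = nat \<lceil>(1 - r) * real M\<rceil>"
  have Mp: "0 < real M" using M'(1) by simp
  have pos: "0 < (1 - r) * real M" using r Mp by simp
  have N0: "(1 - r) * real M \<le> real N0" "real N0 < (1 - r) * real M + 1"
    using pos unfolding N0_def by linarith+
  have "(1 - r) * real M \<le> 1 * real M" using r Mp by (intro mult_right_mono) auto
  then have N0M: "N0 \<le> M" unfolding N0_def by linarith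
  have "1 \<le> N0" using N0(1) pos by linarith
  then have "{N0..M} \<subseteq> {N \<in> X. 1 \<le> N \<and> N \<le> M}"
    using M'(2) N0(1) by (auto intro: order_trans[OF N0(1)])
  then have "card {N0..M} \<le> card {N \<in> X. 1 \<le> N \<and> N \<le> M}" by (intro card_mono) auto
  then have "real (M + 1 - N0) \<le> real (card {N \<in> X. 1 \<le> N \<and> N \<le> M})" by simp
  moreover have "r * real M \<le> real (M + 1 - N0)" using N0(2) N0M by (simp add: of_nat_diff algebra_simps)
  ultimately have "r \<le> real (card {N \<in> X. 1 \<le> N \<and> N \<le> M}) / real M"
    using Mp by (simp add: field_simps)
  then show False using n[of M] M'(1) by simp
qed

section \<open>The final estimate\<close>

lemma dist_int_le_half: "dist_int x \<le> 1 / 2"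
  by (auto simp: dist_int_def min_def)

text \<open>The minimal distance is attained by an orbit point, which lies on the boundary of the
  open arc and hence outside it. Bounding the supremum needs this nonemptiness.\<close>

lemma outside_A_nonempty:
  assumes "g = dist_int (z - x1)"
  shows "outside_A x1 g \<noteq> {}"
proof -
  have "frac (frac z - x1) = frac (z - x1)"
    using periodic_add_int[of frac "z - x1" "- \<lfloor>z\<rfloor>"]
    by (simp add: one_periodic_def frac_1_eq frac_def[of z] algebra_simps)
  then have "dist_int (frac z - x1) = g" by (simp add: assms dist_int_def)
  then have "frac z \<in> outside_A x1 g" by (simp add: outside_A_def frac_lt_1)
  then show ?thesis by blast
qed

text \<open>The main term is \<open>J * \<delta> / 2 * ln Q\<close>. Half of it absorbs the errors
  of the block decomposition, and the other half is shared equally between the supremum term and the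
  integral term. \<open>L1\<close> secures enough full blocks, \<open>L2\<close> makes the two short
  blocks small, and \<open>L3\<close> makes the integral term small. \<open>C1\<close> is chosen so
  that \<open>C1 * ln Q\<close> bounds both the supremum and \<open>N\<close> times the
  integral.\<close>

lemma good_index_estimate:
  fixes f h u :: "real \<Rightarrow> real" and d k L N :: nat and P :: int and A B T W x x1 q0 r \<epsilon> :: real
  assumes lf: "log_form h A B u W" and T: "\<And>y. \<bar>u y\<bar> \<le> T" and f: "\<And>x. f x = h (x - x1)"
    and If: "integral {0..1} f = 0"
    and x: "x \<in> Irr" and \<beta>: "q0 - x1 = real_of_int P / real d" and d: "1 \<le> d"
    and r: "0 < r" "r < 1" and \<epsilon>: "0 < \<epsilon>" "\<epsilon> \<le> 1 / 2"
  defines "D \<equiv> \<bar>A\<bar> + \<bar>B\<bar>" and "\<delta> \<equiv> \<bar>B - A\<bar>"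
  defines "\<kappa> \<equiv> (1 - r) * \<epsilon> / 2" and "C1 \<equiv> 9 * D + T + 1"
  defines "Q \<equiv> den (cf_digit x) k" and "a \<equiv> cf_digit x (Suc k)"
  defines "M \<equiv> nat \<lfloor>\<epsilon> * real a * real Q\<rfloor>"
  assumes \<delta>: "0 < \<delta>" and \<epsilon>D: "2 * \<epsilon> * D \<le> \<delta> / 8"
    and k: "1 \<le> k" and dQ: "d dvd Q" and aL: "L * digit_sum x k \<le> a" and aup: "a \<le> (Suc k)\<^sup>2"
    and L1: "3 / \<kappa> \<le> real L" and L2: "32 * (16 * D + W) / (\<kappa> * \<delta>) \<le> real L" and L3: "8 * C1 / (\<kappa> * \<delta>) \<le> real L"
    and lnQ: "1 \<le> ln (real Q)"
    and E0: "D * (3 + 2 * \<epsilon> + ln (4 / \<kappa>)) + W + 2 * \<bar>A + B\<bar> \<le> \<delta> / 16 * ln (real Q)"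
    and N: "(1 - r) * real M \<le> real N" "N \<le> M"
  shows "\<kappa> * \<delta> / (16 * C1) * (SUP x\<in>outside_A x1 (gmin x q0 x1 N). \<bar>f x\<bar>) * real (\<Sum>i = 1..cf_K x N. cf_digit x i)
      + real N * \<bar>integral {x1 - gmin x q0 x1 N<..<x1 + gmin x q0 x1 N} f\<bar>
    \<le> (- 1) ^ k * sgn (B - A) * S_N f x q0 N" and "k \<le> M"
proof -
  define l where "l = ln (real Q)"
  have l: "1 \<le> l" using lnQ by (simp add: l_def)
  have bv: "bv_by u W" using lf by (simp add: log_form_def)
  have W: "0 \<le> W" using bv_by_nonneg[OF bv] .
  have D: "0 \<le> D" by (simp add: D_def)
  have T0: "0 \<le> T" using T[of 0] by linarith
  have C1: "1 \<le> C1" using D T0 by (simp add: C1_def)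
  have \<kappa>: "0 < \<kappa>" using r \<epsilon> by (simp add: \<kappa>_def)
  have Q1: "1 \<le> Q" using den_Suc_ge(2)[OF x] by (simp add: Q_def)
  have kQ: "k \<le> Q" unfolding Q_def using cf_digit_pos[OF x] by (intro den_ge) auto
  have L0: "1 \<le> L"
  proof -
    have "0 < 3 / \<kappa>" using \<kappa> by simp
    then have "0 < real L" using L1 by linarith
    then show ?thesis by simp
  qed
  have La: "real L \<le> real a"
  proof -
    have "1 \<le> digit_sum x k" using digit_sum_pos[OF x k] k by linarith
    then have "L * 1 \<le> L * digit_sum x k" by (intro mult_left_mono) auto
    then show ?thesis using aL by linarith
  qed
  have a1: "1 \<le> real a" using La L0 by linarith
  define S where "S = real (digit_sum x k)"
  have S0: "0 \<le> S" by (simp add: S_def)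
  have LS: "real L * S \<le> real a"
  proof -
    have "real (L * digit_sum x k) \<le> real a" using aL by (simp only: of_nat_le_iff)
    then show ?thesis by (simp add: S_def)
  qed
  have S_le: "S \<le> real a"
    using LS mult_right_mono[of 1 "real L" S] L0 S0 by simp
  define p where "p = int (num (cf_digit x) k)"
  define \<theta> where "\<theta> = x - real_of_int p / real Q"
  have \<theta>': "\<theta> = x - real (num (cf_digit x) k) / real (den (cf_digit x) k)" by (simp add: \<theta>_def p_def Q_def)
  note ce = convergent_error[OF x, of k, folded \<theta>' Q_def a_def]
  have cop: "coprime p (int Q)" unfolding p_def Q_def by (rule coprime_num_den)
  have \<theta>0: "0 < \<bar>\<theta>\<bar>"
  proof -
    have "0 < 1 / (4 * real a * (real Q)\<^sup>2)" using a1 Q1 by simp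
    then show ?thesis using ce(3) by linarith
  qed
  have \<alpha>: "x = real_of_int p / real Q + \<theta>" by (simp add: \<theta>_def)
  define s where "s = P * int (Q div d)"
  have \<beta>s: "q0 - x1 = real_of_int s / real Q"
  proof -
    have "real Q = real (Q div d) * real d" using dQ by (metis dvd_div_mult_self of_nat_mult)
    moreover have "0 < Q div d" using dQ Q1 d by (simp add: dvd_imp_le div_greater_zero_iff)
    ultimately show ?thesis using \<beta> d by (simp add: s_def)
  qed
  have M0: "0 \<le> \<epsilon> * real a * real Q" using \<epsilon> by simp
  have M_le: "real M \<le> \<epsilon> * real a * real Q" "\<epsilon> * real a * real Q - 1 \<le> real M"
    using M0 unfolding M_def by linarith+
  have NM: "real N \<le> \<epsilon> * real a * real Q" using N(2) M_le(1) by linarith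
  have small: "real N * \<bar>\<theta>\<bar> \<le> \<epsilon> / real Q"
  proof -
    have "real N * \<bar>\<theta>\<bar> \<le> (\<epsilon> * real a * real Q) * (1 / (real a * (real Q)\<^sup>2))"
      using NM ce(2) M0 by (intro mult_mono) auto
    also have "\<dots> = \<epsilon> / real Q" using a1 Q1 by (simp add: power2_eq_square)
    finally show ?thesis .
  qed
  \<comment> \<open>Room for rounding: the number of middle blocks is at least
    \<open>2 * \<kappa> * a - 3\<close>, which is now at least \<open>\<kappa> * a\<close>.\<close>
  have \<kappa>a: "3 \<le> \<kappa> * real a"
  proof -
    have "3 / \<kappa> \<le> real a" using L1 La by linarith
    then show ?thesis using \<kappa> by (simp add: field_simps)
  qed
  have N_lo: "2 * \<kappa> * real a * real Q - 1 \<le> real N"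
  proof -
    define X where "X = \<epsilon> * real a * real Q"
    have "2 * \<kappa> * real a * real Q = (1 - r) * X" by (simp add: \<kappa>_def X_def)
    then have "2 * \<kappa> * real a * real Q - 1 \<le> (1 - r) * (\<epsilon> * real a * real Q - 1)"
      using r unfolding X_def[symmetric] by (simp add: right_diff_distrib)
    also have "\<dots> \<le> (1 - r) * real M" using r M_le by (intro mult_left_mono) auto
    finally show ?thesis using N(1) by linarith
  qed
  define J where "J = N div Q - 1"
  define \<rho> where "\<rho> = N mod Q"
  have \<rho>: "\<rho> < Q" using Q1 by (simp add: \<rho>_def)
  have divQ: "2 * \<kappa> * real a - 2 \<le> real (N div Q)"
  proof -
    have "real N = real (N div Q) * real Q + real \<rho>"
      by (metis \<rho>_def div_mult_mod_eq of_nat_add of_nat_mult)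
    moreover have "real \<rho> \<le> real Q - 1" using \<rho> by linarith
    ultimately have "(2 * \<kappa> * real a - 1) * real Q \<le> real (N div Q) * real Q"
      using N_lo by (simp add: algebra_simps)
    then have "2 * \<kappa> * real a - 1 \<le> real (N div Q)" using Q1 by (simp add: mult_le_cancel_right)
    then show ?thesis by linarith
  qed
  have div_ge: "4 \<le> real (N div Q)" using divQ \<kappa>a by linarith
  then have Jr: "real J = real (N div Q) - 1" unfolding J_def by linarith
  have J\<kappa>: "\<kappa> * real a \<le> real J" using divQ \<kappa>a unfolding Jr by linarith
  have J1: "1 \<le> J" using J\<kappa> \<kappa>a by linarith
  have NJ: "N = (J + 1) * Q + \<rho>"
  proof -
    have "J + 1 = N div Q" using J1 by (simp add: J_def)
    then show ?thesis by (simp add: \<rho>_def)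
  qed
  have QN: "Q \<le> N" unfolding NJ by simp
  then show "k \<le> M" using kQ N(2) by linarith
  \<comment> \<open>The quadratic digit bound enters here:
    \<open>a \<le> (Suc k)\<^sup>2 \<le> (2 * Q)\<^sup>2\<close> makes the argument at most
    \<open>(2 * Q) ^ 4\<close>.\<close>
  have lnaQ: "ln (4 * real a * (real Q)\<^sup>2) \<le> 8 * l"
  proof -
    have "a \<le> (2 * Q)\<^sup>2"
    proof -
      have "Suc k \<le> 2 * Q" using kQ Q1 by simp
      then have "(Suc k)\<^sup>2 \<le> (2 * Q)\<^sup>2" by (rule power_mono) simp
      then show ?thesis using aup by linarith
    qed
    then have "real a \<le> real ((2 * Q)\<^sup>2)" by (simp only: of_nat_le_iff)
    then have "real a \<le> 4 * (real Q)\<^sup>2" by (simp add: power_mult_distrib)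
    then have "4 * real a * (real Q)\<^sup>2 \<le> 4 * (4 * (real Q)\<^sup>2) * (real Q)\<^sup>2" by (intro mult_right_mono mult_left_mono) auto
    also have "\<dots> = (2 * real Q) ^ 4" by (simp add: power4_eq_xxxx power2_eq_square)
    finally have "ln (4 * real a * (real Q)\<^sup>2) \<le> ln ((2 * real Q) ^ 4)"
      using a1 Q1 by (intro ln_mono) auto
    also have "\<dots> = 4 * ln (2 * real Q)" using Q1 by (subst ln_realpow) auto
    also have "\<dots> = 4 * (ln 2 + l)" using Q1 by (simp add: ln_mult l_def)
    finally have b: "ln (4 * real a * (real Q)\<^sup>2) \<le> 4 * (ln 2 + l)" .
    have "ln 2 \<le> (1 :: real)" using ln_le_minus_one[of "2 :: real"] by simp
    then have "4 * (ln 2 + l) \<le> 8 * l" using l by simp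
    then show ?thesis using b by (rule order_trans[rotated])
  qed
  define Err where "Err = real J * (D * (3 + 2 * \<epsilon> * (1 + l) + ln (4 / \<kappa>)) + W)
      + 2 * (S * (D * (2 * ln (4 * real a * (real Q)\<^sup>2)) + W) + \<bar>A + B\<bar>)"
  have main: "\<bar>(\<Sum>n = 1..N. h ((q0 - x1) + real n * x)) - sgn \<theta> * (real J * ((B - A) / 2 * l))\<bar> \<le> Err"
    unfolding Err_def l_def D_def S_def
    by (rule orbit_sum_signed[OF lf _ Q1 cop _ \<alpha> \<beta>s \<epsilon> NJ \<rho> small _ ce(3) J1 J\<kappa> \<kappa>])
      (use \<theta>0 a1 orbit_bound_cf[OF x k] in \<open>auto simp: Q_def\<close>)
  \<comment> \<open>The allowance of \<open>\<delta> / 4\<close> splits into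
    \<open>\<delta> / 16\<close> for the constants in \<open>E0\<close>, \<open>\<delta> / 8\<close>
    for the terms with \<epsilon>, and \<open>\<delta> / 16\<close> for the two short
    blocks.\<close>
  have Err_le: "Err \<le> real J * (\<delta> / 4 * l)"
  proof -
    define c where "c = (16 * D + W) * l"
    have c0: "0 \<le> c" using D W l by (simp add: c_def)
    have "D * (2 * ln (4 * real a * (real Q)\<^sup>2)) + W \<le> D * (2 * (8 * l)) + W * l"
      using lnaQ D W l mult_left_mono[of 1 l W] by (intro add_mono mult_left_mono) auto
    also have "\<dots> = c" by (simp add: c_def algebra_simps)
    finally have "S * (D * (2 * ln (4 * real a * (real Q)\<^sup>2)) + W) \<le> S * c"
      using S0 by (intro mult_left_mono) auto
    moreover have "S * c \<le> real J * (\<delta> / 32 * l)"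
    proof -
      have "32 * (16 * D + W) \<le> real L * (\<kappa> * \<delta>)" using L2 \<kappa> \<delta> by (simp add: field_simps)
      then have "32 * c \<le> real L * (\<kappa> * \<delta>) * l"
        using l mult_right_mono[of "32 * (16 * D + W)" "real L * (\<kappa> * \<delta>)" l] by (simp add: c_def mult.assoc)
      then have "S * (32 * c) \<le> S * (real L * (\<kappa> * \<delta>) * l)" using S0 by (intro mult_left_mono) auto
      also have "\<dots> = (real L * S) * (\<kappa> * \<delta> * l)" by (simp add: mult_ac)
      also have "\<dots> \<le> real a * (\<kappa> * \<delta> * l)" using LS \<kappa> \<delta> l by (intro mult_right_mono) auto
      also have "\<dots> = (\<kappa> * real a) * (\<delta> * l)" by (simp add: mult_ac)
      also have "\<dots> \<le> real J * (\<delta> * l)" using J\<kappa> \<delta> l by (intro mult_right_mono) auto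
      finally show ?thesis by simp
    qed
    moreover have "2 * \<bar>A + B\<bar> \<le> real J * (2 * \<bar>A + B\<bar>)"
      using J1 mult_right_mono[of 1 "real J" "2 * \<bar>A + B\<bar>"] by simp
    moreover have "t1 + 2 * (t2 + t3) \<le> t1 + 2 * b2 + b3"
      if "t2 \<le> b" "b \<le> b2" "2 * t3 \<le> b3" for t1 t2 t3 b b2 b3 :: real
      unfolding distrib_left using that by linarith
    ultimately have "Err \<le> real J * (D * (3 + 2 * \<epsilon> * (1 + l) + ln (4 / \<kappa>)) + W)
       + 2 * (real J * (\<delta> / 32 * l)) + real J * (2 * \<bar>A + B\<bar>)"
      unfolding Err_def by blast
    also have "\<dots> = real J * ((D * (3 + 2 * \<epsilon> + ln (4 / \<kappa>)) + W + 2 * \<bar>A + B\<bar>) + (2 * \<epsilon> * D) * l + \<delta> / 16 * l)"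
      by (simp add: algebra_simps)
    also have "\<dots> \<le> real J * (\<delta> / 16 * l + (\<delta> / 8) * l + \<delta> / 16 * l)"
      using E0 \<epsilon>D l by (intro mult_left_mono add_mono mult_right_mono) (auto simp: l_def)
    finally show ?thesis by (simp add: algebra_simps)
  qed
  have Seq: "S_N f x q0 N = (\<Sum>n = 1..N. h ((q0 - x1) + real n * x))"
    unfolding S_N_def If by (simp add: f algebra_simps)
  \<comment> \<open>The product of the side of the push, \<open>sgn \<theta> = (- 1) ^ k\<close>,
    and the sign of the asymmetry, so that \<sigma> times the main term is positive.\<close>
  define \<sigma> where "\<sigma> = (- 1) ^ k * sgn (B - A)"
  have \<sigma>abs: "\<bar>\<sigma>\<bar> = 1" using \<delta> by (simp add: \<sigma>_def \<delta>_def abs_mult power_abs abs_sgn_eq)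
  have low: "real J * (\<delta> / 4 * l) \<le> \<sigma> * S_N f x q0 N"
  proof -
    define m where "m = sgn \<theta> * (real J * ((B - A) / 2 * l))"
    have "\<sigma> * m = ((- 1) ^ k * (- 1) ^ k) * (real J * ((sgn (B - A) * (B - A)) / 2 * l))"
      by (simp add: \<sigma>_def m_def ce(1) mult_ac)
    also have "(- 1) ^ k * (- 1) ^ k = (1::real)" by (simp flip: power_mult_distrib)
    also have "sgn (B - A) * (B - A) = \<delta>" by (simp add: \<delta>_def sgn_mult_self_eq abs_sgn mult.commute)
    finally have \<sigma>m: "\<sigma> * m = real J * (\<delta> / 2 * l)" by simp
    have "\<bar>\<sigma> * (S_N f x q0 N - m)\<bar> \<le> real J * (\<delta> / 4 * l)"
      using main Err_le by (simp add: abs_mult \<sigma>abs Seq m_def)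
    then have "\<sigma> * m - real J * (\<delta> / 4 * l) \<le> \<sigma> * S_N f x q0 N"
      unfolding right_diff_distrib abs_le_iff by linarith
    moreover have "real J * (\<delta> / 2 * l) - real J * (\<delta> / 4 * l) = real J * (\<delta> / 4 * l)" by (simp add: algebra_simps)
    ultimately show ?thesis unfolding \<sigma>m by linarith
  qed
  define g where "g = gmin x q0 x1 N"
  have small': "real N * \<bar>\<theta>\<bar> \<le> (1 / 2) / real Q"
  proof -
    have "\<epsilon> / real Q \<le> (1 / 2) / real Q" using \<epsilon> by (intro divide_right_mono) auto
    then show ?thesis using small by linarith
  qed
  have gb: "\<bar>\<theta>\<bar> \<le> g" "g \<le> real Q * \<bar>\<theta>\<bar>" "\<exists>n\<in>{1..N}. g = dist_int (real n * x + q0 - x1)"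
    unfolding g_def using \<theta>0 by (intro gmin_bounds[OF Q1 cop _ \<alpha> \<beta>s QN small']; simp)+
  have g0: "0 < g" using gb(1) \<theta>0 by linarith
  have ghalf: "g \<le> 1 / 2" using gb(3) dist_int_le_half by auto
  have ne: "outside_A x1 g \<noteq> {}"
    using gb(3) outside_A_nonempty by blast
  have lng: "- ln g \<le> 8 * l"
  proof -
    have pos: "0 < 4 * real a * (real Q)\<^sup>2" using a1 Q1 by simp
    have "1 / (4 * real a * (real Q)\<^sup>2) \<le> g" using ce(3) gb(1) by linarith
    then have "ln (1 / (4 * real a * (real Q)\<^sup>2)) \<le> ln g" using pos by (intro ln_mono) auto
    moreover have "ln (1 / z) = - ln z" if "0 < z" for z :: real using that by (simp add: ln_div)
    ultimately have "- ln g \<le> ln (4 * real a * (real Q)\<^sup>2)" using pos by fastforce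
    then show ?thesis using lnaQ by linarith
  qed
  define Sup' where "Sup' = (SUP x\<in>outside_A x1 g. \<bar>f x\<bar>)"
  have Sup_le: "Sup' \<le> C1 * l"
  proof -
    have "Sup' \<le> D * (- ln g) + T"
      unfolding Sup'_def D_def by (rule SUP_outside_le[OF lf T f g0 ne])
    also have "\<dots> \<le> D * (8 * l) + T * l"
      using lng D T0 l mult_left_mono[of 1 l T] by (intro add_mono mult_left_mono) auto
    also have "\<dots> \<le> C1 * l" using D l by (simp add: C1_def algebra_simps)
    finally show ?thesis .
  qed
  have int_le: "real N * \<bar>integral {x1 - g<..<x1 + g} f\<bar> \<le> C1 * l"
  proof -
    \<comment> \<open>The nearest point is at distance at most
      \<open>Q * \<bar>\<theta>\<bar>\<close>, so the factor \<open>N\<close> is compensated by the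
      length of the arc and only the logarithm of \<open>g\<close> remains.\<close>
    have Ng: "real N * g \<le> 1 / 2"
    proof -
      have "real N * g \<le> real N * (real Q * \<bar>\<theta>\<bar>)" using gb(2) by (intro mult_left_mono) auto
      also have "\<dots> = real Q * (real N * \<bar>\<theta>\<bar>)" by simp
      also have "\<dots> \<le> real Q * ((1 / 2) / real Q)" using small' by (intro mult_left_mono) auto
      also have "\<dots> = 1 / 2" using Q1 by simp
      finally show ?thesis .
    qed
    have nn: "0 \<le> D * (1 - ln g) + T"
    proof -
      have "ln g \<le> ln 1" using g0 ghalf by (intro ln_mono) auto
      then have "0 \<le> 1 - ln g" by simp
      then show ?thesis using D T0 by (intro add_nonneg_nonneg mult_nonneg_nonneg)
    qed
    have "real N * \<bar>integral {x1 - g<..<x1 + g} f\<bar> \<le> real N * (2 * g * (D * (1 - ln g) + T))"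
      unfolding D_def by (intro mult_left_mono integral_near_singularity_le[OF lf T f g0 ghalf]) auto
    also have "\<dots> = 2 * (real N * g) * (D * (1 - ln g) + T)" by simp
    also have "\<dots> \<le> 1 * (D * (1 - ln g) + T)" using Ng nn by (intro mult_right_mono) auto
    also have "\<dots> \<le> D * (l + 8 * l) + T * l"
    proof -
      have "1 - ln g \<le> l + 8 * l" using lng l by linarith
      then have "D * (1 - ln g) \<le> D * (l + 8 * l)" using D by (rule mult_left_mono)
      moreover have "T \<le> T * l" using mult_left_mono[of 1 l T] T0 l by simp
      ultimately show ?thesis unfolding mult_1 by (rule add_mono)
    qed
    also have "\<dots> \<le> C1 * l" using l by (simp add: C1_def algebra_simps)
    finally show ?thesis .
  qed
  \<comment> \<open>As \<open>\<epsilon> \<le> 1 / 2\<close>, \<open>N\<close> stays below the next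
    denominator. The digit sum on the right therefore ends with the dominating digit
    \<open>a\<close>, and the earlier digits add at most another \<open>a\<close>.\<close>
  have "cf_K x N = Suc k"
  proof (rule cf_K_eq[OF x])
    show "den (cf_digit x) k \<le> N" using QN by (simp add: Q_def)
    have "real N \<le> (1 / 2) * (real a * real Q)" using NM mult_right_mono[OF \<epsilon>(2), of "real a * real Q"] by (simp add: mult.assoc)
    moreover have "0 < real a * real Q" using a1 Q1 by simp
    ultimately have "real N < real (a * Q)" by simp
    then have "N < a * Q" by (simp only: of_nat_less_iff)
    then show "N < den (cf_digit x) (Suc k)" by (simp add: a_def Q_def)
  qed
  then have dig: "real (\<Sum>i = 1..cf_K x N. cf_digit x i) \<le> 2 * real a"
    using S_le by (simp add: S_def digit_sum_def a_def)
  \<comment> \<open>In the constant, \<open>C1\<close> cancels the bound for the supremum, a factor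
    2 the bound \<open>2 * a\<close> for the digits, and the remaining 8 leaves the share
    \<open>\<delta> / 8\<close>.\<close>
  have "\<kappa> * \<delta> / (16 * C1) * Sup' * real (\<Sum>i = 1..cf_K x N. cf_digit x i)
      \<le> \<kappa> * \<delta> / (16 * C1) * (C1 * l) * real (\<Sum>i = 1..cf_K x N. cf_digit x i)"
    using Sup_le \<kappa> \<delta> C1 by (intro mult_right_mono mult_left_mono of_nat_0_le_iff) auto
  also have "\<dots> \<le> \<kappa> * \<delta> / (16 * C1) * (C1 * l) * (2 * real a)"
    using dig \<kappa> \<delta> C1 l by (intro mult_left_mono) auto
  also have "\<dots> = (\<kappa> * real a) * (\<delta> / 8 * l)" using C1 by simp
  also have "\<dots> \<le> real J * (\<delta> / 8 * l)" using J\<kappa> \<delta> l by (intro mult_right_mono) auto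
  finally have part1: "\<kappa> * \<delta> / (16 * C1) * Sup' * real (\<Sum>i = 1..cf_K x N. cf_digit x i) \<le> real J * (\<delta> / 8 * l)" .
  have "8 * C1 \<le> real a * (\<kappa> * \<delta>)"
  proof -
    have "8 * C1 / (\<kappa> * \<delta>) \<le> real a" using L3 La by linarith
    then show ?thesis using \<kappa> \<delta> by (simp add: field_simps)
  qed
  also have "\<dots> = (\<kappa> * real a) * \<delta>" by simp
  also have "\<dots> \<le> real J * \<delta>" using J\<kappa> \<delta> by (intro mult_right_mono) auto
  finally have "C1 \<le> real J * (\<delta> / 8)" by simp
  then have "C1 * l \<le> real J * (\<delta> / 8) * l" using l by (intro mult_right_mono) auto
  then have part2: "real N * \<bar>integral {x1 - g<..<x1 + g} f\<bar> \<le> real J * (\<delta> / 8 * l)"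
    using int_le by (simp add: mult.assoc)
  have "real J * (\<delta> / 8 * l) + real J * (\<delta> / 8 * l) = real J * (\<delta> / 4 * l)" by (simp add: algebra_simps)
  then show "\<kappa> * \<delta> / (16 * C1) * (SUP x\<in>outside_A x1 (gmin x q0 x1 N). \<bar>f x\<bar>) * real (\<Sum>i = 1..cf_K x N. cf_digit x i)
      + real N * \<bar>integral {x1 - gmin x q0 x1 N<..<x1 + gmin x q0 x1 N} f\<bar>
    \<le> (- 1) ^ k * sgn (B - A) * S_N f x q0 N"
    using part1 part2 low unfolding Sup'_def g_def \<sigma>_def by linarith
qed


theorem theorem1p7:
  fixes f :: "real \<Rightarrow> real" and x1 q :: real
  assumes "asym_log_sing f x1" and "q \<in> \<rat>"
  shows "\<exists>C :: real \<Rightarrow> real. (\<forall>r. 0 < r \<and> r < 1 \<longrightarrow> C r > 0) \<and>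
    (AE \<alpha> in lborel. \<alpha> \<in> {0..<1} \<and> \<alpha> \<notin> \<rat> \<longrightarrow>
      (\<forall>r. 0 < r \<and> r < 1 \<longrightarrow>
        upper_density {N. S_N f \<alpha> q N \<ge>
            C r * (SUP x\<in>outside_A x1 (gmin \<alpha> q x1 N). \<bar>f x\<bar>)
                * real (\<Sum>i=1..cf_K \<alpha> N. cf_digit \<alpha> i)
            + real N * \<bar>integral {x1 - gmin \<alpha> q x1 N <..< x1 + gmin \<alpha> q x1 N} f\<bar>} \<ge> ereal r
      \<and> upper_density {N. S_N f \<alpha> q N \<le>
            - C r * (SUP x\<in>outside_A x1 (gmin \<alpha> q x1 N). \<bar>f x\<bar>)
                * real (\<Sum>i=1..cf_K \<alpha> N. cf_digit \<alpha> i)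
            - real N * \<bar>integral {x1 - gmin \<alpha> q x1 N <..< x1 + gmin \<alpha> q x1 N} f\<bar>} \<ge> ereal r))"
proof -
  obtain c1 c2 where c2: "c2 \<noteq> 0" and sing: "smooth_log_sing f x1 c1 c2"
    using assms(1) by (auto simp: asym_log_sing_def)
  define A where "A = c1 + c2"
  define B where "B = c1"
  define h where "h = (\<lambda>y. f (x1 + y))"
  obtain u W where lf: "log_form h A B u W"
    using log_form_of_singularity[OF sing] unfolding h_def A_def B_def by blast
  have f: "f x = h (x - x1)" for x by (simp add: h_def)
  have If: "integral {0..1} f = 0"
    using sing by (auto simp: smooth_log_sing_def intro: integral_unique)
  have "q - x1 \<in> \<rat>" using assms(2) sing by (auto simp: smooth_log_sing_def)
  then obtain P :: int and d :: nat where \<beta>: "q - x1 = real_of_int P / real d" and d: "1 \<le> d"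
    unfolding Rats_eq_int_div_nat by (auto simp: Suc_le_eq)
  define T where "T = \<bar>u 0\<bar> + W"
  have bv: "bv_by u W" using lf by (simp add: log_form_def)
  have T: "\<bar>u y\<bar> \<le> T" for y unfolding T_def by (rule bv_by_bounded[OF bv])
  define D where "D = \<bar>A\<bar> + \<bar>B\<bar>"
  \<comment> \<open>Here \<open>B - A = - c2\<close>, so asymmetry of the singularity is exactly the
    positivity of \<delta>.\<close>
  define \<delta> where "\<delta> = \<bar>B - A\<bar>"
  have D0: "0 \<le> D" and \<delta>0: "0 < \<delta>" using c2 by (auto simp: D_def \<delta>_def A_def B_def)
  \<comment> \<open>Small enough that the terms with \<epsilon> take at most a quarter of the main
    term, whose coefficient is \<open>\<delta> / 2\<close>.\<close>
  define \<epsilon> where "\<epsilon> = min (1 / 2) (\<delta> / (16 * (D + 1)))"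
  have \<epsilon>: "0 < \<epsilon>" "\<epsilon> \<le> 1 / 2"
    using \<delta>0 D0 min.cobounded1[of "1 / 2" "\<delta> / (16 * (D + 1))"] by (simp_all only: \<epsilon>_def) simp
  have \<epsilon>D: "2 * \<epsilon> * D \<le> \<delta> / 8"
  proof -
    have "\<epsilon> * (D + 1) \<le> \<delta> / (16 * (D + 1)) * (D + 1)"
      using D0 by (intro mult_right_mono) (auto simp: \<epsilon>_def)
    also have "\<dots> = \<delta> / 16" using D0 by (simp add: field_simps)
    finally have "\<epsilon> * D + \<epsilon> \<le> \<delta> / 16" by (simp add: distrib_left)
    then show ?thesis using \<epsilon>(1) by linarith
  qed
  define C1 where "C1 = 9 * D + T + 1"
  have C1: "0 < C1" using D0 T[of 0] by (simp add: C1_def)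
  define \<kappa> where "\<kappa> = (\<lambda>r. (1 - r) * \<epsilon> / 2)"
  \<comment> \<open>Fixed before \<alpha> is taken: only the data of \<open>f\<close> and
    \<open>r\<close> enter. It is proportional to \<open>1 - r\<close>, because the window starts at
    \<open>(1 - r) * M\<close>.\<close>
  define C where "C = (\<lambda>r. \<kappa> r * \<delta> / (16 * C1))"
  define rhs where "rhs = (\<lambda>r \<alpha> N. C r * (SUP x\<in>outside_A x1 (gmin \<alpha> q x1 N). \<bar>f x\<bar>)
                * real (\<Sum>i=1..cf_K \<alpha> N. cf_digit \<alpha> i)
            + real N * \<bar>integral {x1 - gmin \<alpha> q x1 N <..< x1 + gmin \<alpha> q x1 N} f\<bar>)"
  have \<kappa>: "0 < \<kappa> r" if "r < 1" for r using that \<epsilon> by (simp add: \<kappa>_def)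
  have Cpos: "0 < C r" if "r < 1" for r using \<kappa>[OF that] \<delta>0 C1 by (simp add: C_def)
  have windows: "\<exists>M\<ge>n. \<forall>N. (1 - r) * real M \<le> real N \<longrightarrow> N \<le> M \<longrightarrow> rhs r \<alpha> N \<le> (- 1) ^ e * sgn (B - A) * S_N f \<alpha> q N"
    if \<alpha>: "\<alpha> \<in> Irr" and r: "0 < r" "r < 1" and e: "e \<le> 1"
      and good: "\<forall>L n r. r \<le> 1 \<longrightarrow> (\<exists>k\<ge>n. k mod 2 = r \<and> d dvd den (cf_digit \<alpha>) k \<and> L * digit_sum \<alpha> k \<le> cf_digit \<alpha> (Suc k))"
      and digits: "\<forall>\<^sub>F k in sequentially. cf_digit \<alpha> (Suc k) \<le> (Suc k)\<^sup>2"
    for \<alpha> r e n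
  proof -
    obtain k0 where k0: "\<And>k. k0 \<le> k \<Longrightarrow> cf_digit \<alpha> (Suc k) \<le> (Suc k)\<^sup>2"
      using digits by (auto simp: eventually_sequentially)
    define E where "E = D * (3 + 2 * \<epsilon> + ln (4 / \<kappa> r)) + W + 2 * \<bar>A + B\<bar>"
    \<comment> \<open>From \<open>k1\<close> on \<open>ln q\<close> outgrows the constants collected
      in \<open>E\<close>, because the denominator of index \<open>k\<close> is at least
      \<open>k\<close>.\<close>
    obtain k1 :: nat where k1: "exp (max 1 (16 * E / \<delta>)) \<le> real k1" using real_arch_simple by blast
    define L where "L = nat \<lceil>max (3 / \<kappa> r) (max (32 * (16 * D + W) / (\<kappa> r * \<delta>)) (8 * C1 / (\<kappa> r * \<delta>)))\<rceil>"
    have "max (3 / \<kappa> r) (max (32 * (16 * D + W) / (\<kappa> r * \<delta>)) (8 * C1 / (\<kappa> r * \<delta>))) \<le> real L"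
      unfolding L_def by (rule real_nat_ceiling_ge)
    then have L: "3 / \<kappa> r \<le> real L" "32 * (16 * D + W) / (\<kappa> r * \<delta>) \<le> real L" "8 * C1 / (\<kappa> r * \<delta>) \<le> real L"
      by simp_all
    obtain k where k: "max n (max k0 (max k1 1)) \<le> k" "k mod 2 = e" "d dvd den (cf_digit \<alpha>) k"
        "L * digit_sum \<alpha> k \<le> cf_digit \<alpha> (Suc k)"
      using good e by blast
    have kge: "n \<le> k" "k0 \<le> k" "k1 \<le> k" "1 \<le> k" using k(1) by auto
    have kden: "k \<le> den (cf_digit \<alpha>) k" using cf_digit_pos[OF \<alpha>] by (intro den_ge) auto
    have lnQ: "max 1 (16 * E / \<delta>) \<le> ln (real (den (cf_digit \<alpha>) k))"
    proof -
      have "exp (max 1 (16 * E / \<delta>)) \<le> real (den (cf_digit \<alpha>) k)" using k1 kge(3) kden by linarith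
      moreover have "0 < real (den (cf_digit \<alpha>) k)" using kden kge(4) by linarith
      ultimately show ?thesis by (simp only: ln_ge_iff)
    qed
    have E_le: "E \<le> \<delta> / 16 * ln (real (den (cf_digit \<alpha>) k))"
    proof -
      have "16 * E / \<delta> \<le> ln (real (den (cf_digit \<alpha>) k))" using lnQ by simp
      then show ?thesis using \<delta>0 by (simp add: field_simps)
    qed
    define M where "M = nat \<lfloor>\<epsilon> * real (cf_digit \<alpha> (Suc k)) * real (den (cf_digit \<alpha>) k)\<rfloor>"
    have par: "(- 1) ^ k = ((- 1) ^ e :: real)"
    proof (cases "even k")
      case True
      then have "e = 0" using k(2) by auto
      then show ?thesis using True by simp
    next
      case False
      then have "e = 1" using k(2) by (metis odd_iff_mod_2_eq_one)
      then show ?thesis using False by simp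
    qed
    have est: "rhs r \<alpha> N \<le> (- 1) ^ k * sgn (B - A) * S_N f \<alpha> q N \<and> k \<le> M"
      if N: "(1 - r) * real M \<le> real N" "N \<le> M" for N
      using good_index_estimate[OF lf T f If \<alpha> \<beta> d r \<epsilon>, where k = k and L = L and N = N,
          folded D_def \<delta>_def, folded C1_def, OF \<delta>0 \<epsilon>D kge(4) k(3,4) k0[OF kge(2)]]
        L lnQ E_le N unfolding rhs_def C_def \<kappa>_def M_def E_def by simp
    have "k \<le> M" using est[of M] r mult_right_mono[of "1 - r" 1 "real M"] by simp
    then show ?thesis using est par kge(1) by (intro exI[of _ M]) auto
  qed
  have "AE \<alpha> in lborel. \<alpha> \<in> {0..<1} \<and> \<alpha> \<notin> \<rat> \<longrightarrow>
      (\<forall>r. 0 < r \<and> r < 1 \<longrightarrow> ereal r \<le> upper_density {N. rhs r \<alpha> N \<le> S_N f \<alpha> q N}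
        \<and> ereal r \<le> upper_density {N. rhs r \<alpha> N \<le> - S_N f \<alpha> q N})"
    using AE_good[OF d] AE_digit_bound
  proof eventually_elim
    case (elim \<alpha>)
    show ?case
    proof (intro impI allI)
      fix r :: real assume a: "\<alpha> \<in> {0..<1} \<and> \<alpha> \<notin> \<rat>" and r: "0 < r \<and> r < 1"
      have "\<alpha> \<noteq> 0" using a by (metis Rats_0)
      then have \<alpha>: "\<alpha> \<in> Irr" using a by (auto simp: Irr_def)
      have win: "\<exists>M\<ge>n. \<forall>N. (1 - r) * real M \<le> real N \<longrightarrow> N \<le> M \<longrightarrow> rhs r \<alpha> N \<le> (- 1) ^ e * sgn (B - A) * S_N f \<alpha> q N"
        if "e \<le> 1" for e n
        using windows[OF \<alpha> _ _ that] r elim \<alpha> by blast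
      have sg: "sgn (B - A) = 1 \<or> sgn (B - A) = - 1" using \<delta>0 by (auto simp: \<delta>_def sgn_real_def)
      \<comment> \<open>Either sign of \<open>S_N\<close> is reached by choosing the parity of the
        good index to match the sign of \<open>B - A\<close>.\<close>
      have "\<exists>e\<le>1. (- 1) ^ e * sgn (B - A) = s" if "s = 1 \<or> s = - 1" for s :: real
      proof (cases "sgn (B - A) = s")
        case True
        then show ?thesis by (intro exI[of _ 0]) simp
      next
        case False
        then show ?thesis using sg that by (intro exI[of _ 1]) auto
      qed
      then have win': "\<exists>M\<ge>n. \<forall>N. (1 - r) * real M \<le> real N \<longrightarrow> N \<le> M \<longrightarrow> rhs r \<alpha> N \<le> s * S_N f \<alpha> q N"
        if "s = 1 \<or> s = - 1" for s n using win that by metis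
      show "ereal r \<le> upper_density {N. rhs r \<alpha> N \<le> S_N f \<alpha> q N}
        \<and> ereal r \<le> upper_density {N. rhs r \<alpha> N \<le> - S_N f \<alpha> q N}"
        using r win'[of 1] win'[of "- 1"] by (auto intro!: upper_density_ge)
    qed
  qed
  moreover have "rhs r \<alpha> N \<le> - S_N f \<alpha> q N \<longleftrightarrow> S_N f \<alpha> q N \<le>
            - C r * (SUP x\<in>outside_A x1 (gmin \<alpha> q x1 N). \<bar>f x\<bar>)
                * real (\<Sum>i=1..cf_K \<alpha> N. cf_digit \<alpha> i)
            - real N * \<bar>integral {x1 - gmin \<alpha> q x1 N <..< x1 + gmin \<alpha> q x1 N} f\<bar>" for r \<alpha> N
    unfolding rhs_def mult_minus_left by linarith
  ultimately show ?thesis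
    using Cpos unfolding rhs_def by (intro exI[of _ C]) simp
qed

end
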